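(* Let $(\mathbf X_t)_{t\ge 0}$ be a multi-type CBI process with parameters $(d,\mathbf c,\boldsymbol\beta,\mathbf B,\nu,\boldsymbol\mu)$ such that $\int_{\mathcal U_d}\|\mathbf r\|\,\mathbf 1_{\{\|\mathbf r\|\ge 1\}}\,\nu(\mathrm d\mathbf r)<\infty$. (i) For all $r>0$, $t>0$ and $\mathbf x=(x_1,\dots,x_d)^\top\in\mathbb R_+^d$, we have $\mathbb P(J_t(\overline K_r^c)<\infty)=1$, and $$\mathbb P_{\mathbf x}\Big(\sup_{s\in(0,t]}\|\Delta\mathbf X_s\|\le r\Big)=\exp\Big\{-\nu(\overline K_r^c)t-\sum_{\ell=1}^dx_\ell\,\tilde v_\ell^{(\overline K_r^c)}(t,\boldsymbol\mu(\overline K_r^c))-\int_0^t\psi^{(\overline K_r^c)}\big(\tilde{\mathbf v}^{(\overline K_r^c)}(s,\boldsymbol\mu(\overline K_r^c))\big)\,\mathrm ds\Big\}.$$ (ii) If, in addition, $\nu(\mathcal U_d)+\sum_{i=1}^d\mu_i(\mathcal U_d)<\infty$, then for all $t>0$ and $\mathbf x=(x_1,\dots,x_d)^\top\in\mathbb R_+^d$, we have $\mathbb P(J_t(\mathcal U_d)<\infty)=1$ and $$\mathbb P_{\mathbf x}\Big(\sup_{s\in(0,t]}\|\Delta\mathbf X_s\|=0\Big)=\exp\Big\{-\nu(\mathcal U_d)t-\sum_{\ell=1}^dx_\ell\,\tilde v_\ell^{(\mathcal U_d)}(t,\boldsymbol\mu(\mathcal U_d))-\int_0^t\big\langle\boldsymbol\beta,\tilde{\mathbf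 v}^{(\mathcal U_d)}(s,\boldsymbol\mu(\mathcal U_d))\big\rangle\,\mathrm ds\Big\}.$$ Here $\tilde{\mathbf v}^{(A)}(\cdot,\boldsymbol\mu(A))$ and $\psi^{(A)}$, for $A=\overline K_r^c$ and $A=\mathcal U_d$ respectively, are the functions defined in the context.
   Context: Notation. $\mathbb R_+=[0,\infty)$, $\mathcal U_d=\mathbb R_+^d\setminus\{\mathbf 0\}$, $\mathcal B(\mathcal U_d)$ its Borel $\sigma$-algebra, $\|\cdot\|$ is the Euclidean norm, $\langle\cdot,\cdot\rangle$ the Euclidean inner product, $a\wedge b=\min\{a,b\}$, $\mathbf e^{(d)}_1,\dots,\mathbf e^{(d)}_d$ is the natural basis of $\mathbb R^d$; $\partial_1$ is the partial derivative in the first variable. For $r>0$: $K_r=\{\mathbf y\in\mathbb R_+^d:\|\mathbf y\|<r\}$, $\overline K_r$ is its closure, and $\overline K_r^c:=\mathcal U_d\setminus\overline K_r$. Admissible parameters. $(d,\mathbf c,\boldsymbol\beta,\mathbf B,\nu,\boldsymbol\mu)$ is a set of admissible parameters if $d\in\mathbb N$ is a positive integer; $\mathbf c=(c_i)_{i=1}^d\in\mathbb R_+^d$; $\boldsymbol\beta=(\beta_i)_{i=1}^d\in\mathbb R_+^d$; $\mathbf B=(b_{i,j})_{i,j=1}^d\in\mathbb R^{d\times d}$ with $b_{i,j}\ge 0$ for $i\ne j$; $\nu$ is a Borel measure on $\mathcal U_d$ with $\int_{\mathcal U_d}(1\wedge\|\mathbf r\|)\,\nu(\mathrm d\mathbf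 r)<\infty$; and $\boldsymbol\mu=(\mu_1,\dots,\mu_d)$, where each $\mu_i$ is a Borel measure on $\mathcal U_d$ with $\int_{\mathcal U_d}\big[\|\mathbf z\|\wedge\|\mathbf z\|^2+\sum_{j\ne i}(1\wedge z_j)\big]\mu_i(\mathrm d\mathbf z)<\infty$. CBI process. The branching mechanism $\boldsymbol\varphi=(\varphi_1,\dots,\varphi_d):\mathbb R_+^d\to\mathbb R^d$ and immigration mechanism $\psi:\mathbb R_+^d\to\mathbb R_+$ are $$\varphi_i(\boldsymbol\lambda)=c_i\lambda_i^2-\langle\mathbf B\mathbf e_i^{(d)},\boldsymbol\lambda\rangle+\int_{\mathcal U_d}\big(\mathrm e^{-\langle\boldsymbol\lambda,\mathbf z\rangle}-1+\lambda_i(1\wedge z_i)\big)\mu_i(\mathrm d\mathbf z),\qquad \psi(\boldsymbol\lambda)=\langle\boldsymbol\beta,\boldsymbol\lambda\rangle+\int_{\mathcal U_d}\big(1-\mathrm e^{-\langle\boldsymbol\lambda,\mathbf r\rangle}\big)\nu(\mathrm d\mathbf r).$$ A multi-type CBI process with parameters $(d,\mathbf c,\boldsymbol\beta,\mathbf B,\nu,\boldsymbol\mu)$ (admissible) is a conservative (time-homogeneous) Markov process with state space $\mathbb R_+^d$ whose transition semigroup $(P_t)_{t\ge0}$ is the unique one with $$\int_{\mathbb R_+^d}\mathrm e^{-\langle\boldsymbol\lambda,\mathbf y\rangle}P_t(\mathbf x,\mathrm d\mathbf y)=\exp\Big\{-\langle\mathbf x,\mathbf v(t,\boldsymbol\lambda)\rangle-\int_0^t\psi(\mathbf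 v(s,\boldsymbol\lambda))\,\mathrm ds\Big\},\qquad \mathbf x,\boldsymbol\lambda\in\mathbb R_+^d,\ t\ge0,$$ where $t\mapsto\mathbf v(t,\boldsymbol\lambda)\in\mathbb R_+^d$ is the unique locally bounded (continuously differentiable) solution of $\partial_1 v_i(t,\boldsymbol\lambda)=-\varphi_i(\mathbf v(t,\boldsymbol\lambda))$, $v_i(0,\boldsymbol\lambda)=\lambda_i$, $i=1,\dots,d$. The process is taken to have càdlàg sample paths. $\mathbb P_{\mathbf x}$ denotes $\mathbb P(\,\cdot\mid\mathbf X_0=\mathbf x)$, i.e. the law of the process started from $\mathbf x$. Jumps. $\Delta\mathbf X_u=\mathbf X_u-\mathbf X_{u-}$ for $u>0$, and $J_t(A):=\mathrm{card}(\{u\in(0,t]:\Delta\mathbf X_u\in A\})$ for $A\in\mathcal B(\mathcal U_d)$, $t>0$. Functions associated with $A$. For $A\in\mathcal B(\mathcal U_d)$ with $\nu(A)+\sum_{\ell=1}^d\mu_\ell(A)<\infty$ (which holds for $A=\overline K_r^c$, $r>0$): $\boldsymbol\mu(A):=(\mu_1(A),\dots,\mu_d(A))$; $\psi^{(A)}(\boldsymbol\lambda):=\langle\boldsymbol\beta,\boldsymbol\lambda\rangle+\int_{\mathcal U_d\setminus A}(1-\mathrm e^{-\langle\boldsymbol\lambda,\mathbf r\rangle})\,\nu(\mathrm d\mathbf r)$; $\varphi^{(A)}_\ell(\boldsymbol\lambda):=\varphi_\ell(\boldsymbol\lambda)+\int_A(1-\mathrm e^{-\langle\boldsymbol\lambda,\mathbf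 z\rangle})\,\mu_\ell(\mathrm d\mathbf z)$, $\boldsymbol\lambda\in\mathbb R_+^d$; and the continuously differentiable function $\mathbb R_+\ni t\mapsto\tilde{\mathbf v}^{(A)}(t,\boldsymbol\mu(A))=(\tilde v^{(A)}_1(t,\boldsymbol\mu(A)),\dots,\tilde v^{(A)}_d(t,\boldsymbol\mu(A)))^\top\in\mathbb R_+^d$ is the unique locally bounded solution of $\partial_1\tilde v_i^{(A)}(t,\boldsymbol\mu(A))=\mu_i(A)-\varphi_i^{(A)}(\tilde{\mathbf v}^{(A)}(t,\boldsymbol\mu(A)))$, $\tilde v_i^{(A)}(0,\boldsymbol\mu(A))=0$, $i\in\{1,\dots,d\}$. *)

theory Defs
  imports "HOL-Probability.Probability"
begin

text \<open>The dimension \<open>d\<close> is the cardinality of the finite index type \<open>'n\<close>; it is nonempty, so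
  \<open>d \<ge> 1\<close> automatically.\<close>

definition orthant :: "(real ^ 'n) set" where
  "orthant = {x. \<forall>i. 0 \<le> x $ i}"

definition punctured_orthant :: "(real ^ 'n) set" where
  "punctured_orthant = orthant - {0}"

definition K :: "real \<Rightarrow> (real ^ 'n::finite) set" where
  "K r = {y \<in> orthant. norm y < r}"

definition Kc :: "real \<Rightarrow> (real ^ 'n::finite) set" where
  "Kc r = punctured_orthant - closure (K r)"

definition admissible ::
  "real ^ 'n::finite \<Rightarrow> real ^ 'n \<Rightarrow> real ^ 'n ^ 'n \<Rightarrow> (real ^ 'n) measure
    \<Rightarrow> ('n \<Rightarrow> (real ^ 'n) measure) \<Rightarrow> bool" where
  "admissible c \<beta> B \<nu> \<mu> \<longleftrightarrow>
     c \<in> orthant \<and> \<beta> \<in> orthant \<and> (\<forall>i j. i \<noteq> j \<longrightarrow> 0 \<le> B $ i $ j) \<and>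
     sets \<nu> = sets (restrict_space borel punctured_orthant) \<and>
     (\<integral>\<^sup>+ r. ennreal (min 1 (norm r)) \<partial>\<nu>) < \<infinity> \<and>
     (\<forall>i. sets (\<mu> i) = sets (restrict_space borel punctured_orthant) \<and>
       (\<integral>\<^sup>+ z. ennreal (min (norm z) ((norm z)\<^sup>2) + (\<Sum>j\<in>UNIV - {i}. min 1 (z $ j))) \<partial>\<mu> i) < \<infinity>)"

definition \<phi> ::
  "real ^ 'n::finite \<Rightarrow> real ^ 'n ^ 'n \<Rightarrow> ('n \<Rightarrow> (real ^ 'n) measure) \<Rightarrow> 'n \<Rightarrow> real ^ 'n \<Rightarrow> real" where
  "\<phi> c B \<mu> i u = c $ i * (u $ i)\<^sup>2 - (B *v axis i 1) \<bullet> u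
     + (LINT z|\<mu> i. exp (- (u \<bullet> z)) - 1 + u $ i * min 1 (z $ i))"

definition \<psi> :: "real ^ 'n::finite \<Rightarrow> (real ^ 'n) measure \<Rightarrow> real ^ 'n \<Rightarrow> real" where
  "\<psi> \<beta> \<nu> u = \<beta> \<bullet> u + (LINT r|\<nu>. 1 - exp (- (u \<bullet> r)))"

definition \<phi>_trunc ::
  "real ^ 'n::finite \<Rightarrow> real ^ 'n ^ 'n \<Rightarrow> ('n \<Rightarrow> (real ^ 'n) measure) \<Rightarrow> (real ^ 'n) set
    \<Rightarrow> 'n \<Rightarrow> real ^ 'n \<Rightarrow> real" where
  "\<phi>_trunc c B \<mu> A i u = \<phi> c B \<mu> i u + (LINT z:A|\<mu> i. 1 - exp (- (u \<bullet> z)))"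

definition \<psi>_trunc ::
  "real ^ 'n::finite \<Rightarrow> (real ^ 'n) measure \<Rightarrow> (real ^ 'n) set \<Rightarrow> real ^ 'n \<Rightarrow> real" where
  "\<psi>_trunc \<beta> \<nu> A u = \<beta> \<bullet> u + (LINT r:punctured_orthant - A|\<nu>. 1 - exp (- (u \<bullet> r)))"

text \<open>\<open>orthant_solution F a v\<close>: the function \<open>v\<close>, restricted to \<open>[0, \<infinity>)\<close>, is a locally bounded
  orthant-valued solution of \<open>v\<^sub>i' = F\<^sub>i(v)\<close>, \<open>v 0 = a\<close>. The derivative at \<open>0\<close> is one-sided,
  and the values of \<open>v\<close> at negative times are irrelevant.\<close>

definition orthant_solution ::
  "('n \<Rightarrow> real ^ 'n \<Rightarrow> real) \<Rightarrow> real ^ 'n::finite \<Rightarrow> (real \<Rightarrow> real ^ 'n) \<Rightarrow> bool" where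
  "orthant_solution F a v \<longleftrightarrow>
     v 0 = a \<and> (\<forall>t\<ge>0. v t \<in> orthant) \<and> (\<forall>T\<ge>0. bounded (v ` {0..T})) \<and>
     (\<forall>t\<ge>0. \<forall>i. ((\<lambda>s. v s $ i) has_real_derivative F i (v t)) (at t within {0..}))"

definition is_v ::
  "real ^ 'n::finite \<Rightarrow> real ^ 'n ^ 'n \<Rightarrow> ('n \<Rightarrow> (real ^ 'n) measure) \<Rightarrow> real ^ 'n
    \<Rightarrow> (real \<Rightarrow> real ^ 'n) \<Rightarrow> bool" where
  "is_v c B \<mu> u v \<longleftrightarrow> orthant_solution (\<lambda>i y. - \<phi> c B \<mu> i y) u v"

definition is_v_tilde ::
  "real ^ 'n::finite \<Rightarrow> real ^ 'n ^ 'n \<Rightarrow> ('n \<Rightarrow> (real ^ 'n) measure) \<Rightarrow> (real ^ 'n) set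
    \<Rightarrow> (real \<Rightarrow> real ^ 'n) \<Rightarrow> bool" where
  "is_v_tilde c B \<mu> A w \<longleftrightarrow>
     orthant_solution (\<lambda>i y. measure (\<mu> i) A - \<phi>_trunc c B \<mu> A i y) 0 w"

abbreviation state_algebra :: "(real ^ 'n::finite) measure" where
  "state_algebra \<equiv> restrict_space borel orthant"

definition transition_semigroup ::
  "(real \<Rightarrow> real ^ 'n::finite \<Rightarrow> (real ^ 'n) measure) \<Rightarrow> bool" where
  "transition_semigroup P \<longleftrightarrow>
     (\<forall>t\<ge>0. P t \<in> state_algebra \<rightarrow>\<^sub>M prob_algebra state_algebra) \<and>
     (\<forall>x\<in>orthant. P 0 x = return state_algebra x) \<and>
     (\<forall>s\<ge>0. \<forall>t\<ge>0. \<forall>x\<in>orthant. P (s + t) x = P s x \<bind> P t)"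

definition cbi_semigroup ::
  "real ^ 'n::finite \<Rightarrow> real ^ 'n \<Rightarrow> real ^ 'n ^ 'n \<Rightarrow> (real ^ 'n) measure
    \<Rightarrow> ('n \<Rightarrow> (real ^ 'n) measure) \<Rightarrow> (real \<Rightarrow> real ^ 'n \<Rightarrow> (real ^ 'n) measure) \<Rightarrow> bool" where
  "cbi_semigroup c \<beta> B \<nu> \<mu> P \<longleftrightarrow> transition_semigroup P \<and>
     (\<forall>u\<in>orthant. \<exists>v. is_v c B \<mu> u v \<and>
       (\<forall>x\<in>orthant. \<forall>t\<ge>0. (LINT y|P t x. exp (- (u \<bullet> y)))
          = exp (- (x \<bullet> v t) - integral {0..t} (\<lambda>s. \<psi> \<beta> \<nu> (v s)))))"

definition natural_filtration ::
  "'w measure \<Rightarrow> (real \<Rightarrow> 'w \<Rightarrow> real ^ 'n::finite) \<Rightarrow> real \<Rightarrow> 'w measure" where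
  "natural_filtration M X s =
     sigma (space M) {X u -` A \<inter> space M | u A. u \<in> {0..s} \<and> A \<in> sets state_algebra}"

definition markov_process ::
  "(real \<Rightarrow> real ^ 'n::finite \<Rightarrow> (real ^ 'n) measure) \<Rightarrow> 'w measure
    \<Rightarrow> (real \<Rightarrow> 'w \<Rightarrow> real ^ 'n) \<Rightarrow> bool" where
  "markov_process P M X \<longleftrightarrow> prob_space M \<and>
     (\<forall>t\<ge>0. X t \<in> M \<rightarrow>\<^sub>M state_algebra) \<and>
     (\<forall>s\<ge>0. \<forall>t\<ge>0. \<forall>A\<in>sets state_algebra. AE \<omega> in M.
        real_cond_exp M (natural_filtration M X s) (\<lambda>\<omega>. indicator A (X (s + t) \<omega>)) \<omega>
          = measure (P t (X s \<omega>)) A)"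

definition cadlag :: "(real \<Rightarrow> real ^ 'n::finite) \<Rightarrow> bool" where
  "cadlag f \<longleftrightarrow> (\<forall>t\<ge>0. continuous (at_right t) f) \<and> (\<forall>t>0. \<exists>l. (f \<longlongrightarrow> l) (at_left t))"

text \<open>A CBI process with an arbitrary initial distribution.\<close>

definition cbi_process ::
  "real ^ 'n::finite \<Rightarrow> real ^ 'n \<Rightarrow> real ^ 'n ^ 'n \<Rightarrow> (real ^ 'n) measure
    \<Rightarrow> ('n \<Rightarrow> (real ^ 'n) measure) \<Rightarrow> 'w measure \<Rightarrow> (real \<Rightarrow> 'w \<Rightarrow> real ^ 'n) \<Rightarrow> bool" where
  "cbi_process c \<beta> B \<nu> \<mu> M X \<longleftrightarrow> admissible c \<beta> B \<nu> \<mu> \<and>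
     (\<exists>P. cbi_semigroup c \<beta> B \<nu> \<mu> P \<and> markov_process P M X) \<and>
     (\<forall>\<omega>\<in>space M. cadlag (\<lambda>t. X t \<omega>))"

text \<open>\<open>M\<close> plays the role of \<open>\<P>\<^sub>x\<close>: under it, \<open>X\<close> is a CBI process started from \<open>x\<close>.\<close>

definition cbi_process_from ::
  "real ^ 'n::finite \<Rightarrow> real ^ 'n \<Rightarrow> real ^ 'n ^ 'n \<Rightarrow> (real ^ 'n) measure
    \<Rightarrow> ('n \<Rightarrow> (real ^ 'n) measure) \<Rightarrow> real ^ 'n \<Rightarrow> 'w measure \<Rightarrow> (real \<Rightarrow> 'w \<Rightarrow> real ^ 'n) \<Rightarrow> bool" where
  "cbi_process_from c \<beta> B \<nu> \<mu> x M X \<longleftrightarrow>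
     cbi_process c \<beta> B \<nu> \<mu> M X \<and> (AE \<omega> in M. X 0 \<omega> = x)"

definition jump :: "(real \<Rightarrow> 'w \<Rightarrow> real ^ 'n::finite) \<Rightarrow> real \<Rightarrow> 'w \<Rightarrow> real ^ 'n" where
  "jump X u \<omega> = X u \<omega> - Lim (at_left u) (\<lambda>s. X s \<omega>)"

text \<open>The counting measure makes an infinite number of jumps count as \<open>\<infinity>\<close>, whereas
  \<^const>\<open>card\<close> would give \<open>0\<close>.\<close>

definition J ::
  "(real \<Rightarrow> 'w \<Rightarrow> real ^ 'n::finite) \<Rightarrow> real \<Rightarrow> (real ^ 'n) set \<Rightarrow> 'w \<Rightarrow> ennreal" where
  "J X t A \<omega> = emeasure (count_space UNIV) {u \<in> {0<..t}. jump X u \<omega> \<in> A}"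

text \<open>The supremum is taken in the extended reals, so that it is meaningful without a
  boundedness argument.\<close>

definition sup_jump :: "(real \<Rightarrow> 'w \<Rightarrow> real ^ 'n::finite) \<Rightarrow> real \<Rightarrow> 'w \<Rightarrow> ereal" where
  "sup_jump X t \<omega> = (SUP s\<in>{0<..t}. ereal (norm (jump X s \<omega>)))"

end

theory Submission
  imports Defs
begin

text \<open>
  Why the formulas hold. Fix \<open>r\<close>, let \<open>A\<close> be the set of jumps of norm greater than \<open>r\<close>, and let \<open>w\<close> be the
  solution of the equation for \<open>A\<close>. The right-hand side of the formula, as a function \<open>u s x\<close> of time and
  starting point (\<open>survival\<close>), is an exponential whose exponent is affine in \<open>x\<close>, and it should be the
  probability of having no jump in \<open>A\<close> up to time \<open>s\<close>. Differentiating, \<open>u\<close> solves the backward equation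
  \<open>u' = G u - (\<integral> of 1\<^sub>A(z) u(x + z) over the jump kernel \<nu> + \<Sum> x\<^sub>l \<mu>\<^sub>l)\<close>, where \<open>G\<close> is the generator of the
  process; it is the equation of the process killed at its first jump in \<open>A\<close>.

  The semigroup is given by its Laplace transform. The jump kernel is read off from the transition kernels for
  small times (\<open>small_time_rate_cutoff\<close>): for continuous \<open>g\<close> vanishing near \<open>0\<close> and constant for large
  arguments, the mean of \<open>g\<close> over the increment of the process in time \<open>h\<close> is \<open>h\<close> times the integral of \<open>g\<close>
  over the jump kernel, up to \<open>o(h)\<close>, uniformly for bounded starting points. For the product of an exponential
  sum with \<open>flat_weight\<close>, which has a zero of order four at \<open>0\<close>, this is a fourth difference of the small-time
  expansion of the Laplace transform; the fourth difference removes the drift and diffusion parts of \<open>\<phi>\<close> and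
  leaves the jump part (\<open>symbol_alternating\<close>). The passage to \<open>g\<close> is the Stone-Weierstrass theorem in the
  variables \<open>exp (- z\<^sub>i)\<close>, which live in a compact cube.

  Consequently one step of length \<open>h\<close> of the chain killed at large increments maps \<open>u s\<close> to \<open>u (s + h)\<close> up to
  \<open>o(h)\<close> and an error from replacing the indicator of \<open>A\<close> by a cutoff function (\<open>killed_one_step\<close>), and the
  errors of the \<open>n\<close> steps of length \<open>t / n\<close> add up to something small (\<open>grid_survival\<close>). All estimates are
  uniform only on bounded sets, so paths that leave a ball are discarded; as cadlag paths are bounded on
  compact intervals, this costs a probability that tends to \<open>0\<close> as the radius grows. Finally the large
  increments along a fine grid of a cadlag path are the large jumps of the path, and the cutoff functions
  increase to the indicator of the vectors of norm greater than \<open>r\<close>; a sandwich argument identifies the limit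
  with the probability of having no such jump (\<open>prob_no_jump\<close>). Since the kernels see increments in all
  directions, jumps out of the orthant are covered as well.

  A cadlag path has finitely many jumps of norm greater than \<open>r > 0\<close> in a bounded interval. If \<open>\<nu>\<close> and the
  \<open>\<mu>\<^sub>i\<close> are finite, the same one-step estimate bounds the expected number of jumps of a path kept in a ball in
  terms of the total mass of the jump kernel (\<open>expected_jump_count\<close>). So there are finitely many jumps of
  any size almost surely, and the case \<open>r = 0\<close> of the formula applies.
\<close>

section \<open>Jumps of cadlag paths\<close>

definition path_jump :: "(real \<Rightarrow> 'a::real_normed_vector) \<Rightarrow> real \<Rightarrow> 'a" where
  "path_jump f u = f u - Lim (at_left u) f"

lemma jump_eq_path_jump: "jump X u \<omega> = path_jump (\<lambda>s. X s \<omega>) u"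
  by (simp add: jump_def path_jump_def)

lemma cadlag_left_limit:
  assumes "cadlag f" "0 < u"
  shows "(f \<longlongrightarrow> f u - path_jump f u) (at_left u)"
proof -
  obtain l where l: "(f \<longlongrightarrow> l) (at_left u)"
    using assms unfolding cadlag_def by blast
  then have "Lim (at_left u) f = l"
    by (intro tendsto_Lim) auto
  with l show ?thesis by (simp add: path_jump_def)
qed

lemma cadlag_left_nbhd:
  assumes "cadlag f" "0 < u" "0 < e"
  obtains d where "0 < d" "\<And>s. u - d < s \<Longrightarrow> s < u \<Longrightarrow> dist (f s) (f u - path_jump f u) < e"
proof -
  have "eventually (\<lambda>s. dist (f s) (f u - path_jump f u) < e) (at_left u)"
    using cadlag_left_limit[OF assms(1,2)] assms(3) by (rule tendstoD)
  then obtain b where "b < u" "\<And>s. b < s \<Longrightarrow> s < u \<Longrightarrow> dist (f s) (f u - path_jump f u) < e"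
    unfolding eventually_at_left_field by blast
  then show ?thesis by (intro that[of "u - b"]) auto
qed

lemma cadlag_right_nbhd:
  assumes "cadlag f" "0 \<le> u" "0 < e"
  obtains d where "0 < d" "\<And>s. u \<le> s \<Longrightarrow> s < u + d \<Longrightarrow> dist (f s) (f u) < e"
proof -
  have "continuous (at_right u) f" using assms unfolding cadlag_def by blast
  then have "(f \<longlongrightarrow> f u) (at_right u)" by (simp add: continuous_within)
  then have "eventually (\<lambda>s. dist (f s) (f u) < e) (at_right u)"
    using assms(3) by (rule tendstoD)
  then obtain b where b: "b > u" "\<And>s. u < s \<Longrightarrow> s < b \<Longrightarrow> dist (f s) (f u) < e"
    unfolding eventually_at_right_field by blast
  show ?thesis
  proof (rule that[of "b - u"])
    fix s assume "u \<le> s" "s < u + (b - u)"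
    then show "dist (f s) (f u) < e" using b assms(3) by (cases "s = u") auto
  qed (use b in auto)
qed

text \<open>Both one-sided limits exist, so an increment over a short interval close to \<open>u\<close> is small if the interval
  lies on one side of \<open>u\<close>, and is close to the jump at \<open>u\<close> if the interval contains \<open>u\<close>.\<close>

lemma cadlag_increment_dichotomy:
  assumes f: "cadlag f" and u: "0 \<le> u" and e: "0 < e"
  obtains d where "0 < d"
    "\<And>s s'. 0 \<le> s \<Longrightarrow> s \<le> s' \<Longrightarrow> u - d < s \<Longrightarrow> s' < u + d \<Longrightarrow>
       norm (f s' - f s) < e \<or> (s < u \<and> u \<le> s' \<and> dist (f s' - f s) (path_jump f u) < e)"
proof -
  obtain d1 where d1: "0 < d1" "\<And>s. u \<le> s \<Longrightarrow> s < u + d1 \<Longrightarrow> dist (f s) (f u) < e/2"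
    using cadlag_right_nbhd[OF f u, of "e/2"] e by (metis half_gt_zero)
  obtain d2 where d2: "0 < d2"
    "\<And>s. 0 \<le> s \<Longrightarrow> u - d2 < s \<Longrightarrow> s < u \<Longrightarrow> dist (f s) (f u - path_jump f u) < e/2"
  proof (cases "u = 0")
    case True then show ?thesis by (intro that[of 1]) auto
  next
    case False
    then show ?thesis using cadlag_left_nbhd[OF f, of u "e/2"] u e that
      by (metis half_gt_zero less_eq_real_def)
  qed
  show ?thesis
  proof (rule that[of "min d1 d2"])
    fix s s' assume s: "0 \<le> s" "s \<le> s'" "u - min d1 d2 < s" "s' < u + min d1 d2"
    consider "u \<le> s" | "s' < u" | "s < u" "u \<le> s'" by linarith
    then show "norm (f s' - f s) < e \<or> (s < u \<and> u \<le> s' \<and> dist (f s' - f s) (path_jump f u) < e)"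
    proof cases
      case 1
      then have "dist (f s) (f u) < e/2" "dist (f s') (f u) < e/2" using s d1 by auto
      then have "dist (f s') (f s) < e" by (meson dist_triangle_half_l)
      then show ?thesis by (simp add: dist_norm)
    next
      case 2
      then have "dist (f s) (f u - path_jump f u) < e/2" "dist (f s') (f u - path_jump f u) < e/2"
        using s d2(2) by auto
      then have "dist (f s') (f s) < e" by (meson dist_triangle_half_l)
      then show ?thesis by (simp add: dist_norm)
    next
      case 3
      then have a: "norm (f s - (f u - path_jump f u)) < e/2" "norm (f s' - f u) < e/2"
        using s d1(2)[of s'] d2(2)[of s] by (auto simp: dist_norm)
      have eq: "f s' - f s - path_jump f u = (f s' - f u) - (f s - (f u - path_jump f u))" by simp
      have "norm (f s' - f s - path_jump f u) \<le> norm (f s' - f u) + norm (f s - (f u - path_jump f u))"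
        unfolding eq by (rule norm_triangle_ineq4)
      with a have "dist (f s' - f s) (path_jump f u) < e"
        unfolding dist_norm by linarith
      then show ?thesis using 3 by simp
    qed
  qed (use d1 d2 in auto)
qed

text \<open>The shrinking intervals accumulate at some time \<open>u\<close>, and by the dichotomy the increments over them are either
  small, which \<open>0 \<notin> A\<close> excludes, or close to the jump at \<open>u\<close>, which therefore lies in the closed set \<open>A\<close>.\<close>

lemma cadlag_jump_of_increments:
  fixes f :: "real \<Rightarrow> real ^ 'n::finite"
  assumes f: "cadlag f" and a: "0 \<le> a" and A: "closed A" "0 \<notin> A"
    and s: "\<And>m. a \<le> s m" "\<And>m. s m \<le> s' m" "\<And>m. s' m \<le> b"
    and small: "(\<lambda>m. s' m - s m) \<longlonglongrightarrow> 0"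
    and near: "\<And>m::nat. \<exists>z\<in>A. dist z (f (s' m) - f (s m)) < 1 / Suc m"
  shows "\<exists>u\<in>{a<..b}. path_jump f u \<in> A"
proof (rule ccontr)
  assume no: "\<not> ?thesis"
  have "\<forall>m. s m \<in> {a..b}" using s order_trans by (metis atLeastAtMost_iff)
  then obtain u r where u: "u \<in> {a..b}" "strict_mono r" "(s \<circ> r) \<longlonglongrightarrow> u"
    using compact_Icc[of a b] unfolding compact_def by blast
  have s1: "(\<lambda>m. s (r m)) \<longlonglongrightarrow> u" using u(3) by (simp add: o_def)
  have "(\<lambda>m. s' (r m) - s (r m)) \<longlonglongrightarrow> 0"
    using LIMSEQ_subseq_LIMSEQ[OF small u(2)] by (simp add: o_def)
  from tendsto_add[OF this s1] have s2: "(\<lambda>m. s' (r m)) \<longlonglongrightarrow> u" by simp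
  have u0: "0 \<le> u" using u a by auto
  obtain e1 where e1: "e1 > 0" "\<And>z. z \<in> A \<Longrightarrow> e1 \<le> norm z"
    using separate_point_closed[OF A] by (metis dist_0_norm)
  obtain e2 where e2: "e2 > 0" "u > a \<longrightarrow> (\<forall>z\<in>A. e2 \<le> dist (path_jump f u) z)"
  proof (cases "u > a")
    case True
    then have "path_jump f u \<notin> A" using no u by auto
    then obtain e where "e > 0" "\<And>z. z \<in> A \<Longrightarrow> e \<le> dist (path_jump f u) z"
      using separate_point_closed[OF A(1)] by metis
    then show ?thesis using that[of e] by blast
  next
    case False then show ?thesis using that[of 1] by auto
  qed
  define e where "e = min e1 e2 / 2"
  have e: "e > 0" using e1 e2 by (simp add: e_def)
  obtain d where d: "0 < d"
    "\<And>s s'. 0 \<le> s \<Longrightarrow> s \<le> s' \<Longrightarrow> u - d < s \<Longrightarrow> s' < u + d \<Longrightarrow>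
       norm (f s' - f s) < e \<or> (s < u \<and> u \<le> s' \<and> dist (f s' - f s) (path_jump f u) < e)"
    using cadlag_increment_dichotomy[OF f u0 e] by blast
  have "eventually (\<lambda>m. u - d < s (r m)) sequentially"
    using s1 d(1) by (intro order_tendstoD(1)[OF s1]) auto
  moreover have "eventually (\<lambda>m. s' (r m) < u + d) sequentially"
    using d(1) by (intro order_tendstoD(2)[OF s2]) auto
  moreover have "eventually (\<lambda>m. 1 / real (Suc m) < e) sequentially"
    using e by (intro order_tendstoD(2)[OF LIMSEQ_Suc[OF lim_1_over_n]])
  ultimately have "eventually (\<lambda>m. u - d < s (r m) \<and> s' (r m) < u + d \<and> 1 / real (Suc m) < e) sequentially"
    by eventually_elim auto
  then obtain m where m: "u - d < s (r m)" "s' (r m) < u + d" "1 / real (Suc m) < e"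
    using eventually_happens by fastforce
  have "r m \<ge> m" using u(2) by (rule seq_suble)
  then have "1 / real (Suc (r m)) \<le> 1 / real (Suc m)" by (simp add: frac_le)
  moreover obtain z where z: "z \<in> A" "dist z (f (s' (r m)) - f (s (r m))) < 1 / Suc (r m)"
    using near by blast
  ultimately have z': "dist z (f (s' (r m)) - f (s (r m))) < e" using m by linarith
  from d(2)[of "s (r m)" "s' (r m)"] m s a
  have "norm (f (s' (r m)) - f (s (r m))) < e \<or>
        (s (r m) < u \<and> dist (f (s' (r m)) - f (s (r m))) (path_jump f u) < e)"
    by (meson order_trans)
  then show False
  proof
    assume "norm (f (s' (r m)) - f (s (r m))) < e"
    then have "dist z 0 < e + e"
      using z' dist_triangle[of z 0 "f (s' (r m)) - f (s (r m))"] by simp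
    then show False using e1(2)[OF z(1)] by (simp add: e_def min_def split: if_splits)
  next
    assume *: "s (r m) < u \<and> dist (f (s' (r m)) - f (s (r m))) (path_jump f u) < e"
    then have "u > a" using s(1)[of "r m"] by auto
    moreover have "dist z (path_jump f u) < e + e"
      using z' * dist_triangle[of z "path_jump f u" "f (s' (r m)) - f (s (r m))"] by simp
    ultimately have "e2 \<le> dist (path_jump f u) z" "dist z (path_jump f u) < e2"
      using e2(2) z(1) by (auto simp: e_def)
    then show False by (simp add: dist_commute)
  qed
qed

lemma cadlag_increments_of_jump:
  assumes f: "cadlag f" and u: "0 < u" and e: "0 < e"
  obtains d where "0 < d"
    "\<And>s s'. u - d < s \<Longrightarrow> s < u \<Longrightarrow> u \<le> s' \<Longrightarrow> s' < u + d \<Longrightarrow> dist (f s' - f s) (path_jump f u) < e"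
proof -
  obtain d1 where d1: "0 < d1" "\<And>s. u \<le> s \<Longrightarrow> s < u + d1 \<Longrightarrow> dist (f s) (f u) < e/2"
    using cadlag_right_nbhd[OF f, of u "e/2"] u e by (metis half_gt_zero less_eq_real_def)
  obtain d2 where d2: "0 < d2" "\<And>s. u - d2 < s \<Longrightarrow> s < u \<Longrightarrow> dist (f s) (f u - path_jump f u) < e/2"
    using cadlag_left_nbhd[OF f, of u "e/2"] u e by (metis half_gt_zero)
  show ?thesis
  proof (rule that[of "min d1 d2"])
    fix s s' assume "u - min d1 d2 < s" "s < u" "u \<le> s'" "s' < u + min d1 d2"
    then have a: "norm (f s - (f u - path_jump f u)) < e/2" "norm (f s' - f u) < e/2"
      using d1(2)[of s'] d2(2)[of s] by (auto simp: dist_norm)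
    have eq: "f s' - f s - path_jump f u = (f s' - f u) - (f s - (f u - path_jump f u))" by simp
    have "norm (f s' - f s - path_jump f u) \<le> norm (f s' - f u) + norm (f s - (f u - path_jump f u))"
      unfolding eq by (rule norm_triangle_ineq4)
    with a show "dist (f s' - f s) (path_jump f u) < e"
      unfolding dist_norm by linarith
  qed (use d1 d2 in auto)
qed

lemma cadlag_bounded:
  fixes f :: "real \<Rightarrow> real ^ 'n::finite"
  assumes f: "cadlag f"
  shows "\<exists>N::nat. \<forall>s\<in>{0..t}. norm (f s) \<le> N"
proof (rule ccontr)
  assume "\<not> ?thesis"
  then have "\<forall>N::nat. \<exists>s\<in>{0..t}. norm (f s) > N" by (meson not_le)
  then obtain s where s: "\<And>N::nat. s N \<in> {0..t}" "\<And>N::nat. norm (f (s N)) > N" by metis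
  obtain u r where u: "u \<in> {0..t}" "strict_mono r" "(s \<circ> r) \<longlonglongrightarrow> u"
    using compact_Icc[of 0 t] s(1) unfolding compact_def by blast
  have s1: "(\<lambda>m. s (r m)) \<longlonglongrightarrow> u" using u(3) by (simp add: o_def)
  have u0: "0 \<le> u" using u by auto
  obtain d1 where d1: "0 < d1" "\<And>s. u \<le> s \<Longrightarrow> s < u + d1 \<Longrightarrow> dist (f s) (f u) < 1"
    using cadlag_right_nbhd[OF f u0, of 1] by auto
  obtain d2 where d2: "0 < d2"
    "\<And>s. 0 \<le> s \<Longrightarrow> u - d2 < s \<Longrightarrow> s < u \<Longrightarrow> dist (f s) (f u - path_jump f u) < 1"
  proof (cases "u = 0")
    case True then show ?thesis by (intro that[of 1]) auto
  next
    case False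
    then show ?thesis using cadlag_left_nbhd[OF f, of u 1] u0 that
      by (metis zero_less_one less_eq_real_def)
  qed
  define C where "C = norm (f u) + norm (f u - path_jump f u) + 1"
  have "eventually (\<lambda>m. u - d2 < s (r m)) sequentially"
    using d2(1) by (intro order_tendstoD(1)[OF s1]) auto
  moreover have "eventually (\<lambda>m. s (r m) < u + d1) sequentially"
    using d1(1) by (intro order_tendstoD(2)[OF s1]) auto
  moreover have "eventually (\<lambda>m. nat \<lceil>C\<rceil> \<le> m) sequentially"
    by (rule eventually_ge_at_top)
  ultimately have "eventually (\<lambda>m. u - d2 < s (r m) \<and> s (r m) < u + d1 \<and> nat \<lceil>C\<rceil> \<le> m) sequentially"
    by eventually_elim auto
  then obtain m where m: "u - d2 < s (r m)" "s (r m) < u + d1" "nat \<lceil>C\<rceil> \<le> m"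
    using eventually_happens by fastforce
  have "m \<le> r m" using u(2) by (rule seq_suble)
  then have "C \<le> r m" using m(3) by linarith
  moreover have "norm (f (s (r m))) \<le> C"
  proof (cases "u \<le> s (r m)")
    case True
    then have "dist (f (s (r m))) (f u) < 1" using d1 m by auto
    then show ?thesis using norm_triangle_sub[of "f (s (r m))" "f u"] unfolding C_def dist_norm
      by (smt (verit) norm_ge_zero)
  next
    case False
    then have "dist (f (s (r m))) (f u - path_jump f u) < 1" using d2 m s(1)[of "r m"] by auto
    then show ?thesis using norm_triangle_sub[of "f (s (r m))" "f u - path_jump f u"] unfolding C_def dist_norm
      by (smt (verit) norm_ge_zero)
  qed
  ultimately show False using s(2)[of "r m"] by linarith
qed

text \<open>Jump times of large jumps cannot accumulate, because near an accumulation point all increments not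
  straddling it are small.\<close>

lemma cadlag_finite_large_jumps:
  fixes f :: "real \<Rightarrow> real ^ 'n::finite"
  assumes f: "cadlag f" and r: "0 < r"
  shows "finite {u\<in>{0<..t}. r < norm (path_jump f u)}" (is "finite ?S")
proof (rule ccontr)
  assume inf: "infinite ?S"
  have "?S \<subseteq> {0..t}" by auto
  then obtain u where u: "u \<in> {0..t}" "u islimpt ?S"
    using compact_Icc[of 0 t] inf unfolding compact_eq_Bolzano_Weierstrass by blast
  have u0: "0 \<le> u" using u by simp
  obtain d where d: "0 < d"
    "\<And>s s'. 0 \<le> s \<Longrightarrow> s \<le> s' \<Longrightarrow> u - d < s \<Longrightarrow> s' < u + d \<Longrightarrow>
       norm (f s' - f s) < r \<or> (s < u \<and> u \<le> s' \<and> dist (f s' - f s) (path_jump f u) < r)"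
    using cadlag_increment_dichotomy[OF f u0 r] by blast
  obtain q where q: "q \<in> ?S" "q \<noteq> u" "dist q u < d"
    using u(2) d(1) unfolding islimpt_approachable by blast
  have q0: "0 < q" using q by simp
  have qd: "u - d < q" "q < u + d" using q by (auto simp: dist_real_def)
  have lt_q: "eventually (\<lambda>s. s < q) (at_left q)"
    by (simp add: eventually_at_filter)
  have "eventually (\<lambda>s. max 0 (u - d) < s) (at_left q)"
    using q0 qd by (intro order_tendstoD(1)[of "\<lambda>x. x"]) (auto simp: tendsto_ident_at)
  moreover have "eventually (\<lambda>s. s < q \<and> (q > u \<longrightarrow> u < s)) (at_left q)"
  proof (cases "q > u")
    case True
    then have "eventually (\<lambda>s. u < s) (at_left q)"
      by (intro order_tendstoD(1)[of "\<lambda>x. x"]) (auto simp: tendsto_ident_at)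
    with lt_q show ?thesis by eventually_elim auto
  next
    case False
    from lt_q show ?thesis by eventually_elim (use False in auto)
  qed
  ultimately have "eventually (\<lambda>s. norm (f q - f s) \<le> r) (at_left q)"
  proof eventually_elim
    case (elim s)
    then have "norm (f q - f s) < r \<or> (s < u \<and> u \<le> q)" using d(2)[of s q] qd by auto
    then show ?case using elim q(2) by auto
  qed
  moreover have "((\<lambda>s. norm (f q - f s)) \<longlongrightarrow> norm (f q - (f q - path_jump f q))) (at_left q)"
    by (intro tendsto_intros cadlag_left_limit f q0)
  ultimately have "norm (f q - (f q - path_jump f q)) \<le> r"
    by (intro tendsto_upperbound) auto
  then show False using q by simp
qed


definition grid :: "real \<Rightarrow> nat \<Rightarrow> nat \<Rightarrow> real" where
  "grid t n j = t * real j / real n"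

text \<open>The index of the half-open cell \<open>(grid t n j, grid t n (Suc j)]\<close> that contains \<open>u\<close>.\<close>

definition grid_cell :: "real \<Rightarrow> nat \<Rightarrow> real \<Rightarrow> nat" where
  "grid_cell t n u = nat (\<lceil>u * real n / t\<rceil> - 1)"

lemma grid_diff: "grid t n (Suc j) - grid t n j = t / n"
  by (simp add: grid_def field_simps add_divide_distrib[symmetric] diff_divide_distrib[symmetric])

lemma grid_less: "0 < t \<Longrightarrow> 0 < n \<Longrightarrow> grid t n j < grid t n (Suc j)"
  by (simp add: grid_def divide_strict_right_mono)

lemma grid_nonneg: "0 \<le> t \<Longrightarrow> 0 \<le> grid t n j"
  by (simp add: grid_def)

lemma grid_le: "0 \<le> t \<Longrightarrow> j \<le> n \<Longrightarrow> grid t n j \<le> t"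
  by (cases "n = 0") (auto simp: grid_def divide_simps intro: mult_left_mono)

lemma grid_mono: "0 \<le> t \<Longrightarrow> i \<le> j \<Longrightarrow> grid t n i \<le> grid t n j"
  by (auto simp: grid_def intro!: divide_right_mono mult_left_mono)

lemma grid_cell:
  assumes "0 < t" "0 < n" "0 < u" "u \<le> t"
  shows "grid_cell t n u < n" "grid t n (grid_cell t n u) < u" "u \<le> grid t n (Suc (grid_cell t n u))"
proof -
  define c where "c = \<lceil>u * real n / t\<rceil>"
  have pos: "0 < u * real n / t" using assms by simp
  then have c1: "1 \<le> c" unfolding c_def by linarith
  have c2: "u * real n / t \<le> c" "c - 1 < u * real n / t" unfolding c_def by linarith+
  have "u * real n / t \<le> n" using assms by (simp add: field_simps)
  then have c3: "c \<le> int n" unfolding c_def by (simp add: ceiling_le_iff)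
  have k: "real (grid_cell t n u) = real_of_int c - 1" "grid_cell t n u = nat (c - 1)" using c1 by (auto simp: grid_cell_def c_def[symmetric])
  show "grid_cell t n u < n" using c3 c1 k(2) by linarith
  have "t * (real_of_int c - 1) < u * real n" using c2(2) assms by (simp add: field_simps)
  then show "grid t n (grid_cell t n u) < u" unfolding grid_def k(1) using assms by (simp add: divide_less_eq)
  have "u * real n \<le> t * c" using c2(1) assms by (simp add: field_simps)
  then show "u \<le> grid t n (Suc (grid_cell t n u))" using assms k(1) by (simp add: grid_def field_simps)
qed

lemma grid_cell_unique:
  assumes "0 \<le> t" "grid t n i < u" "u \<le> grid t n (Suc i)" "grid t n j < u" "u \<le> grid t n (Suc j)"
  shows "i = j"
proof (rule ccontr)
  assume "i \<noteq> j"
  then consider "Suc i \<le> j" | "Suc j \<le> i" by linarith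
  then show False
    using grid_mono[OF assms(1), of "Suc i" j n] grid_mono[OF assms(1), of "Suc j" i n] assms(2-)
    by cases auto
qed

lemma eventually_mesh_less: "0 < e \<Longrightarrow> eventually (\<lambda>n. t / real n < e) sequentially"
  by (rule order_tendstoD(2)[OF lim_const_over_n])

lemma filterlim_mesh: "0 < t \<Longrightarrow> filterlim (\<lambda>n. t / real n) (at_right 0) sequentially"
proof (rule tendsto_imp_filterlim_at_right[OF lim_const_over_n])
  assume t: "0 < t"
  show "eventually (\<lambda>n. 0 < t / real n) sequentially"
    using eventually_gt_at_top[of "0::nat"] by eventually_elim (use t in simp)
qed

lemma eventually_grid_cell_inj:
  assumes t: "0 < t" and F: "finite F" "F \<subseteq> {0<..t}"
  shows "eventually (\<lambda>n. inj_on (grid_cell t n) F) sequentially"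
proof -
  have "eventually (\<lambda>n. \<forall>p\<in>F \<times> F. fst p \<noteq> snd p \<longrightarrow> grid_cell t n (fst p) \<noteq> grid_cell t n (snd p)) sequentially"
  proof (rule eventually_ball_finite, use F in simp, rule ballI)
    fix p assume p: "p \<in> F \<times> F"
    show "eventually (\<lambda>n. fst p \<noteq> snd p \<longrightarrow> grid_cell t n (fst p) \<noteq> grid_cell t n (snd p)) sequentially"
    proof (cases "fst p = snd p")
      case False
      then have "0 < \<bar>fst p - snd p\<bar>" by simp
      from eventually_mesh_less[OF this, of t] eventually_gt_at_top[of "0::nat"]
      show ?thesis
      proof eventually_elim
        case (elim n)
        have a: "0 < fst p" "fst p \<le> t" "0 < snd p" "snd p \<le> t" using p F by auto
        show ?case
        proof (intro impI notI)
          assume "grid_cell t n (fst p) = grid_cell t n (snd p)"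
          then show False
            using grid_cell(2,3)[OF t elim(2) a(1,2)] grid_cell(2,3)[OF t elim(2) a(3,4)] elim(1)
              grid_diff[of t n "grid_cell t n (snd p)"] by (simp only:)
        qed
      qed
    qed simp
  qed
  then show ?thesis by eventually_elim (auto simp: inj_on_def)
qed

lemma cadlag_grid_increments_small:
  fixes f :: "real \<Rightarrow> real ^ 'n::finite"
  assumes f: "cadlag f" and t: "0 < t" and r: "0 \<le> r" and e: "0 < e"
    and no: "\<And>u. u \<in> {0<..t} \<Longrightarrow> norm (path_jump f u) \<le> r"
  shows "eventually (\<lambda>n. \<forall>j<n. norm (f (grid t n (Suc j)) - f (grid t n j)) < r + e) sequentially"
proof (rule ccontr)
  assume "\<not> ?thesis"
  then have "\<forall>m. \<exists>n\<ge>m. \<exists>j<n. r + e \<le> norm (f (grid t n (Suc j)) - f (grid t n j))"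
    unfolding eventually_sequentially by (meson not_less)
  then obtain n j where nj: "\<And>m. n m \<ge> m" "\<And>m. j m < n m"
    "\<And>m. r + e \<le> norm (f (grid t (n m) (Suc (j m))) - f (grid t (n m) (j m)))"
    by metis
  have lim: "(\<lambda>m. t / real (n m)) \<longlonglongrightarrow> 0"
  proof (rule tendsto_sandwich[of "\<lambda>_. 0" _ _ "\<lambda>m. t / real m"])
    show "eventually (\<lambda>m. t / real (n m) \<le> t / real m) sequentially"
      using eventually_gt_at_top[of "0::nat"]
      by eventually_elim (use nj(1) t in \<open>auto intro!: divide_left_mono mult_pos_pos simp: order_less_le_trans\<close>)
  qed (use t lim_const_over_n in auto)
  have "\<exists>u\<in>{0<..t}. path_jump f u \<in> {z. r + e \<le> norm z}"
  proof (rule cadlag_jump_of_increments[OF f, of 0 _ "\<lambda>m. grid t (n m) (j m)" "\<lambda>m. grid t (n m) (Suc (j m))"])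
    show "closed {z :: real ^ 'n. r + e \<le> norm z}"
      by (intro closed_Collect_le continuous_intros)
    show "(\<lambda>m. grid t (n m) (Suc (j m)) - grid t (n m) (j m)) \<longlonglongrightarrow> 0"
      using lim by (simp add: grid_diff)
    show "\<exists>z\<in>{z. r + e \<le> norm z}. dist z (f (grid t (n m) (Suc (j m))) - f (grid t (n m) (j m))) < 1 / real (Suc m)" for m
      using nj(3)[of m] by (intro bexI[of _ "f (grid t (n m) (Suc (j m))) - f (grid t (n m) (j m))"]) auto
    show "grid t (n m) (Suc (j m)) \<le> t" for m using grid_le[of t "Suc (j m)" "n m"] t nj(2)[of m] by auto
    show "grid t (n m) (j m) \<le> grid t (n m) (Suc (j m))" for m using grid_mono[of t "j m" "Suc (j m)"] t by auto
  qed (use r e t grid_nonneg in auto)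
  then show False using no e by force
qed

text \<open>For a fine grid distinct jump times lie in distinct cells, and the increment over the cell of a jump
  time is close to the jump. Hence the large jumps can be counted through the grid.\<close>

lemma cadlag_grid_increments_large:
  fixes f :: "real \<Rightarrow> real ^ 'n::finite"
  assumes f: "cadlag f" and t: "0 < t" and F: "finite F" "F \<subseteq> {u\<in>{0<..t}. \<rho> < norm (path_jump f u)}"
  shows "eventually (\<lambda>n. card F \<le> card {j\<in>{..<n}. \<rho> < norm (f (grid t n (Suc j)) - f (grid t n j))}) sequentially"
proof -
  have F': "F \<subseteq> {0<..t}" using F by auto
  have "eventually (\<lambda>n. \<forall>u\<in>F. \<rho> < norm (f (grid t n (Suc (grid_cell t n u))) - f (grid t n (grid_cell t n u)))) sequentially"
  proof (rule eventually_ball_finite[OF F(1)], rule ballI)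
    fix u assume "u \<in> F"
    then have u: "0 < u" "u \<le> t" "0 < norm (path_jump f u) - \<rho>" using F by auto
    obtain d where d: "0 < d" "\<And>s s'. u - d < s \<Longrightarrow> s < u \<Longrightarrow> u \<le> s' \<Longrightarrow> s' < u + d \<Longrightarrow>
        dist (f s' - f s) (path_jump f u) < norm (path_jump f u) - \<rho>"
      using cadlag_increments_of_jump[OF f u(1,3)] by blast
    from eventually_mesh_less[OF d(1), of t] eventually_gt_at_top[of "0::nat"]
    show "eventually (\<lambda>n. \<rho> < norm (f (grid t n (Suc (grid_cell t n u))) - f (grid t n (grid_cell t n u)))) sequentially"
    proof eventually_elim
      case (elim n)
      let ?z = "f (grid t n (Suc (grid_cell t n u))) - f (grid t n (grid_cell t n u))"
      have "dist ?z (path_jump f u) < norm (path_jump f u) - \<rho>"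
        using grid_cell[OF t elim(2) u(1,2)] elim(1) grid_diff[of t n "grid_cell t n u"]
        by (intro d(2)) linarith+
      then show ?case using norm_triangle_ineq2[of "path_jump f u" ?z] by (simp add: dist_norm norm_minus_commute)
    qed
  qed
  moreover note eventually_grid_cell_inj[OF t F(1) F'] eventually_gt_at_top[of "0::nat"]
  ultimately show ?thesis
  proof eventually_elim
    case (elim n)
    have "card F = card (grid_cell t n ` F)" using elim(2) by (simp add: card_image)
    also have "\<dots> \<le> card {j\<in>{..<n}. \<rho> < norm (f (grid t n (Suc j)) - f (grid t n j))}"
      using elim(1,3) F' grid_cell(1)[OF t] by (intro card_mono) auto
    finally show ?case .
  qed
qed

text \<open>Rational proportions of \<open>[a, b]\<close> rather than rational times are used, because a jump may sit at the endpoint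
  \<open>b\<close>, which therefore has to be a sample point. The criterion makes jump events measurable.\<close>

lemma cadlag_jump_iff_rational_increments:
  fixes f :: "real \<Rightarrow> real ^ 'n::finite"
  assumes f: "cadlag f" and ab: "0 \<le> a" "a < b" and A: "closed A" "0 \<notin> A"
  shows "(\<exists>u\<in>{a<..b}. path_jump f u \<in> A) \<longleftrightarrow>
    (\<forall>m::nat. \<exists>p\<in>\<rat> \<inter> {0..1}. \<exists>q\<in>\<rat> \<inter> {0..1}. p < q \<and> (b - a) * (q - p) < 1 / Suc m \<and>
       f (a + (b - a) * q) - f (a + (b - a) * p) \<in> (\<Union>z\<in>A. ball z (1 / Suc m)))"
  (is "?L \<longleftrightarrow> ?R")
proof
  assume ?L
  then obtain u where u: "a < u" "u \<le> b" "path_jump f u \<in> A" by auto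
  show ?R
  proof
    fix m :: nat
    have u0: "0 < u" using u ab by simp
    obtain d where d: "0 < d" "\<And>s s'. u - d < s \<Longrightarrow> s < u \<Longrightarrow> u \<le> s' \<Longrightarrow> s' < u + d \<Longrightarrow>
        dist (f s' - f s) (path_jump f u) < 1 / Suc m"
      using cadlag_increments_of_jump[OF f u0, of "1 / Suc m"] by auto
    define e where "e = min d (1 / (2 * Suc m))"
    have e: "0 < e" "e \<le> d" "2 * e \<le> 1 / Suc m" using d by (auto simp: e_def min_def field_simps)
    define \<theta> where "\<theta> = (u - a) / (b - a)"
    have \<theta>: "0 < \<theta>" "\<theta> \<le> 1" "u = a + (b - a) * \<theta>" using u ab by (auto simp: \<theta>_def field_simps)
    have "max 0 (\<theta> - e / (b - a)) < \<theta>" using \<theta> e ab by auto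
    then obtain p where p: "p \<in> \<rat>" "max 0 (\<theta> - e / (b - a)) < p" "p < \<theta>"
      using Rats_dense_in_real by blast
    obtain q where q: "q \<in> \<rat>" "\<theta> \<le> q" "q \<le> 1" "q < \<theta> + e / (b - a)"
    proof (cases "\<theta> = 1")
      case True then show ?thesis using e ab by (intro that[of 1]) auto
    next
      case False
      then have "\<theta> < min 1 (\<theta> + e / (b - a))" using \<theta> e ab by auto
      then show ?thesis using Rats_dense_in_real[of \<theta> "min 1 (\<theta> + e / (b - a))"] that by force
    qed
    have sc: "(b - a) * (\<theta> - e / (b - a)) = (b - a) * \<theta> - e" "(b - a) * (\<theta> + e / (b - a)) = (b - a) * \<theta> + e"
      using ab by (auto simp: field_simps)
    have "(b - a) * (\<theta> - e / (b - a)) < (b - a) * p" "(b - a) * p < (b - a) * \<theta>"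
      using p ab by (auto intro!: mult_strict_left_mono)
    then have p': "u - e < a + (b - a) * p" "a + (b - a) * p < u"
      unfolding sc using \<theta>(3) by linarith+
    have "(b - a) * \<theta> \<le> (b - a) * q" "(b - a) * q < (b - a) * (\<theta> + e / (b - a))"
      using q ab by (auto intro!: mult_strict_left_mono mult_left_mono)
    then have q': "u \<le> a + (b - a) * q" "a + (b - a) * q < u + e"
      unfolding sc using \<theta>(3) by linarith+
    have "dist (f (a + (b - a) * q) - f (a + (b - a) * p)) (path_jump f u) < 1 / Suc m"
      using p' q' e by (intro d(2)) auto
    then have "f (a + (b - a) * q) - f (a + (b - a) * p) \<in> (\<Union>z\<in>A. ball z (1 / Suc m))"
      using u(3) by (auto simp: dist_commute)
    moreover have "(b - a) * (q - p) < 1 / Suc m"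
      using p' q' e(3) by (simp add: right_diff_distrib)
    moreover have "p \<in> \<rat> \<inter> {0..1}" "q \<in> \<rat> \<inter> {0..1}" "p < q" using p q \<theta> by auto
    ultimately show "\<exists>p\<in>\<rat> \<inter> {0..1}. \<exists>q\<in>\<rat> \<inter> {0..1}. p < q \<and> (b - a) * (q - p) < 1 / Suc m \<and>
       f (a + (b - a) * q) - f (a + (b - a) * p) \<in> (\<Union>z\<in>A. ball z (1 / Suc m))"
      by blast
  qed
next
  assume ?R
  then obtain p q where pq: "\<And>m. p m \<in> \<rat> \<inter> {0..1}" "\<And>m. q m \<in> \<rat> \<inter> {0..1}" "\<And>m. p m < q m"
    "\<And>m::nat. (b - a) * (q m - p m) < 1 / Suc m"
    "\<And>m. f (a + (b - a) * q m) - f (a + (b - a) * p m) \<in> (\<Union>z\<in>A. ball z (1 / Suc m))"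
    by metis
  show ?L
  proof (rule cadlag_jump_of_increments[OF f ab(1) A, of "\<lambda>m. a + (b - a) * p m" "\<lambda>m. a + (b - a) * q m"])
    fix m
    show "a \<le> a + (b - a) * p m" using pq(1)[of m] ab by auto
    show "a + (b - a) * p m \<le> a + (b - a) * q m" using pq(3)[of m] ab by (auto intro: mult_left_mono)
    have "(b - a) * q m \<le> (b - a) * 1" using pq(2)[of m] ab by (intro mult_left_mono) auto
    then show "a + (b - a) * q m \<le> b" by simp
    show "\<exists>z\<in>A. dist z (f (a + (b - a) * q m) - f (a + (b - a) * p m)) < 1 / Suc m"
      using pq(5)[of m] by auto
  next
    show "(\<lambda>m. a + (b - a) * q m - (a + (b - a) * p m)) \<longlonglongrightarrow> 0"
    proof (rule tendsto_sandwich[of "\<lambda>_. 0" _ _ "\<lambda>m. 1 / real (Suc m)"])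
      show "eventually (\<lambda>m. 0 \<le> a + (b - a) * q m - (a + (b - a) * p m)) sequentially"
        using pq(3) ab by (auto intro!: always_eventually mult_left_mono simp: less_imp_le)
      show "eventually (\<lambda>m. a + (b - a) * q m - (a + (b - a) * p m) \<le> 1 / real (Suc m)) sequentially"
        using pq(4) by (auto intro!: always_eventually simp: right_diff_distrib less_imp_le)
      show "(\<lambda>m. 1 / real (Suc m)) \<longlonglongrightarrow> 0" by (rule LIMSEQ_Suc[OF lim_1_over_n])
    qed simp
  qed
qed

lemma jump_event_measurable:
  fixes X :: "real \<Rightarrow> 'w \<Rightarrow> real ^ 'n::finite"
  assumes X: "\<And>t. 0 \<le> t \<Longrightarrow> X t \<in> borel_measurable M" and c: "\<And>\<omega>. \<omega> \<in> space M \<Longrightarrow> cadlag (\<lambda>t. X t \<omega>)"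
    and ab: "0 \<le> a" "a < b" and A: "closed A" "0 \<notin> A"
  shows "{\<omega>\<in>space M. \<exists>u\<in>{a<..b}. jump X u \<omega> \<in> A} \<in> sets M"
proof -
  have cnt: "countable (\<rat> \<inter> {0..1::real})" using countable_rat by (rule countable_Int1)
  have op: "(\<Union>z\<in>A. ball z (1 / Suc m)) \<in> sets borel" for m by (intro borel_open) auto
  have "{\<omega>\<in>space M. \<exists>u\<in>{a<..b}. jump X u \<omega> \<in> A} =
    {\<omega>\<in>space M. \<forall>m::nat. \<exists>p\<in>\<rat> \<inter> {0..1}. \<exists>q\<in>\<rat> \<inter> {0..1}. p < q \<and> (b - a) * (q - p) < 1 / Suc m \<and>
       X (a + (b - a) * q) \<omega> - X (a + (b - a) * p) \<omega> \<in> (\<Union>z\<in>A. ball z (1 / Suc m))}"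
    unfolding jump_eq_path_jump
    by (intro Collect_cong conj_cong refl cadlag_jump_iff_rational_increments[OF c ab A])
  also have "\<dots> \<in> sets M"
  proof (intro sets.sets_Collect_countable_All sets.sets_Collect_countable_Ex' cnt)
    fix m :: nat and p q :: real assume "p \<in> \<rat> \<inter> {0..1}" "q \<in> \<rat> \<inter> {0..1}"
    then have [measurable]: "X (a + (b - a) * q) \<in> borel_measurable M" "X (a + (b - a) * p) \<in> borel_measurable M"
      using ab by (auto intro!: X)
    note [measurable] = op
    show "{\<omega>\<in>space M. p < q \<and> (b - a) * (q - p) < 1 / Suc m \<and>
        X (a + (b - a) * q) \<omega> - X (a + (b - a) * p) \<omega> \<in> (\<Union>z\<in>A. ball z (1 / Suc m))} \<in> sets M"
      by measurable
  qed
  finally show ?thesis .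
qed

lemma sup_jump_le_iff:
  assumes "0 \<le> r"
  shows "sup_jump X t \<omega> \<le> ereal r \<longleftrightarrow> (\<forall>u\<in>{0<..t}. norm (jump X u \<omega>) \<le> r)"
  by (simp add: sup_jump_def SUP_le_iff)

lemma sup_jump_eq_0_iff:
  assumes "0 < t"
  shows "sup_jump X t \<omega> = 0 \<longleftrightarrow> sup_jump X t \<omega> \<le> ereal 0"
proof -
  have "ereal (norm (jump X t \<omega>)) \<le> sup_jump X t \<omega>"
    unfolding sup_jump_def using assms by (intro SUP_upper) auto
  then have "0 \<le> sup_jump X t \<omega>" using order_trans by (metis ereal_less_eq(5) norm_ge_zero)
  then show ?thesis by (auto simp: zero_ereal_def[symmetric])
qed

lemma no_large_jump_measurable:
  fixes X :: "real \<Rightarrow> 'w \<Rightarrow> real ^ 'n::finite"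
  assumes X: "\<And>t. 0 \<le> t \<Longrightarrow> X t \<in> borel_measurable M" and c: "\<And>\<omega>. \<omega> \<in> space M \<Longrightarrow> cadlag (\<lambda>t. X t \<omega>)"
    and t: "0 < t" and r: "0 \<le> r"
  shows "{\<omega>\<in>space M. \<forall>u\<in>{0<..t}. norm (jump X u \<omega>) \<le> r} \<in> sets M"
proof -
  have *: "y \<le> r \<longleftrightarrow> (\<forall>k. \<not> r + 1 / Suc k \<le> y)" for y :: real
  proof safe
    fix k assume "y \<le> r" "r + 1 / Suc k \<le> y"
    moreover have "0 < 1 / real (Suc k)" by simp
    ultimately show False by linarith
  next
    assume "\<forall>k. \<not> r + 1 / Suc k \<le> y"
    show "y \<le> r"
    proof (rule ccontr)
      assume "\<not> y \<le> r"
      then obtain k where "inverse (real (Suc k)) < y - r" using reals_Archimedean[of "y - r"] by auto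
      then show False using \<open>\<forall>k. \<not> r + 1 / Suc k \<le> y\<close>[rule_format, of k] by (simp add: inverse_eq_divide)
    qed
  qed
  have "{\<omega>\<in>space M. \<forall>u\<in>{0<..t}. norm (jump X u \<omega>) \<le> r} =
     {\<omega>\<in>space M. \<forall>k. \<not> (\<exists>u\<in>{0<..t}. jump X u \<omega> \<in> {z. r + 1 / Suc k \<le> norm z})}"
    unfolding * by blast
  also have "\<dots> \<in> sets M"
    using r by (intro sets.sets_Collect_countable_All sets.sets_Collect_neg jump_event_measurable X c t)
      (auto intro!: closed_Collect_le continuous_intros simp: not_le add_nonneg_pos)
  finally show ?thesis .
qed

lemma emeasure_count_space_le:
  assumes "\<And>F. finite F \<Longrightarrow> F \<subseteq> S \<Longrightarrow> of_nat (card F) \<le> c"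
  shows "emeasure (count_space UNIV) S \<le> (c :: ennreal)"
proof (cases "finite S")
  case True
  then show ?thesis using assms[of S] by (simp add: emeasure_count_space)
next
  case False
  have "of_nat N \<le> c" for N
  proof -
    obtain F where "F \<subseteq> S" "finite F" "card F = N" using infinite_arbitrarily_large[OF False] by blast
    then show ?thesis using assms[of F] by simp
  qed
  then have "c = \<top>" by (metis ennreal_Ex_less_of_nat linorder_not_less top.not_eq_extremum)
  then show ?thesis by simp
qed

text \<open>Counting the cells with a jump in \<open>A k\<close> undercounts the jumps, and every finite set of jumps is counted
  correctly by a fine grid and a large \<open>k\<close>. The approximation by \<open>A k\<close> is needed because the set of
  interest need not be closed nor bounded away from \<open>0\<close>.\<close>

lemma J_eq_SUP_grid:
  assumes t: "0 < t" and inc: "\<And>k. A k \<subseteq> A (Suc k)" and A: "B = (\<Union>k. A k)"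
  shows "J X t B \<omega> = (SUP k. SUP n. \<Sum>j<Suc n. indicator {\<omega>. \<exists>u\<in>{grid t (Suc n) j<..grid t (Suc n) (Suc j)}. jump X u \<omega> \<in> A k} \<omega>)"
  (is "_ = (SUP k. SUP n. ?S k n)")
proof (rule antisym)
  have mono: "A k \<subseteq> A l" if "k \<le> l" for k l using inc that by (rule lift_Suc_mono_le)
  have cnt: "?S k n = of_nat (card {j\<in>{..<Suc n}. \<exists>u\<in>{grid t (Suc n) j<..grid t (Suc n) (Suc j)}. jump X u \<omega> \<in> A k})" for k n
    by (simp add: indicator_def sum.If_cases Int_def conj_commute del: sum.lessThan_Suc)
  show "J X t B \<omega> \<le> (SUP k. SUP n. ?S k n)"
    unfolding J_def
  proof (rule emeasure_count_space_le)
    fix F assume F: "finite F" "F \<subseteq> {u \<in> {0<..t}. jump X u \<omega> \<in> B}"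
    have "\<forall>u\<in>F. \<exists>k. jump X u \<omega> \<in> A k" using F A by blast
    then obtain \<kappa> where \<kappa>: "\<And>u. u \<in> F \<Longrightarrow> jump X u \<omega> \<in> A (\<kappa> u)" by metis
    have "finite (\<kappa> ` F)" using F(1) by simp
    then obtain k where "\<forall>u\<in>F. \<kappa> u \<le> k" unfolding finite_nat_set_iff_bounded_le by auto
    then have k: "jump X u \<omega> \<in> A k" if "u \<in> F" for u using \<kappa>[OF that] mono that by blast
    have Ft: "F \<subseteq> {0<..t}" using F by auto
    obtain n where n: "inj_on (grid_cell t (Suc n)) F"
      using eventually_grid_cell_inj[OF t F(1) Ft] unfolding eventually_sequentially by (meson le_SucI order_refl)
    have "card F = card (grid_cell t (Suc n) ` F)" using n by (simp add: card_image)
    also have "\<dots> \<le> card {j\<in>{..<Suc n}. \<exists>u\<in>{grid t (Suc n) j<..grid t (Suc n) (Suc j)}. jump X u \<omega> \<in> A k}"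
    proof (intro card_mono subsetI)
      fix j assume "j \<in> grid_cell t (Suc n) ` F"
      then obtain u where u: "u \<in> F" "j = grid_cell t (Suc n) u" by auto
      then have "0 < u" "u \<le> t" using Ft by auto
      from grid_cell[OF t _ this, of "Suc n"] u k[OF u(1)]
      show "j \<in> {j\<in>{..<Suc n}. \<exists>u\<in>{grid t (Suc n) j<..grid t (Suc n) (Suc j)}. jump X u \<omega> \<in> A k}"
        by auto
    qed auto
    finally have "of_nat (card F) \<le> ?S k n" unfolding cnt by (rule of_nat_mono)
    also have "\<dots> \<le> (SUP k. SUP n. ?S k n)" by (intro SUP_upper2[of k] SUP_upper2[of n]) auto
    finally show "of_nat (card F) \<le> (SUP k. SUP n. ?S k n)" .
  qed
  show "(SUP k. SUP n. ?S k n) \<le> J X t B \<omega>"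
  proof (intro SUP_least)
    fix k n
    define I where "I = {j\<in>{..<Suc n}. \<exists>u\<in>{grid t (Suc n) j<..grid t (Suc n) (Suc j)}. jump X u \<omega> \<in> A k}"
    have "\<forall>j\<in>I. \<exists>u. u \<in> {grid t (Suc n) j<..grid t (Suc n) (Suc j)} \<and> jump X u \<omega> \<in> A k" unfolding I_def by blast
    then obtain u where u: "\<And>j. j \<in> I \<Longrightarrow> u j \<in> {grid t (Suc n) j<..grid t (Suc n) (Suc j)}"
      "\<And>j. j \<in> I \<Longrightarrow> jump X (u j) \<omega> \<in> A k" by metis
    have inj: "inj_on u I"
    proof (rule inj_onI)
      fix i j assume "i \<in> I" "j \<in> I" "u i = u j"
      then show "i = j" using u(1)[of i] u(1)[of j] t by (intro grid_cell_unique[of t "Suc n" i "u i" j]) auto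
    qed
    have fin: "finite I" by (simp add: I_def)
    have "u ` I \<subseteq> {u \<in> {0<..t}. jump X u \<omega> \<in> B}"
    proof
      fix v assume "v \<in> u ` I"
      then obtain j where j: "j \<in> I" "v = u j" by auto
      then have "j < Suc n" by (simp add: I_def)
      then show "v \<in> {u \<in> {0<..t}. jump X u \<omega> \<in> B}"
        using u[OF j(1)] j(2) A grid_nonneg[of t "Suc n" j] grid_le[of t "Suc j" "Suc n"] t by auto
    qed
    then have "emeasure (count_space UNIV) (u ` I) \<le> J X t B \<omega>"
      unfolding J_def by (rule emeasure_mono) simp
    then show "?S k n \<le> J X t B \<omega>"
      using fin inj unfolding cnt I_def[symmetric] by (simp add: emeasure_count_space card_image)
  qed
qed

lemma J_measurable:
  fixes X :: "real \<Rightarrow> 'w \<Rightarrow> real ^ 'n::finite"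
  assumes X: "\<And>t. 0 \<le> t \<Longrightarrow> X t \<in> borel_measurable M" and c: "\<And>\<omega>. \<omega> \<in> space M \<Longrightarrow> cadlag (\<lambda>t. X t \<omega>)"
    and t: "0 < t" and inc: "\<And>k. A k \<subseteq> A (Suc k)" and A: "B = (\<Union>k. A k)"
    and cl: "\<And>k. closed (A k)" "\<And>k. 0 \<notin> A k"
  shows "J X t B \<in> borel_measurable M"
proof -
  have "(\<lambda>\<omega>. SUP k. SUP n. \<Sum>j<Suc n. indicator {\<omega>. \<exists>u\<in>{grid t (Suc n) j<..grid t (Suc n) (Suc j)}. jump X u \<omega> \<in> A k} \<omega> :: ennreal)
     \<in> borel_measurable M"
  proof (intro borel_measurable_SUP borel_measurable_sum countableI_type)
    fix k n j
    have "{\<omega>\<in>space M. \<exists>u\<in>{grid t (Suc n) j<..grid t (Suc n) (Suc j)}. jump X u \<omega> \<in> A k} \<in> sets M"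
      using t by (intro jump_event_measurable X c cl grid_nonneg grid_less) auto
    then show "indicator {\<omega>. \<exists>u\<in>{grid t (Suc n) j<..grid t (Suc n) (Suc j)}. jump X u \<omega> \<in> A k} \<in> borel_measurable M"
      by (rule measurable_cong[THEN iffD1, OF _ borel_measurable_indicator, rotated]) (auto simp: indicator_def)
  qed
  then show ?thesis using J_eq_SUP_grid[OF t inc A] by (subst measurable_cong) auto
qed

section \<open>The Markov property\<close>

lemma transition_kernel:
  assumes P: "transition_semigroup P" and t: "0 \<le> t"
  shows "P t \<in> state_algebra \<rightarrow>\<^sub>M subprob_algebra state_algebra"
    and "x \<in> orthant \<Longrightarrow> prob_space (P t x)"
    and "x \<in> orthant \<Longrightarrow> sets (P t x) = sets state_algebra"
    and "x \<in> orthant \<Longrightarrow> space (P t x) = orthant"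
proof -
  have K: "P t \<in> state_algebra \<rightarrow>\<^sub>M prob_algebra state_algebra"
    using P t unfolding transition_semigroup_def by blast
  then show "P t \<in> state_algebra \<rightarrow>\<^sub>M subprob_algebra state_algebra" by (rule measurable_prob_algebraD)
  assume "x \<in> orthant"
  then have x: "P t x \<in> space (prob_algebra state_algebra)"
    using measurable_space[OF K, of x] by (simp add: space_restrict_space)
  then show "prob_space (P t x)" and s: "sets (P t x) = sets state_algebra" 
    by (auto simp: space_prob_algebra)
  show "space (P t x) = orthant" using sets_eq_imp_space_eq[OF s] by (simp add: space_restrict_space)
qed

lemma natural_filtration_subalgebra:
  assumes "\<And>t. 0 \<le> t \<Longrightarrow> X t \<in> M \<rightarrow>\<^sub>M state_algebra"
  shows "subalgebra M (natural_filtration M X s)"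
proof -
  let ?G = "{X u -` A \<inter> space M | u A. u \<in> {0..s} \<and> A \<in> sets state_algebra}"
  have G: "?G \<subseteq> sets M" using assms by (auto intro!: measurable_sets)
  have "?G \<subseteq> Pow (space M)" by auto
  then have "sets (natural_filtration M X s) = sigma_sets (space M) ?G"
    unfolding natural_filtration_def by (rule sets_measure_of)
  then have "sets (natural_filtration M X s) \<subseteq> sets M"
    using sets.sigma_sets_subset[OF G] by simp
  moreover have "space (natural_filtration M X s) = space M"
    unfolding natural_filtration_def by (rule space_measure_of) auto
  ultimately show ?thesis unfolding subalgebra_def by simp
qed

lemma natural_filtration_measurable:
  fixes X :: "real \<Rightarrow> 'w \<Rightarrow> real ^ 'n::finite"
  assumes X: "\<And>t. 0 \<le> t \<Longrightarrow> X t \<in> M \<rightarrow>\<^sub>M state_algebra" and u: "0 \<le> u" "u \<le> s"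
  shows "X u \<in> natural_filtration M X s \<rightarrow>\<^sub>M state_algebra"
proof (rule measurableI)
  have sp: "space (natural_filtration M X s) = space M"
    using natural_filtration_subalgebra[of X M s] X unfolding subalgebra_def by simp
  show "X u \<omega> \<in> space state_algebra" if "\<omega> \<in> space (natural_filtration M X s)" for \<omega>
    using measurable_space[OF X[OF u(1)], of \<omega>] that sp by simp
  fix A :: "(real ^ 'n) set" assume A: "A \<in> sets state_algebra"
  have "{X u -` A \<inter> space M | u A. u \<in> {0..s} \<and> A \<in> sets state_algebra} \<subseteq> Pow (space M)" by auto
  then show "X u -` A \<inter> space (natural_filtration M X s) \<in> sets (natural_filtration M X s)"
    unfolding sp unfolding natural_filtration_def using A u
    by (subst sets_measure_of) (auto intro!: sigma_sets.Basic)
qed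

text \<open>The Markov property is assumed for events of a single later time; it extends to functionals of the past and
  of one later value because both sides define measures on the product of the filtration with the state
  space, and these agree on rectangles.\<close>

lemma markov_process_integral:
  fixes X :: "real \<Rightarrow> 'w \<Rightarrow> real ^ 'n::finite" and H :: "'w \<times> (real ^ 'n) \<Rightarrow> real"
  assumes P: "transition_semigroup P" and MP: "markov_process P M X" and s: "0 \<le> s" and t: "0 \<le> t"
    and H: "H \<in> borel_measurable (natural_filtration M X s \<Otimes>\<^sub>M state_algebra)"
    and bd: "\<And>\<omega> y. \<omega> \<in> space M \<Longrightarrow> y \<in> orthant \<Longrightarrow> \<bar>H (\<omega>, y)\<bar> \<le> C"
  shows "(\<integral>\<omega>. H (\<omega>, X (s + t) \<omega>) \<partial>M) = (\<integral>\<omega>. (\<integral>y. H (\<omega>, y) \<partial>P t (X s \<omega>)) \<partial>M)"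
proof -
  interpret prob_space M using MP unfolding markov_process_def by blast
  have X: "\<And>t. 0 \<le> t \<Longrightarrow> X t \<in> M \<rightarrow>\<^sub>M state_algebra" using MP unfolding markov_process_def by blast
  let ?F = "natural_filtration M X s" and ?S = "state_algebra :: (real ^ 'n) measure"
  have sub: "subalgebra M ?F" by (rule natural_filtration_subalgebra[OF X])
  then have spF: "space ?F = space M" and setF: "sets ?F \<subseteq> sets M" unfolding subalgebra_def by auto
  interpret F: finite_measure_subalgebra M ?F
    using sub by unfold_locales
  have id[measurable]: "(\<lambda>\<omega>. \<omega>) \<in> M \<rightarrow>\<^sub>M ?F" using setF spF by (intro measurableI) (auto dest: sets.sets_into_space)
  have Xs[measurable]: "X s \<in> M \<rightarrow>\<^sub>M ?S" and Xst[measurable]: "X (s + t) \<in> M \<rightarrow>\<^sub>M ?S"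
    using X s t by auto
  define Q where "Q = (\<lambda>\<omega>. distr (P t (X s \<omega>)) (?F \<Otimes>\<^sub>M ?S) (Pair \<omega>))"
  have Qm: "Q \<in> M \<rightarrow>\<^sub>M subprob_algebra (?F \<Otimes>\<^sub>M ?S)"
    unfolding Q_def
  proof (rule measurable_distr2)
    show "(\<lambda>(\<omega>, y). (\<omega>, y)) \<in> M \<Otimes>\<^sub>M ?S \<rightarrow>\<^sub>M ?F \<Otimes>\<^sub>M ?S" by measurable
    show "(\<lambda>\<omega>. P t (X s \<omega>)) \<in> M \<rightarrow>\<^sub>M subprob_algebra ?S"
      using transition_kernel(1)[OF P t] by measurable
  qed
  have orth: "X s \<omega> \<in> orthant" if "\<omega> \<in> space M" for \<omega>
    using measurable_space[OF Xs that] by (simp add: space_restrict_space)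
  define m1 where "m1 = distr M (?F \<Otimes>\<^sub>M ?S) (\<lambda>\<omega>. (\<omega>, X (s + t) \<omega>))"
  have pair[measurable]: "(\<lambda>\<omega>. (\<omega>, X (s + t) \<omega>)) \<in> M \<rightarrow>\<^sub>M ?F \<Otimes>\<^sub>M ?S" by measurable
  have ne: "space M \<noteq> {}" by (rule not_empty)
  have s2: "sets (M \<bind> Q) = sets (?F \<Otimes>\<^sub>M ?S)" by (rule sets_bind[OF sets_kernel[OF Qm] ne])
  have rect: "emeasure m1 (a \<times> b) = emeasure (M \<bind> Q) (a \<times> b)" if a: "a \<in> sets ?F" and b: "b \<in> sets ?S" for a b
  proof -
    have aM[measurable]: "a \<in> sets M" using a setF by auto
    note [measurable] = b
    have bP: "b \<in> sets (P t (X s \<omega>))" if "\<omega> \<in> space M" for \<omega>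
      using transition_kernel(3)[OF P t orth[OF that]] b by simp
    have ae: "AE \<omega> in M. real_cond_exp M ?F (\<lambda>\<omega>. indicator b (X (s + t) \<omega>)) \<omega> = measure (P t (X s \<omega>)) b"
      using MP s t b unfolding markov_process_def by blast
    have meas: "(\<lambda>\<omega>. measure (P t (X s \<omega>)) b) \<in> borel_measurable M"
      using transition_kernel(1)[OF P t] b by measurable
    have "emeasure m1 (a \<times> b) = emeasure M (a \<inter> (X (s + t) -` b \<inter> space M))"
      unfolding m1_def using a b sets.sets_into_space[OF aM]
      by (subst emeasure_distr) (auto intro!: arg_cong[where f = "emeasure M"])
    also have "\<dots> = ennreal (\<integral>\<omega>. indicator a \<omega> * indicator b (X (s + t) \<omega>) \<partial>M)"
    proof -
      let ?a = "a \<inter> (X (s + t) -` b \<inter> space M)"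
      have A: "?a \<in> sets M" by measurable
      have "(\<integral>\<omega>. indicator a \<omega> * indicator b (X (s + t) \<omega>) \<partial>M) = (\<integral>\<omega>. indicator ?a \<omega> \<partial>M :: real)"
        by (intro Bochner_Integration.integral_cong) (simp_all add: indicator_def)
      also have "\<dots> = measure M ?a"
        using A by (simp add: sets.Int_space_eq2 del: Int_iff)
      finally show ?thesis by (simp add: emeasure_eq_measure)
    qed
    also have "(\<integral>\<omega>. indicator a \<omega> * indicator b (X (s + t) \<omega>) \<partial>M) =
        (\<integral>\<omega>. indicator a \<omega> * real_cond_exp M ?F (\<lambda>\<omega>. indicator b (X (s + t) \<omega>)) \<omega> \<partial>M)"
    proof (rule F.real_cond_exp_intg(2)[symmetric])
      show "integrable M (\<lambda>\<omega>. indicator a \<omega> * indicator b (X (s + t) \<omega>) :: real)"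
      proof (rule integrable_const_bound[where B = 1])
        show "AE \<omega> in M. norm (indicator a \<omega> * indicator b (X (s + t) \<omega>) :: real) \<le> 1"
          by (simp add: indicator_def)
      qed measurable
      show "indicator a \<in> borel_measurable ?F" using a by (rule borel_measurable_indicator)
      show "(\<lambda>\<omega>. indicator b (X (s + t) \<omega>) :: real) \<in> borel_measurable M" by measurable
    qed
    also have "\<dots> = (\<integral>\<omega>. indicator a \<omega> * measure (P t (X s \<omega>)) b \<partial>M)"
    proof (rule integral_cong_AE)
      show "(\<lambda>\<omega>. indicator a \<omega> * real_cond_exp M ?F (\<lambda>\<omega>. indicator b (X (s + t) \<omega>)) \<omega>) \<in> borel_measurable M"
        by (intro borel_measurable_times borel_measurable_indicator aM borel_measurable_cond_exp2)
      show "(\<lambda>\<omega>. indicator a \<omega> * measure (P t (X s \<omega>)) b) \<in> borel_measurable M"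
        by (intro borel_measurable_times borel_measurable_indicator aM meas)
      show "AE \<omega> in M. indicator a \<omega> * real_cond_exp M ?F (\<lambda>\<omega>. indicator b (X (s + t) \<omega>)) \<omega>
          = indicator a \<omega> * measure (P t (X s \<omega>)) b"
        using ae by eventually_elim simp
    qed
    also have "ennreal \<dots> = (\<integral>\<^sup>+\<omega>. ennreal (indicator a \<omega> * measure (P t (X s \<omega>)) b) \<partial>M)"
    proof (rule nn_integral_eq_integral[symmetric])
      show "integrable M (\<lambda>\<omega>. indicator a \<omega> * measure (P t (X s \<omega>)) b)"
      proof (rule integrable_const_bound[where B = 1])
        show "(\<lambda>\<omega>. indicator a \<omega> * measure (P t (X s \<omega>)) b) \<in> borel_measurable M"
          by (intro borel_measurable_times borel_measurable_indicator aM meas)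
        show "AE \<omega> in M. norm (indicator a \<omega> * measure (P t (X s \<omega>)) b) \<le> 1"
        proof (rule AE_I2)
          fix \<omega> assume "\<omega> \<in> space M"
          then have "measure (P t (X s \<omega>)) b \<le> 1"
            using transition_kernel(2)[OF P t orth] prob_space.prob_le_1 by blast
          then show "norm (indicator a \<omega> * measure (P t (X s \<omega>)) b) \<le> 1" by (simp add: indicator_def)
        qed
      qed
    qed simp
    also have "\<dots> = (\<integral>\<^sup>+\<omega>. emeasure (Q \<omega>) (a \<times> b) \<partial>M)"
    proof (intro nn_integral_cong)
      fix \<omega> assume w: "\<omega> \<in> space M"
      interpret p: prob_space "P t (X s \<omega>)" using transition_kernel(2)[OF P t orth[OF w]] .
      have sP: "sets (P t (X s \<omega>)) = sets ?S" "space (P t (X s \<omega>)) = orthant"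
        using transition_kernel(3,4)[OF P t orth[OF w]] by auto
      have "Pair \<omega> \<in> ?S \<rightarrow>\<^sub>M ?F \<Otimes>\<^sub>M ?S" using w spF by (intro measurable_Pair1') simp
      then have pm: "Pair \<omega> \<in> P t (X s \<omega>) \<rightarrow>\<^sub>M ?F \<Otimes>\<^sub>M ?S"
        using measurable_cong_sets[OF sP(1) refl] by blast
      have ab: "a \<times> b \<in> sets (?F \<Otimes>\<^sub>M ?S)" using a b by (rule pair_measureI)
      have "b \<subseteq> orthant" using sets.sets_into_space[OF b] by (simp add: space_restrict_space)
      then have "Pair \<omega> -` (a \<times> b) \<inter> space (P t (X s \<omega>)) = (if \<omega> \<in> a then b else {})"
        unfolding sP(2) by auto
      then have "emeasure (Q \<omega>) (a \<times> b) = emeasure (P t (X s \<omega>)) (if \<omega> \<in> a then b else {})"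
        unfolding Q_def emeasure_distr[OF pm ab] by (rule arg_cong)
      then show "ennreal (indicator a \<omega> * measure (P t (X s \<omega>)) b) = emeasure (Q \<omega>) (a \<times> b)"
        by (simp add: p.emeasure_eq_measure)
    qed
    also have "\<dots> = emeasure (M \<bind> Q) (a \<times> b)"
      using a b by (intro emeasure_bind[OF ne Qm, symmetric]) simp
    finally show ?thesis .
  qed
  have eq: "m1 = M \<bind> Q"
  proof (rule measure_eqI_generator_eq[OF Int_stable_pair_measure_generator[of ?F ?S]])
    show "{a \<times> b | a b. a \<in> sets ?F \<and> b \<in> sets ?S} \<subseteq> Pow (space ?F \<times> space ?S)"
      by (auto dest: sets.sets_into_space)
    show "sets m1 = sigma_sets (space ?F \<times> space ?S) {a \<times> b | a b. a \<in> sets ?F \<and> b \<in> sets ?S}"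
      by (simp add: m1_def sets_pair_measure)
    show "sets (M \<bind> Q) = sigma_sets (space ?F \<times> space ?S) {a \<times> b | a b. a \<in> sets ?F \<and> b \<in> sets ?S}"
      unfolding s2 by (simp add: sets_pair_measure)
    show "range (\<lambda>_::nat. space ?F \<times> space ?S) \<subseteq> {a \<times> b | a b. a \<in> sets ?F \<and> b \<in> sets ?S}" by auto
    show "emeasure m1 (space ?F \<times> space ?S) \<noteq> \<infinity>" for i :: nat
    proof -
      interpret m: prob_space m1 unfolding m1_def by (rule prob_space_distr) measurable
      show ?thesis by simp
    qed
  qed (use rect in auto)
  have "(\<integral>\<omega>. H (\<omega>, X (s + t) \<omega>) \<partial>M) = integral\<^sup>L m1 H"
    unfolding m1_def by (rule integral_distr[OF pair H, symmetric])
  also have "\<dots> = (\<integral>\<omega>. integral\<^sup>L (Q \<omega>) H \<partial>M)"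
    unfolding eq
  proof (rule integral_bind[where B = C and B' = 1])
    show "AE \<omega> in M. emeasure (Q \<omega>) (space (Q \<omega>)) \<le> ennreal 1"
      using measurable_space[OF Qm] by (auto simp: space_subprob_algebra intro!: subprob_space.emeasure_space_le_1)
    show "\<bar>H p\<bar> \<le> C" if "p \<in> space (?F \<Otimes>\<^sub>M ?S)" for p
      using that bd[of "fst p" "snd p"] by (auto simp: space_pair_measure spF space_restrict_space)
  qed (use H Qm in \<open>auto intro!: finite_measure_axioms\<close>)
  also have "\<dots> = (\<integral>\<omega>. (\<integral>y. H (\<omega>, y) \<partial>P t (X s \<omega>)) \<partial>M)"
  proof (intro Bochner_Integration.integral_cong refl)
    fix \<omega> assume w: "\<omega> \<in> space M"
    have sP: "sets (P t (X s \<omega>)) = sets ?S" using transition_kernel(3)[OF P t orth[OF w]] .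
    have "Pair \<omega> \<in> ?S \<rightarrow>\<^sub>M ?F \<Otimes>\<^sub>M ?S" using w spF by (intro measurable_Pair1') simp
    then have pm: "Pair \<omega> \<in> P t (X s \<omega>) \<rightarrow>\<^sub>M ?F \<Otimes>\<^sub>M ?S"
      using measurable_cong_sets[OF sP(1) refl] by blast
    show "integral\<^sup>L (Q \<omega>) H = (\<integral>y. H (\<omega>, y) \<partial>P t (X s \<omega>))"
      unfolding Q_def by (rule integral_distr[OF pm H])
  qed
  finally show ?thesis .
qed

section \<open>Short-time behaviour of differential equations on the orthant\<close>

lemma orthant_iff: "x \<in> orthant \<longleftrightarrow> (\<forall>i. 0 \<le> x $ i)"
  by (simp add: orthant_def)

lemma closed_orthant: "closed (orthant :: (real ^ 'n::finite) set)"
proof -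
  have "orthant = (\<Inter>i. {x :: real ^ 'n. 0 \<le> x $ i})" by (auto simp: orthant_def)
  moreover have "closed (\<Inter>i. {x :: real ^ 'n. 0 \<le> x $ i})"
    by (intro closed_INT ballI closed_Collect_le continuous_intros)
  ultimately show ?thesis by simp
qed

lemma orthant_add: "x \<in> orthant \<Longrightarrow> y \<in> orthant \<Longrightarrow> x + y \<in> orthant"
  by (simp add: orthant_iff)

lemma inner_orthant_nonneg: "x \<in> orthant \<Longrightarrow> y \<in> orthant \<Longrightarrow> 0 \<le> x \<bullet> (y :: real ^ 'n::finite)"
  by (auto simp: orthant_iff inner_vec_def intro!: sum_nonneg)

lemma compact_orthant_cball: "compact (orthant \<inter> cball 0 R :: (real ^ 'n::finite) set)"
  using closed_orthant by (rule closed_Int_compact) simp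

lemma exp_minus_quadratic: 
  fixes a :: real assumes "0 \<le> a"
  shows "exp (- a) - 1 + a \<le> a\<^sup>2"
proof -
  have "exp (- a) \<le> 1 / (1 + a)"
    using exp_ge_add_one_self[of a] assms by (simp add: exp_minus inverse_eq_divide frac_le)
  also have "\<dots> \<le> 1 - a + a\<^sup>2"
  proof -
    have "1 \<le> 1 + a * a * a" using assms by simp
    also have "\<dots> = (1 - a + a\<^sup>2) * (1 + a)" by (simp add: algebra_simps power2_eq_square)
    finally show ?thesis using assms by (simp add: divide_le_eq)
  qed
  finally show ?thesis by simp
qed

lemma abs_exp_quadratic:
  fixes a :: real assumes "\<bar>a\<bar> \<le> 1"
  shows "\<bar>exp a - 1 - a\<bar> \<le> a\<^sup>2"
proof (cases "0 \<le> a")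
  case True
  then show ?thesis using exp_bound[of a] assms exp_ge_add_one_self[of a] by linarith
next
  case False
  then have "exp a - 1 - a \<le> a\<^sup>2" using exp_minus_quadratic[of "- a"] by simp
  then show ?thesis using exp_ge_add_one_self[of a] by linarith
qed

lemma orthant_solution_derivative:
  assumes "orthant_solution F a v" "0 \<le> t"
  shows "(v has_vector_derivative (\<chi> i. F i (v t))) (at t within {0..})"
proof -
  have "((\<lambda>s. v s $ i) has_real_derivative F i (v t)) (at t within {0..})" for i
    using assms unfolding orthant_solution_def by blast
  moreover have "(*) (F i (v t)) = (\<lambda>h. h * F i (v t))" for i by (simp add: fun_eq_iff mult.commute)
  ultimately have "((\<lambda>s. v s $ i) has_derivative (\<lambda>h. h * F i (v t))) (at t within {0..})" for i
    unfolding has_field_derivative_def by simp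
  then show ?thesis
    unfolding has_vector_derivative_def
    by (subst has_derivative_componentwise_within)
      (auto simp: Basis_vec_def inner_axis)
qed

lemma orthant_solution_continuous:
  assumes "orthant_solution F a v"
  shows "continuous_on {0..} v"
  unfolding continuous_on_eq_continuous_within
  using orthant_solution_derivative[OF assms] has_vector_derivative_continuous by fastforce

lemma orthant_solution_shift:
  assumes v: "orthant_solution F a v" and s: "0 \<le> s"
  shows "orthant_solution F (v s) (\<lambda>u. v (s + u))"
  unfolding orthant_solution_def
proof (intro conjI allI impI)
  fix T :: real assume "0 \<le> T"
  then have "bounded (v ` {0..s + T})" using v s unfolding orthant_solution_def by simp
  moreover have "(\<lambda>u. v (s + u)) ` {0..T} \<subseteq> v ` {0..s + T}" using s by auto
  ultimately show "bounded ((\<lambda>u. v (s + u)) ` {0..T})" by (rule bounded_subset)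
next
  fix t :: real and i assume t: "0 \<le> t"
  have "((\<lambda>u. v u $ i) has_real_derivative F i (v (s + t))) (at (s + t) within {0..})"
    using v s t unfolding orthant_solution_def by simp
  then have "((\<lambda>u. v u $ i) has_real_derivative F i (v (s + t))) (at (s + t) within (+) s ` {0..})"
    by (rule DERIV_subset) (use s in auto)
  then show "((\<lambda>u. v (s + u) $ i) has_real_derivative F i (v (s + t))) (at t within {0..})"
    by (rule DERIV_at_within_shift[THEN iffD1])
qed (use assms in \<open>auto simp: orthant_solution_def\<close>)

text \<open>A solution cannot move by more than \<open>\<delta>\<close> before time \<open>\<delta> / Mx\<close>, where \<open>Mx\<close> bounds the field on a ball, and
  up to that time the field is close to its initial value. The time depends only on the
  bound \<open>L\<close> for the initial values.\<close>

lemma orthant_solution_small_time: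
  fixes F :: "'n::finite \<Rightarrow> real ^ 'n \<Rightarrow> real"
  assumes F: "\<And>i. continuous_on orthant (F i)" and e: "0 < e"
  shows "eventually (\<lambda>h. \<forall>a v. norm a \<le> L \<longrightarrow> orthant_solution F a v \<longrightarrow>
     (\<forall>s\<in>{0..h}. norm (v s - a) \<le> e) \<and> norm (v h - a - h *\<^sub>R (\<chi> i. F i a)) \<le> e * h) (at_right 0)"
proof -
  define G where "G y = (\<chi> i. F i y)" for y
  let ?C = "orthant \<inter> cball 0 (L + 1) :: (real ^ 'n) set"
  have Gc: "continuous_on ?C G"
    unfolding G_def using F by (intro continuous_on_vec_lambda) (auto intro: continuous_on_subset)
  have comp: "compact ?C" by (rule compact_orthant_cball)
  obtain Mx where Mx: "0 < Mx" "\<And>y. y \<in> ?C \<Longrightarrow> norm (G y) \<le> Mx"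
    using compact_imp_bounded[OF compact_continuous_image[OF Gc comp]] unfolding bounded_pos by auto
  have "uniformly_continuous_on ?C G" using Gc comp by (rule compact_uniformly_continuous)
  then obtain d where d: "0 < d" "\<And>y z. y \<in> ?C \<Longrightarrow> z \<in> ?C \<Longrightarrow> dist y z < d \<Longrightarrow> dist (G y) (G z) < e"
    unfolding uniformly_continuous_on_def using e by (metis dist_commute)
  define \<delta> where "\<delta> = min (min 1 e) (d / 2)"
  have \<delta>: "0 < \<delta>" "\<delta> \<le> 1" "\<delta> \<le> e" "\<delta> < d" using d e by (auto simp: \<delta>_def)
  have main: "(\<forall>s\<in>{0..h}. norm (v s - a) \<le> e) \<and> norm (v h - a - h *\<^sub>R G a) \<le> e * h"
    if h: "0 < h" "h < \<delta> / Mx" and a: "norm a \<le> L" and v: "orthant_solution F a v" for h a v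
  proof -
    have v0: "v 0 = a" and vo: "\<And>s. 0 \<le> s \<Longrightarrow> v s \<in> orthant" using v unfolding orthant_solution_def by auto
    have vc: "continuous_on {0..} v" using orthant_solution_continuous[OF v] .
    have vd: "(v has_derivative (\<lambda>x. x *\<^sub>R G (v s))) (at s)" if "0 < s" for s
    proof -
      have "(v has_vector_derivative G (v s)) (at s within {0..})"
        using orthant_solution_derivative[OF v, of s] that by (simp add: G_def)
      moreover have "at s within {0..} = at s" using that by (intro at_within_interior) (simp add: interior_Ici[of "-1"])
      ultimately show ?thesis by (simp add: has_vector_derivative_def)
    qed
    \<comment> \<open>otherwise consider the first time \<open>u\<close> at which the distance from \<open>a\<close> reaches \<open>\<delta>\<close>\<close>
    have close: "norm (v s - a) < \<delta>" if s: "0 \<le> s" "s \<le> h" for s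
    proof (rule ccontr)
      assume neg: "\<not> norm (v s - a) < \<delta>"
      let ?S = "{u\<in>{0..h}. \<delta> \<le> norm (v u - a)}"
      have "closed ?S"
        by (intro continuous_on_closed_Collect_le continuous_intros continuous_on_subset[OF vc]) auto
      then have "closed ?S" .
      moreover have "?S \<noteq> {}" "bdd_below ?S" using neg s by (auto intro!: bdd_belowI[of _ 0] simp: not_less)
      ultimately have m: "Inf ?S \<in> ?S" by (intro closed_contains_Inf)
      define u where "u = Inf ?S"
      have u: "0 \<le> u" "u \<le> h" "\<delta> \<le> norm (v u - a)" using m unfolding u_def by auto
      have less: "norm (v x - a) < \<delta>" if "0 \<le> x" "x < u" for x
        using cInf_lower[of x ?S] \<open>bdd_below ?S\<close> that u unfolding u_def by force
      have "u \<noteq> 0" using u(3) v0 \<delta> by auto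
      then have "0 < u" using u by simp
      have "continuous_on {0..u} v" using vc by (rule continuous_on_subset) auto
      then obtain x where x: "x \<in> {0<..<u}" "norm (v u - v 0) \<le> norm ((u - 0) *\<^sub>R G (v x))"
        using mvt_general[OF \<open>0 < u\<close>, of v "\<lambda>s x. x *\<^sub>R G (v s)"] vd by auto
      have "norm (v x) \<le> L + 1" using less[of x] x a \<delta> norm_triangle_sub[of "v x" a] by auto
      then have "norm (G (v x)) \<le> Mx" using vo[of x] x by (intro Mx(2)) auto
      then have "norm ((u - 0) *\<^sub>R G (v x)) \<le> h * Mx" using u by (simp add: mult_mono)
      also have "\<dots> < \<delta>" using h Mx by (simp add: pos_less_divide_eq)
      finally show False using x(2) u(3) v0 by simp
    qed
    have "continuous_on {0..h} (\<lambda>s. v s - a - s *\<^sub>R G a)"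
      by (intro continuous_intros continuous_on_subset[OF vc]) auto
    moreover have "((\<lambda>s. v s - a - s *\<^sub>R G a) has_derivative (\<lambda>x. x *\<^sub>R G (v s) - x *\<^sub>R G a)) (at s)" if "0 < s" for s
      using vd[OF that] by (auto intro!: derivative_eq_intros)
    ultimately obtain x where x: "x \<in> {0<..<h}"
      "norm ((v h - a - h *\<^sub>R G a) - (v 0 - a - 0 *\<^sub>R G a)) \<le> norm ((h - 0) *\<^sub>R G (v x) - (h - 0) *\<^sub>R G a)"
      using mvt_general[OF h(1), of "\<lambda>s. v s - a - s *\<^sub>R G a" "\<lambda>s x. x *\<^sub>R G (v s) - x *\<^sub>R G a"] by auto
    have c: "norm (v x - a) < \<delta>" using close[of x] x by auto
    then have "norm (v x) \<le> L + 1" using a \<delta> norm_triangle_sub[of "v x" a] by auto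
    then have "v x \<in> ?C" "a \<in> ?C" using vo[of x] vo[of 0] v0 x a by auto
    then have "dist (G (v x)) (G a) < e" using c \<delta> by (intro d(2)) (auto simp: dist_norm)
    then have "norm ((h - 0) *\<^sub>R G (v x) - (h - 0) *\<^sub>R G a) \<le> h * e"
      using h unfolding scaleR_diff_right[symmetric] by (simp add: dist_norm)
    then show ?thesis using close \<delta> x(2) v0 by (fastforce simp: mult.commute)
  qed
  have "eventually (\<lambda>h. 0 < h \<and> h < \<delta> / Mx) (at_right 0)"
    using \<delta> Mx by (auto simp: eventually_at_right_field intro!: exI[of _ "\<delta> / Mx"])
  then show ?thesis by eventually_elim (use main G_def in auto)
qed

text \<open>The common first-order expansion behind the two exponentials of the proof: the Laplace transform of the
  process (with \<open>F = - \<phi>\<close> and \<open>g = \<psi>\<close>) and the candidate for the survival probability (with the killed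
  mechanisms). The order of the quantifiers says that the expansion is uniform.\<close>

lemma affine_exponential_small_time:
  fixes F :: "'n::finite \<Rightarrow> real ^ 'n \<Rightarrow> real" and g :: "real ^ 'n \<Rightarrow> real"
  assumes F: "\<And>i. continuous_on orthant (F i)" and g: "continuous_on orthant g" and e: "0 < e"
  shows "eventually (\<lambda>h. \<forall>a v x. norm a \<le> L \<longrightarrow> norm x \<le> R \<longrightarrow> orthant_solution F a v \<longrightarrow>
     \<bar>exp (x \<bullet> a - x \<bullet> v h - integral {0..h} (\<lambda>s. g (v s))) - 1 + h * ((\<Sum>l\<in>UNIV. x $ l * F l a) + g a)\<bar> \<le> e * h)
   (at_right 0)"
proof -
  define G where "G y = (\<chi> i. F i y)" for y
  let ?C = "orthant \<inter> cball 0 (\<bar>L\<bar> + 1) :: (real ^ 'n) set"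
  have comp: "compact ?C" by (rule compact_orthant_cball)
  have gC: "continuous_on ?C g" using g by (rule continuous_on_subset) auto
  have Gc: "continuous_on ?C G"
    unfolding G_def using F by (intro continuous_on_vec_lambda) (auto intro: continuous_on_subset)
  obtain Mg where Mg: "0 < Mg" "\<And>y. y \<in> ?C \<Longrightarrow> \<bar>g y\<bar> \<le> Mg"
    using compact_imp_bounded[OF compact_continuous_image[OF gC comp]] unfolding bounded_pos by auto
  obtain MG where MG: "0 < MG" "\<And>y. y \<in> ?C \<Longrightarrow> norm (G y) \<le> MG"
    using compact_imp_bounded[OF compact_continuous_image[OF Gc comp]] unfolding bounded_pos by auto
  \<comment> \<open>The error \<open>e\<close> is shared by the linearisation of \<open>v\<close> (\<open>e1\<close>), the integral of \<open>g\<close> (\<open>e2\<close>) and the quadratic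
    remainder of the exponential, whose argument is at most \<open>h * D\<close>.\<close>
  define e1 where "e1 = min 1 (e / 4 / (\<bar>R\<bar> + 1))"
  define e2 where "e2 = min 1 (e / 4)"
  have e1: "0 < e1" "e1 * \<bar>R\<bar> \<le> e / 4"
  proof -
    show "0 < e1" using e by (simp add: e1_def)
    define k where "k = \<bar>R\<bar> + 1"
    have k: "0 < k" "\<bar>R\<bar> \<le> k" by (auto simp: k_def)
    have "e1 * \<bar>R\<bar> \<le> e / 4 / k * k" using e k by (intro mult_mono) (auto simp: e1_def k_def)
    then show "e1 * \<bar>R\<bar> \<le> e / 4" using k by simp
  qed
  have e2: "0 < e2" "e2 \<le> e / 4" using e by (auto simp: e2_def)
  have "uniformly_continuous_on ?C g" using gC comp by (rule compact_uniformly_continuous)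
  then obtain d where d: "0 < d" "\<And>y z. y \<in> ?C \<Longrightarrow> z \<in> ?C \<Longrightarrow> dist y z < d \<Longrightarrow> dist (g y) (g z) < e2"
    unfolding uniformly_continuous_on_def using e2 by (metis dist_commute)
  define e3 where "e3 = min e1 (min 1 (d / 2))"
  have e3: "0 < e3" "e3 \<le> e1" "e3 \<le> 1" "e3 < d" using e1 d by (auto simp: e3_def)
  define D where "D = \<bar>R\<bar> * MG + Mg + e"
  have D: "0 < D" using Mg MG e by (simp add: D_def add_nonneg_pos)
  have small: "eventually (\<lambda>h. 0 < h \<and> h < min (1 / D) (e / (2 * D\<^sup>2))) (at_right 0)"
    using D e by (auto simp: eventually_at_right_field intro!: exI[of _ "min (1 / D) (e / (2 * D\<^sup>2))"])
  have "eventually (\<lambda>h. \<forall>a v. norm a \<le> L \<longrightarrow> orthant_solution F a v \<longrightarrow>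
     (\<forall>s\<in>{0..h}. norm (v s - a) \<le> e3) \<and> norm (v h - a - h *\<^sub>R (\<chi> i. F i a)) \<le> e3 * h) (at_right 0)"
    by (rule orthant_solution_small_time[OF F e3(1)])
  from this small show ?thesis
  proof eventually_elim
    case (elim h)
    then have h: "0 < h" "h * D \<le> 1" "h * D\<^sup>2 \<le> e / 2" using D by (auto simp: pos_less_divide_eq field_simps)
    show ?case
    proof (intro allI impI)
      fix a x :: "real ^ 'n" and v assume a: "norm a \<le> L" and x: "norm x \<le> R" and v: "orthant_solution F a v"
      have near: "\<And>s. s \<in> {0..h} \<Longrightarrow> norm (v s - a) \<le> e3"
        and lin: "norm (v h - a - h *\<^sub>R G a) \<le> e3 * h"
        using elim(1) a v by (auto simp: G_def)
      have v0: "v 0 = a" and vo: "\<And>s. 0 \<le> s \<Longrightarrow> v s \<in> orthant" using v unfolding orthant_solution_def by auto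
      have aC: "a \<in> ?C" using vo[of 0] v0 a by auto
      have vC: "v s \<in> ?C" if "s \<in> {0..h}" for s
        using vo[of s] near[OF that] that a e3 norm_triangle_sub[of "v s" a] by auto
      have gv: "continuous_on {0..h} (\<lambda>s. g (v s))"
        using vC by (intro continuous_on_compose2[OF gC] continuous_on_subset[OF orthant_solution_continuous[OF v]]) auto
      have "norm (integral {0..h} (\<lambda>s. g (v s) - g a)) \<le> e2 * (h - 0)"
      proof (rule integral_bound)
        show "continuous_on {0..h} (\<lambda>s. g (v s) - g a)"
          using gv by (intro continuous_intros)
        show "norm (g (v s) - g a) \<le> e2" if s: "s \<in> {0..h}" for s
        proof -
          have "dist (g (v s)) (g a) < e2" using near[OF s] e3 by (intro d(2) vC[OF s] aC) (auto simp: dist_norm)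
          then show ?thesis by (simp add: dist_norm)
        qed
      qed (use h in simp)
      moreover have "integral {0..h} (\<lambda>s. g (v s) - g a) = integral {0..h} (\<lambda>s. g (v s)) - h * g a"
        using gv h by (subst Henstock_Kurzweil_Integration.integral_diff) (auto intro: integrable_continuous_real)
      ultimately have "\<bar>integral {0..h} (\<lambda>s. g (v s)) - h * g a\<bar> \<le> e2 * h" by simp
      also have "\<dots> \<le> e / 4 * h" using h by (intro mult_right_mono[OF e2(2)]) simp
      finally have int: "\<bar>integral {0..h} (\<lambda>s. g (v s)) - h * g a\<bar> \<le> e / 4 * h" .
      have "\<bar>x \<bullet> (v h - a - h *\<^sub>R G a)\<bar> \<le> norm x * norm (v h - a - h *\<^sub>R G a)" by (rule Cauchy_Schwarz_ineq2)
      also have "\<dots> \<le> \<bar>R\<bar> * (e1 * h)"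
        using x h order_trans[OF lin mult_right_mono[OF e3(2), of h]] by (intro mult_mono) auto
      also have "\<dots> = (e1 * \<bar>R\<bar>) * h" by simp
      also have "\<dots> \<le> e / 4 * h" using e1(2) h by (intro mult_right_mono) auto
      finally have in1: "\<bar>x \<bullet> (v h - a - h *\<^sub>R G a)\<bar> \<le> e / 4 * h" .
      define A where "A = x \<bullet> a - x \<bullet> v h - integral {0..h} (\<lambda>s. g (v s))"
      define b where "b = x \<bullet> G a + g a"
      have b_eq: "b = (\<Sum>l\<in>UNIV. x $ l * F l a) + g a" by (simp add: b_def G_def inner_vec_def)
      have Aeq: "A + h * b = - (x \<bullet> (v h - a - h *\<^sub>R G a)) - (integral {0..h} (\<lambda>s. g (v s)) - h * g a)"
        by (simp add: A_def b_def inner_diff_right algebra_simps)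
      have Ab: "\<bar>A + h * b\<bar> \<le> e / 2 * h" unfolding Aeq using int in1 by linarith
      have "\<bar>x \<bullet> G a\<bar> \<le> norm x * norm (G a)" by (rule Cauchy_Schwarz_ineq2)
      also have "\<dots> \<le> \<bar>R\<bar> * MG" using x MG aC by (intro mult_mono) auto
      finally have "\<bar>b\<bar> \<le> \<bar>R\<bar> * MG + Mg" using Mg(2)[OF aC] unfolding b_def by linarith
      then have "\<bar>h * b\<bar> \<le> h * (\<bar>R\<bar> * MG + Mg)" using h by (simp add: abs_mult)
      moreover have "e / 2 * h \<le> h * e" using e h by simp
      ultimately have "\<bar>A\<bar> \<le> h * (\<bar>R\<bar> * MG + Mg) + h * e" using Ab by linarith
      then have AD: "\<bar>A\<bar> \<le> h * D" by (simp add: D_def distrib_left)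
      then have "\<bar>exp A - 1 - A\<bar> \<le> A\<^sup>2" using h by (intro abs_exp_quadratic) linarith
      also have "\<dots> \<le> (h * D)\<^sup>2" using AD by (metis abs_ge_zero power2_abs power_mono)
      also have "\<dots> = h * (h * D\<^sup>2)" by (simp add: power2_eq_square)
      also have "\<dots> \<le> h * (e / 2)" using h by (intro mult_left_mono) auto
      also have "\<dots> = e / 2 * h" by simp
      finally have "\<bar>exp A - 1 - A\<bar> \<le> e / 2 * h" .
      then have "\<bar>exp A - 1 + h * b\<bar> \<le> e / 2 * h + e / 2 * h" using Ab by linarith
      then have "\<bar>exp A - 1 + h * b\<bar> \<le> e * h" by simp
      then show "\<bar>exp (x \<bullet> a - x \<bullet> v h - integral {0..h} (\<lambda>s. g (v s))) - 1 + h * ((\<Sum>l\<in>UNIV. x $ l * F l a) + g a)\<bar> \<le> e * h"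
        unfolding A_def b_eq .
    qed
  qed
qed

section \<open>Exponential sums and cutoff functions\<close>

text \<open>The functions whose means under the transition kernels can be computed from the Laplace transform.\<close>

inductive exponential_sum :: "(real ^ 'n::finite \<Rightarrow> real) \<Rightarrow> bool" where
  exponential_sum_term: "m \<in> orthant \<Longrightarrow> exponential_sum (\<lambda>z. a * exp (- (m \<bullet> z)))"
| exponential_sum_add: "exponential_sum p \<Longrightarrow> exponential_sum q \<Longrightarrow> exponential_sum (\<lambda>z. p z + q z)"

lemma exponential_sum_const: "exponential_sum (\<lambda>z :: real ^ 'n::finite. a)"
  using exponential_sum_term[of 0 a] by (simp add: orthant_iff)

lemma exponential_sum_sum:
  assumes "finite I" "\<And>i. i \<in> I \<Longrightarrow> exponential_sum (p i)"
  shows "exponential_sum (\<lambda>z. \<Sum>i\<in>I. p i z)"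
  using assms by (induction I rule: finite_induct) (auto intro: exponential_sum_const exponential_sum_add)

lemma exponential_sum_mult_term:
  assumes "exponential_sum q" "m \<in> orthant"
  shows "exponential_sum (\<lambda>z. a * exp (- (m \<bullet> z)) * q z)"
  using assms(1)
proof induction
  case (exponential_sum_term m' a')
  have "exponential_sum (\<lambda>z. (a * a') * exp (- ((m + m') \<bullet> z)))"
    using exponential_sum_term assms(2) by (intro exponential_sum.intros orthant_add)
  then show ?case by (simp add: inner_add_left exp_add[symmetric] exp_diff exp_minus field_simps)
next
  case (exponential_sum_add p q)
  then show ?case unfolding distrib_left by (intro exponential_sum.exponential_sum_add)
qed

lemma exponential_sum_mult:
  assumes "exponential_sum p" "exponential_sum q"
  shows "exponential_sum (\<lambda>z. p z * q z)"
  using assms(1)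
proof induction
  case (exponential_sum_term m a)
  then show ?case using exponential_sum_mult_term assms(2) by blast
next
  case (exponential_sum_add p1 p2)
  then show ?case unfolding distrib_right by (intro exponential_sum.exponential_sum_add)
qed

lemma axis_orthant: "axis i 1 \<in> orthant"
  by (simp add: orthant_iff axis_def)

lemma exponential_sum_real_polynomial:
  fixes f :: "real ^ 'n::finite \<Rightarrow> real"
  assumes "real_polynomial_function f"
  shows "exponential_sum (\<lambda>z :: real ^ 'n. f (\<chi> i. exp (- (z $ i))))"
  using assms
proof induction
  case (linear f)
  have "f (\<chi> i. exp (- (z $ i))) = (\<Sum>i\<in>UNIV. f (axis i 1) * exp (- (axis i 1 \<bullet> z)))" for z :: "real ^ 'n"
  proof -
    have "(\<chi> i. exp (- (z $ i))) = (\<Sum>i\<in>UNIV. exp (- (z $ i)) *\<^sub>R axis i 1 :: real ^ 'n)"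
      by (subst basis_expansion[symmetric]) (simp add: scalar_mult_eq_scaleR)
    then have "f (\<chi> i. exp (- (z $ i))) = f (\<Sum>i\<in>UNIV. exp (- (z $ i)) *\<^sub>R axis i 1)" by simp
    also have "\<dots> = (\<Sum>i\<in>UNIV. exp (- (z $ i)) * f (axis i 1))"
      using bounded_linear.linear[OF linear] by (simp add: linear_sum linear_cmul)
    finally show ?thesis by (simp add: inner_axis' mult.commute)
  qed
  then show ?case by (simp add: exponential_sum_sum exponential_sum_term axis_orthant)
qed (auto intro: exponential_sum_const exponential_sum_add exponential_sum_mult)

lemma exponential_sum_continuous: "exponential_sum p \<Longrightarrow> continuous_on UNIV p"
  by (induction rule: exponential_sum.induct) (auto intro!: continuous_intros)

lemma exp_inner_le:
  fixes z :: "real ^ 'n::finite"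
  assumes "m \<in> orthant" "\<And>i. - R \<le> z $ i"
  shows "exp (- (m \<bullet> z)) \<le> exp (R * (\<Sum>i\<in>UNIV. m $ i))"
proof -
  have "(\<Sum>i\<in>UNIV. m $ i * - R) \<le> (\<Sum>i\<in>UNIV. m $ i * z $ i)"
    using assms by (intro sum_mono mult_left_mono) (auto simp: orthant_iff)
  also have "(\<Sum>i\<in>UNIV. m $ i * - R) = (\<Sum>i\<in>UNIV. m $ i) * - R" by (rule sum_distrib_right[symmetric])
  finally show ?thesis by (simp add: inner_vec_def mult.commute)
qed

lemma exponential_sum_bounded:
  assumes "exponential_sum p"
  shows "\<exists>C. \<forall>z. (\<forall>i. - R \<le> z $ i) \<longrightarrow> \<bar>p z\<bar> \<le> C"
  using assms
proof induction
  case (exponential_sum_term m a)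
  show ?case
    using exp_inner_le[OF exponential_sum_term, of R]
    by (intro exI[of _ "\<bar>a\<bar> * exp (R * (\<Sum>i\<in>UNIV. m $ i))"]) (auto simp: abs_mult intro!: mult_left_mono)
next
  case (exponential_sum_add p q)
  then obtain C1 C2 where "\<forall>z. (\<forall>i. - R \<le> z $ i) \<longrightarrow> \<bar>p z\<bar> \<le> C1" "\<forall>z. (\<forall>i. - R \<le> z $ i) \<longrightarrow> \<bar>q z\<bar> \<le> C2" by blast
  then show ?case by (intro exI[of _ "C1 + C2"]) (fastforce intro: order_trans[OF abs_triangle_ineq] add_mono)
qed

text \<open>A nonnegative exponential sum vanishing only at \<open>0\<close>. The power is even, because increments may have negative
  coordinates, and exceeds \<open>2\<close>, so that the diffusion part of the process does not contribute to its rate.\<close>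

definition flat_weight :: "real ^ 'n::finite \<Rightarrow> real" where
  "flat_weight z = (\<Sum>i\<in>UNIV. (1 - exp (- (z $ i))) ^ 4)"

lemma power4_nonneg: "0 \<le> (x :: real) ^ 4"
  by (rule zero_le_even_power) simp

lemma flat_weight_nonneg: "0 \<le> flat_weight z"
  unfolding flat_weight_def by (intro sum_nonneg power4_nonneg)

lemma flat_weight_lower:
  fixes z :: "real ^ 'n::finite"
  assumes "0 < \<rho>" "\<rho> \<le> norm z"
  shows "(1 - exp (- (\<rho> / CARD('n)))) ^ 4 \<le> flat_weight z"
proof -
  define s where "s = \<rho> / CARD('n)"
  have s: "0 < s" "\<rho> = CARD('n) * s" using assms by (auto simp: s_def)
  have "\<exists>i. s \<le> \<bar>z $ i\<bar>"
  proof (rule ccontr)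
    assume "\<not> ?thesis"
    then have "(\<Sum>i\<in>(UNIV :: 'n set). \<bar>z $ i\<bar>) < (\<Sum>i\<in>(UNIV :: 'n set). s)"
      by (intro sum_strict_mono) (auto simp: not_le)
    then show False using norm_le_l1_cart[of z] assms s by simp
  qed
  then obtain i where i: "s \<le> \<bar>z $ i\<bar>" by blast
  have "1 - exp (- s) \<le> \<bar>1 - exp (- (z $ i))\<bar>"
  proof (cases "0 \<le> z $ i")
    case True
    then show ?thesis using i by simp
  next
    case False
    then have "exp s \<le> exp (- (z $ i))" using i by simp
    moreover have "2 \<le> exp s + exp (- s)"
      using exp_ge_add_one_self[of s] exp_ge_add_one_self[of "- s"] by linarith
    ultimately show ?thesis by linarith
  qed
  moreover have "0 \<le> 1 - exp (- s)" using s by simp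
  ultimately have "(1 - exp (- s)) ^ 4 \<le> \<bar>1 - exp (- (z $ i))\<bar> ^ 4" by (rule power_mono)
  also have "\<dots> = (1 - exp (- (z $ i))) ^ 4" by simp
  also have "\<dots> \<le> flat_weight z"
    unfolding flat_weight_def by (rule member_le_sum) (auto intro: power4_nonneg)
  finally show ?thesis by (simp add: s_def)
qed

text \<open>Continuous, \<open>0\<close> on the ball of radius \<open>r + \<delta>\<close> and \<open>1\<close> outside the ball of radius \<open>r + 2 * \<delta>\<close>; it increases to
  the indicator of the complement of the closed ball of radius \<open>r\<close> as \<open>\<delta>\<close> decreases to \<open>0\<close>.\<close>

definition cutoff :: "real \<Rightarrow> real \<Rightarrow> real ^ 'n::finite \<Rightarrow> real" where
  "cutoff r \<delta> z = min 1 (max 0 ((norm z - r) / \<delta> - 1))"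

lemma cutoff_range: "0 \<le> cutoff r \<delta> z" "cutoff r \<delta> z \<le> 1"
  by (auto simp: cutoff_def)

lemma cutoff_eq_0: "0 < \<delta> \<Longrightarrow> norm z \<le> r + \<delta> \<Longrightarrow> cutoff r \<delta> z = 0"
  by (simp add: cutoff_def field_simps)

lemma cutoff_eq_1: "0 < \<delta> \<Longrightarrow> r + 2 * \<delta> \<le> norm z \<Longrightarrow> cutoff r \<delta> z = 1"
  by (simp add: cutoff_def field_simps)

lemma cutoff_continuous: "continuous_on S (cutoff r \<delta>)"
  unfolding cutoff_def divide_inverse by (intro continuous_intros)

lemma cutoff_truncate:
  fixes z :: "real ^ 'n::finite"
  assumes "0 < \<delta>" "r + 2 * \<delta> \<le> L" "0 \<le> L"
  shows "cutoff r \<delta> (\<chi> i. min (z $ i) L) = cutoff r \<delta> z"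
proof (cases "\<forall>i. z $ i \<le> L")
  case True
  then have "(\<chi> i. min (z $ i) L) = z" by (simp add: vec_eq_iff)
  then show ?thesis by simp
next
  case False
  then obtain i where i: "L < z $ i" by (auto simp: not_le)
  have "L \<le> norm z" using i component_le_norm_cart[of z i] assms by linarith
  moreover have "L \<le> norm (\<chi> i. min (z $ i) L)" (is "_ \<le> norm ?y")
    using component_le_norm_cart[of ?y i] i assms by simp
  ultimately show ?thesis using assms cutoff_eq_1 by (metis order_trans)
qed

text \<open>The quotient of the cutoff by the weight extends to a continuous function of the variables
  \<open>q\<^sub>i = exp (- z\<^sub>i)\<close> on the whole cube \<open>[0, exp R]\<close>, the faces \<open>q\<^sub>i = 0\<close> standing for infinite coordinates:
  the cutoff is \<open>1\<close> there and vanishes where the weight is small. Polynomials in the \<open>q\<^sub>i\<close> are exponential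
  sums, so the Stone-Weierstrass theorem applies.\<close>

lemma cutoff_approx_exponential_sum:
  fixes r \<delta> \<epsilon> R :: real
  assumes r: "0 \<le> r" and \<delta>: "0 < \<delta>" and \<epsilon>: "0 < \<epsilon>"
  obtains p :: "real ^ 'n::finite \<Rightarrow> real" where "exponential_sum p"
    "\<And>z. (\<And>i. - R \<le> z $ i) \<Longrightarrow> \<bar>cutoff r \<delta> z - flat_weight z * p z\<bar> \<le> \<epsilon> * flat_weight z"
proof -
  define L where "L = r + 2 * \<delta>"
  define \<rho> where "\<rho> = r + \<delta>"
  define \<eta> where "\<eta> = (1 - exp (- (\<rho> / CARD('n)))) ^ 4"
  have L: "r + 2 * \<delta> \<le> L" "0 \<le> L" and \<rho>: "0 < \<rho>" using r \<delta> by (auto simp: L_def \<rho>_def)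
  have \<eta>: "0 < \<eta>" unfolding \<eta>_def using \<rho> by (intro zero_less_power) simp
  \<comment> \<open>\<open>\<zeta> q\<close> recovers \<open>z\<close> from \<open>q\<close>; truncation at \<open>L\<close> avoids the logarithm of \<open>0\<close> and does not change the cutoff\<close>
  define \<zeta> where "\<zeta> q = (\<chi> i. - ln (max (q $ i) (exp (- L))))" for q :: "real ^ 'n"
  \<comment> \<open>\<open>\<eta>\<close> is a lower bound for the weight wherever the cutoff does not vanish\<close>
  define \<Gamma> where "\<Gamma> q = cutoff r \<delta> (\<zeta> q) / max \<eta> (\<Sum>i\<in>UNIV. (1 - q $ i) ^ 4)" for q :: "real ^ 'n"
  have pos: "0 < max y (exp (- L))" for y by (simp add: less_max_iff_disj)
  have \<zeta>c: "continuous_on UNIV \<zeta>"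
    unfolding \<zeta>_def using pos by (intro continuous_on_vec_lambda continuous_intros) (auto simp: less_imp_neq[symmetric])
  have \<Gamma>c: "continuous_on UNIV \<Gamma>"
    unfolding \<Gamma>_def
  proof (intro continuous_intros)
    show "continuous_on UNIV (\<lambda>q. cutoff r \<delta> (\<zeta> q))"
      by (rule continuous_on_compose2[OF cutoff_continuous[of UNIV] \<zeta>c]) auto
    show "\<forall>q\<in>UNIV. max \<eta> (\<Sum>i\<in>UNIV. (1 - q $ i) ^ 4) \<noteq> 0" using \<eta> by (auto simp: max_def)
  qed
  let ?S = "cbox 0 (\<chi> i. exp R) :: (real ^ 'n) set"
  obtain f where f: "real_polynomial_function f" "\<And>q. q \<in> ?S \<Longrightarrow> \<bar>\<Gamma> q - f q\<bar> < \<epsilon>"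
    using Stone_Weierstrass_real_polynomial_function[OF compact_cbox continuous_on_subset[OF \<Gamma>c] \<epsilon>] by (metis subset_UNIV)
  define p where "p z = f (\<chi> i. exp (- (z $ i)))" for z :: "real ^ 'n"
  show ?thesis
  proof (rule that[of p])
    show "exponential_sum p" unfolding p_def using f(1) by (rule exponential_sum_real_polynomial)
    fix z :: "real ^ 'n" assume z: "\<And>i. - R \<le> z $ i"
    let ?q = "(\<chi> i. exp (- (z $ i))) :: real ^ 'n"
    have "?q \<in> ?S" using z by (auto simp: mem_box_cart minus_le_iff)
    then have fp: "\<bar>\<Gamma> ?q - p z\<bar> \<le> \<epsilon>" using f(2) by (fastforce simp: p_def)
    have "max (exp (- (z $ i))) (exp (- L)) = exp (- min (z $ i) L)" for i by (auto simp: max_def min_def)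
    then have "\<zeta> ?q = (\<chi> i. min (z $ i) L)" by (simp add: \<zeta>_def)
    then have cz: "cutoff r \<delta> (\<zeta> ?q) = cutoff r \<delta> z" using cutoff_truncate[OF \<delta> L] by simp
    have "(\<Sum>i\<in>UNIV. (1 - ?q $ i) ^ 4) = flat_weight z" by (simp add: flat_weight_def)
    then have G: "\<Gamma> ?q = cutoff r \<delta> z / max \<eta> (flat_weight z)" unfolding \<Gamma>_def cz by simp
    have "cutoff r \<delta> z = flat_weight z * \<Gamma> ?q"
    proof (cases "\<rho> \<le> norm z")
      case True
      then have "\<eta> \<le> flat_weight z" using flat_weight_lower[OF \<rho>] unfolding \<eta>_def by blast
      then show ?thesis unfolding G using \<eta> by (simp add: max_def)
    next
      case False
      then have "cutoff r \<delta> z = 0" using \<delta> by (intro cutoff_eq_0) (auto simp: \<rho>_def)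
      then show ?thesis by (simp add: G)
    qed
    then have "\<bar>cutoff r \<delta> z - flat_weight z * p z\<bar> = flat_weight z * \<bar>\<Gamma> ?q - p z\<bar>"
      using flat_weight_nonneg[of z] by (simp add: abs_mult right_diff_distrib[symmetric])
    also have "\<dots> \<le> flat_weight z * \<epsilon>" using fp flat_weight_nonneg by (rule mult_left_mono)
    finally show "\<bar>cutoff r \<delta> z - flat_weight z * p z\<bar> \<le> \<epsilon> * flat_weight z" by (simp add: mult.commute)
  qed
qed

section \<open>Branching and immigration mechanisms\<close>

text \<open>The case \<open>r = 0\<close> is included: then the set is the whole punctured orthant. This is what makes the second
  part of the theorem an instance of the first.\<close>

lemma Kc_eq:
  assumes "0 \<le> r"
  shows "Kc r = {z\<in>orthant. r < norm (z :: real ^ 'n::finite)}"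
proof (cases "r = 0")
  case True
  then have "K r = ({} :: (real ^ 'n) set)" by (auto simp: K_def)
  then show ?thesis using True by (auto simp: Kc_def punctured_orthant_def)
next
  case False
  with assms have r: "0 < r" by simp
  have cl: "closure (K r) = {z\<in>orthant. norm (z :: real ^ 'n) \<le> r}"
  proof (intro equalityI closure_minimal)
    have eq: "{z\<in>orthant. norm (z :: real ^ 'n) \<le> r} = orthant \<inter> {z. norm z \<le> r}" by auto
    show "closed {z\<in>orthant. norm (z :: real ^ 'n) \<le> r}"
      unfolding eq by (intro closed_Int closed_orthant closed_Collect_le continuous_intros)
    show "{z\<in>orthant. norm z \<le> r} \<subseteq> closure (K r :: (real ^ 'n) set)"
    proof
      fix z :: "real ^ 'n" assume z: "z \<in> {z\<in>orthant. norm z \<le> r}"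
      define y where "y n = (1 - 1 / real (Suc n)) *\<^sub>R z" for n
      have "y n \<in> K r" for n
      proof -
        have "(1 - 1 / real (Suc n)) * norm z \<le> (1 - 1 / real (Suc n)) * r"
          using z by (intro mult_left_mono) auto
        also have "\<dots> < 1 * r" using r by (intro mult_strict_right_mono) auto
        finally have "norm (y n) < r" by (simp add: y_def)
        moreover have "y n \<in> orthant" using z by (auto simp: y_def orthant_iff)
        ultimately show ?thesis by (simp add: K_def)
      qed
      moreover have "y \<longlonglongrightarrow> (1 - 0) *\<^sub>R z"
        unfolding y_def by (intro tendsto_intros LIMSEQ_Suc[OF lim_1_over_n])
      ultimately show "z \<in> closure (K r)" unfolding closure_sequential by auto
    qed
  qed (auto simp: K_def)
  show ?thesis unfolding Kc_def cl punctured_orthant_def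
    using r by (intro set_eqI) (auto simp: not_le intro: less_trans)
qed

lemma Kc_borel: "0 \<le> r \<Longrightarrow> Kc r \<in> sets (borel :: (real ^ 'n::finite) measure)"
proof -
  assume "0 \<le> r"
  then have eq: "Kc r = orthant \<inter> {z :: real ^ 'n. r < norm z}" by (auto simp: Kc_eq)
  have "open {z :: real ^ 'n. r < norm z}" by (intro open_Collect_less continuous_intros)
  then show ?thesis unfolding eq by (rule sets.Int[OF borel_closed[OF closed_orthant] borel_open])
qed

lemma punctured_borel: "punctured_orthant \<in> sets (borel :: (real ^ 'n::finite) measure)"
  unfolding punctured_orthant_def by (rule sets.Diff[OF borel_closed[OF closed_orthant] borel_closed[OF closed_singleton]])

locale admissible_parameters =
  fixes c \<beta> :: "real ^ 'n::finite" and B :: "real ^ 'n ^ 'n"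
    and \<nu> :: "(real ^ 'n) measure" and \<mu> :: "'n \<Rightarrow> (real ^ 'n) measure"
  assumes admissible: "admissible c \<beta> B \<nu> \<mu>"
begin

text \<open>Most integrability facts are the same for \<open>\<nu>\<close> and for the \<open>\<mu> i\<close>.\<close>

definition levy_measure :: "(real ^ 'n) measure \<Rightarrow> bool" where
  "levy_measure N \<longleftrightarrow> N = \<nu> \<or> N \<in> range \<mu>"

lemma levy_measure_nu_mu: "levy_measure \<nu>" "levy_measure (\<mu> l)"
  by (auto simp: levy_measure_def)

lemma levy_sets: "levy_measure N \<Longrightarrow> sets N = sets (restrict_space borel punctured_orthant)"
  using admissible unfolding admissible_def levy_measure_def by auto

lemma levy_space: "levy_measure N \<Longrightarrow> space N = punctured_orthant"
  using sets_eq_imp_space_eq[OF levy_sets] by (simp add: space_restrict_space)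

lemma levy_measurable:
  assumes "levy_measure N" "f \<in> borel_measurable borel"
  shows "f \<in> borel_measurable N"
proof -
  have "f \<in> borel_measurable (restrict_space borel punctured_orthant)"
    using assms(2) by (rule measurable_restrict_space1)
  then show ?thesis using measurable_cong_sets[OF levy_sets[OF assms(1)] refl] by blast
qed

lemma levy_setsI: "levy_measure N \<Longrightarrow> A \<in> sets borel \<Longrightarrow> A \<subseteq> punctured_orthant \<Longrightarrow> A \<in> sets N"
  by (subst levy_sets, assumption, subst sets_restrict_space_iff) (auto simp: punctured_borel)

definition mu_weight :: "'n \<Rightarrow> real ^ 'n \<Rightarrow> real" where
  "mu_weight i z = min (norm z) ((norm z)\<^sup>2) + (\<Sum>j\<in>UNIV - {i}. min 1 (z $ j))"

lemma mu_weight_ge: "z \<in> orthant \<Longrightarrow> min 1 ((norm z)\<^sup>2) \<le> mu_weight i z"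
proof -
  assume "z \<in> orthant"
  then have "0 \<le> (\<Sum>j\<in>UNIV - {i}. min 1 (z $ j))" by (intro sum_nonneg) (auto simp: orthant_iff)
  moreover have "min 1 ((norm z)\<^sup>2) \<le> min (norm z) ((norm z)\<^sup>2)"
    using power_decreasing[of 1 2 "norm z"] by (cases "norm z \<le> 1") (auto simp: min_def)
  ultimately show ?thesis by (simp add: mu_weight_def)
qed

lemma mu_weight_nonneg: "z \<in> orthant \<Longrightarrow> 0 \<le> mu_weight i z"
  by (rule order_trans[OF _ mu_weight_ge]) auto

lemma AE_levyI:
  assumes "levy_measure N" "\<And>z. z \<in> orthant \<Longrightarrow> Q z"
  shows "AE z in N. Q z"
proof (rule AE_I2)
  fix z assume "z \<in> space N"
  then have "z \<in> orthant" by (simp add: levy_space[OF assms(1)] punctured_orthant_def)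
  then show "Q z" by (rule assms(2))
qed

lemma integrable_mu_weight: "integrable (\<mu> i) (mu_weight i)"
proof (rule integrableI_nonneg)
  show "mu_weight i \<in> borel_measurable (\<mu> i)"
    unfolding mu_weight_def by (rule levy_measurable[OF levy_measure_nu_mu(2)]) measurable
  show "AE z in \<mu> i. 0 \<le> mu_weight i z"
    by (intro AE_levyI levy_measure_nu_mu mu_weight_nonneg)
  show "(\<integral>\<^sup>+ z. ennreal (mu_weight i z) \<partial>\<mu> i) < \<infinity>"
    using admissible unfolding admissible_def mu_weight_def by auto
qed

lemma integrable_nu_weight: "integrable \<nu> (\<lambda>z. min 1 (norm z))"
proof (rule integrableI_nonneg)
  show "(\<lambda>z. min 1 (norm z)) \<in> borel_measurable \<nu>"
    by (rule levy_measurable[OF levy_measure_nu_mu(1)]) measurable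
  show "(\<integral>\<^sup>+ z. ennreal (min 1 (norm z)) \<partial>\<nu>) < \<infinity>"
    using admissible unfolding admissible_def by auto
qed simp

lemma integrable_levy_weight:
  assumes "levy_measure N"
  shows "integrable N (\<lambda>z. min 1 ((norm z)\<^sup>2))"
proof -
  have m: "(\<lambda>z. min 1 ((norm z)\<^sup>2)) \<in> borel_measurable N"
    by (rule levy_measurable[OF assms]) measurable
  consider "N = \<nu>" | i where "N = \<mu> i" using assms by (auto simp: levy_measure_def)
  then show ?thesis
  proof cases
    case 1
    have "min 1 ((norm z)\<^sup>2) \<le> min 1 (norm z)" for z :: "real ^ 'n"
      using power_decreasing[of 1 2 "norm z"] by (cases "norm z \<le> 1") (auto simp: min_def)
    then show ?thesis using m unfolding 1
      by (intro Bochner_Integration.integrable_bound[OF integrable_nu_weight]) auto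
  next
    case 2
    show ?thesis unfolding 2
    proof (rule Bochner_Integration.integrable_bound[OF integrable_mu_weight])
      show "AE z in \<mu> i. norm (min 1 ((norm z)\<^sup>2)) \<le> norm (mu_weight i z)"
      proof (rule AE_levyI[OF levy_measure_nu_mu(2)])
        fix z :: "real ^ 'n" assume "z \<in> orthant"
        then show "norm (min 1 ((norm z)\<^sup>2)) \<le> norm (mu_weight i z)"
          using mu_weight_ge[of z i] by (simp add: min_def split: if_splits)
      qed
    qed (use m 2 in simp)
  qed
qed

lemma integrable_levy_bound:
  assumes N: "levy_measure N" and f: "f \<in> borel_measurable borel"
    and bd: "\<And>z. z \<in> orthant \<Longrightarrow> \<bar>f z\<bar> \<le> C * min 1 ((norm z)\<^sup>2)"
  shows "integrable N f"
proof (rule Bochner_Integration.integrable_bound)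
  show "integrable N (\<lambda>z. C * min 1 ((norm z)\<^sup>2))" using integrable_levy_weight[OF N] by simp
  show "AE z in N. norm (f z) \<le> norm (C * min 1 ((norm z)\<^sup>2))"
    unfolding real_norm_def by (rule AE_levyI[OF N], rule order_trans[OF bd abs_ge_self])
qed (rule levy_measurable[OF N f])

lemma Kc_finite:
  assumes "0 < r" "levy_measure N"
  shows "emeasure N (Kc r) < \<infinity>"
proof -
  have "integrable N (indicator (Kc r) :: real ^ 'n \<Rightarrow> real)"
  proof (rule integrable_levy_bound[OF assms(2)])
    define k where "k = max 1 (1 / r\<^sup>2)"
    have k: "1 \<le> k" "1 / r\<^sup>2 \<le> k" by (auto simp: k_def)
    show "\<bar>indicator (Kc r) z\<bar> \<le> k * min 1 ((norm z)\<^sup>2)" for z :: "real ^ 'n"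
    proof (cases "z \<in> Kc r")
      case True
      then have "r\<^sup>2 \<le> (norm z)\<^sup>2" using assms by (auto simp: Kc_eq intro!: power_mono)
      then have "1 \<le> 1 / r\<^sup>2 * (norm z)\<^sup>2" using assms by (simp add: field_simps)
      also have "\<dots> \<le> k * (norm z)\<^sup>2" using k(2) by (intro mult_right_mono) auto
      finally show ?thesis using True k(1) by (simp add: min_def)
    qed (use k(1) in simp)
    show "indicator (Kc r) \<in> borel_measurable borel" using assms(1) by (intro borel_measurable_indicator Kc_borel) simp
  qed
  moreover have "Kc r \<in> sets N"
    using assms(1) by (intro levy_setsI[OF assms(2) Kc_borel]) (auto simp: Kc_def)
  ultimately show ?thesis by (simp add: integrable_indicator_iff sets.Int_space_eq2)
qed

definition mu_integrand :: "'n \<Rightarrow> real ^ 'n \<Rightarrow> real ^ 'n \<Rightarrow> real" where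
  "mu_integrand i u z = exp (- (u \<bullet> z)) - 1 + u $ i * min 1 (z $ i)"

text \<open>For small \<open>z\<close> the linear terms in \<open>z $ i\<close> cancel and leave the quadratic Taylor remainder and the linear
  terms in the other coordinates; for large \<open>z\<close> the integrand is bounded.\<close>

lemma mu_integrand_bound:
  assumes u: "u \<in> orthant" "norm u \<le> L" and z: "z \<in> orthant"
  shows "\<bar>mu_integrand i u z\<bar> \<le> (1 + L)\<^sup>2 * mu_weight i z"
proof -
  have L: "0 \<le> L" using u(2) norm_ge_zero order_trans by blast
  have uL: "0 \<le> u $ j" "u $ j \<le> L" for j
    using u component_le_norm_cart[of u j] by (auto simp: orthant_iff intro: order_trans[OF abs_ge_self])
  have z0: "0 \<le> z $ j" "z $ j \<le> norm z" for j
    using z component_le_norm_cart[of z j] by (auto simp: orthant_iff)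
  define a where "a = u \<bullet> z"
  define S where "S = (\<Sum>j\<in>UNIV - {i}. min 1 (z $ j))"
  have S0: "0 \<le> S" unfolding S_def using z0 by (intro sum_nonneg) auto
  have a0: "0 \<le> a" unfolding a_def using u z by (intro inner_orthant_nonneg)
  have LL: "1 + L \<le> (1 + L)\<^sup>2" "L\<^sup>2 \<le> (1 + L)\<^sup>2" "L \<le> (1 + L)\<^sup>2"
    using L by (auto simp: power2_eq_square algebra_simps)
  show ?thesis
  proof (cases "norm z \<le> 1")
    case True
    then have m: "min 1 (z $ j) = z $ j" for j using z0(2)[of j] by simp
    have "(norm z)\<^sup>2 \<le> norm z" using True power_decreasing[of 1 2 "norm z"] by simp
    then have w: "mu_weight i z = (norm z)\<^sup>2 + S" by (simp add: mu_weight_def S_def)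
    have "a = u $ i * z $ i + (\<Sum>j\<in>UNIV - {i}. u $ j * z $ j)"
      unfolding a_def inner_vec_def by (simp add: sum.remove[of UNIV i])
    then have eq: "mu_integrand i u z = (exp (- a) - 1 + a) - (\<Sum>j\<in>UNIV - {i}. u $ j * z $ j)"
      by (simp add: mu_integrand_def a_def[symmetric] m)
    have "(\<Sum>j\<in>UNIV - {i}. u $ j * z $ j) \<le> (\<Sum>j\<in>UNIV - {i}. L * z $ j)"
      using uL z0 by (intro sum_mono mult_right_mono) auto
    then have s1: "(\<Sum>j\<in>UNIV - {i}. u $ j * z $ j) \<le> L * S" by (simp add: S_def m sum_distrib_left)
    have s0: "0 \<le> (\<Sum>j\<in>UNIV - {i}. u $ j * z $ j)" using uL z0 by (intro sum_nonneg mult_nonneg_nonneg) auto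
    have "a \<le> L * norm z"
      using Cauchy_Schwarz_ineq2[of u z] u(2) mult_right_mono[OF u(2), of "norm z"] by (simp add: a_def)
    then have "a\<^sup>2 \<le> (L * norm z)\<^sup>2" using a0 by (intro power_mono)
    then have "exp (- a) - 1 + a \<le> L\<^sup>2 * (norm z)\<^sup>2"
      using exp_minus_quadratic[OF a0] by (simp add: power_mult_distrib)
    moreover have "0 \<le> exp (- a) - 1 + a" using exp_ge_add_one_self[of "- a"] by simp
    ultimately have "\<bar>mu_integrand i u z\<bar> \<le> L\<^sup>2 * (norm z)\<^sup>2 + L * S"
      unfolding eq using s0 s1 by (auto simp: abs_le_iff)
    also have "\<dots> \<le> (1 + L)\<^sup>2 * (norm z)\<^sup>2 + (1 + L)\<^sup>2 * S"
      using LL S0 by (intro add_mono mult_right_mono) auto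
    finally show ?thesis by (simp add: w distrib_left)
  next
    case False
    then have "norm z \<le> (norm z)\<^sup>2" using self_le_power[of "norm z" 2] by simp
    then have w: "mu_weight i z = norm z + S" by (simp add: mu_weight_def S_def)
    have "\<bar>exp (- a) - 1\<bar> \<le> 1" using a0 by (simp add: abs_le_iff)
    moreover have "0 \<le> u $ i * min 1 (z $ i)" using uL z0 by (intro mult_nonneg_nonneg) auto
    moreover have "u $ i * min 1 (z $ i) \<le> L * 1" using uL z0 L by (intro mult_mono) auto
    ultimately have "\<bar>mu_integrand i u z\<bar> \<le> 1 + L" unfolding mu_integrand_def a_def[symmetric] by linarith
    also have "\<dots> \<le> (1 + L)\<^sup>2 * 1" using LL by simp
    also have "\<dots> \<le> (1 + L)\<^sup>2 * mu_weight i z" unfolding w using False S0 by (intro mult_left_mono) auto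
    finally show ?thesis .
  qed
qed

lemma mu_integrand_borel: "mu_integrand i u \<in> borel_measurable borel"
  unfolding mu_integrand_def by measurable

lemma integrable_mu_integrand:
  assumes "u \<in> orthant"
  shows "integrable (\<mu> i) (mu_integrand i u)"
proof (rule Bochner_Integration.integrable_bound)
  show "integrable (\<mu> i) (\<lambda>z. (1 + norm u)\<^sup>2 * mu_weight i z)" using integrable_mu_weight by simp
  show "AE z in \<mu> i. norm (mu_integrand i u z) \<le> norm ((1 + norm u)\<^sup>2 * mu_weight i z)"
    unfolding real_norm_def
    by (rule AE_levyI[OF levy_measure_nu_mu(2)], rule order_trans[OF mu_integrand_bound[OF assms order_refl] abs_ge_self])
qed (rule levy_measurable[OF levy_measure_nu_mu(2) mu_integrand_borel])

lemma nu_integrand_bound: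
  assumes u: "u \<in> orthant" "norm u \<le> L" and z: "z \<in> orthant"
  shows "\<bar>1 - exp (- (u \<bullet> z))\<bar> \<le> (1 + L) * min 1 (norm z)"
proof -
  have L: "0 \<le> L" using u(2) norm_ge_zero order_trans by blast
  have a0: "0 \<le> u \<bullet> z" using u z by (intro inner_orthant_nonneg)
  have "u \<bullet> z \<le> L * norm z"
    using Cauchy_Schwarz_ineq2[of u z] u(2) mult_right_mono[OF u(2), of "norm z"] by simp
  also have "\<dots> \<le> (1 + L) * norm z" by (intro mult_right_mono) auto
  finally have "1 - exp (- (u \<bullet> z)) \<le> (1 + L) * norm z" using exp_ge_add_one_self[of "- (u \<bullet> z)"] by linarith
  moreover have e0: "0 \<le> exp (- (u \<bullet> z))" by simp
  have "1 - exp (- (u \<bullet> z)) \<le> 1 + L" using e0 L by linarith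
  then have "1 - exp (- (u \<bullet> z)) \<le> (1 + L) * 1" by simp
  ultimately show ?thesis using a0 by (auto simp: min_def)
qed

lemma integrable_nu_integrand:
  assumes "u \<in> orthant"
  shows "integrable \<nu> (\<lambda>z. 1 - exp (- (u \<bullet> z)))"
proof (rule Bochner_Integration.integrable_bound)
  show "integrable \<nu> (\<lambda>z. (1 + norm u) * min 1 (norm z))" using integrable_nu_weight by simp
  show "AE z in \<nu>. norm (1 - exp (- (u \<bullet> z))) \<le> norm ((1 + norm u) * min 1 (norm z))"
    unfolding real_norm_def
    by (rule AE_levyI[OF levy_measure_nu_mu(1)], rule order_trans[OF nu_integrand_bound[OF assms order_refl] abs_ge_self])
qed (rule levy_measurable[OF levy_measure_nu_mu(1)], measurable)

text \<open>Dominated convergence; a dominating function for each ball suffices, because convergent sequences of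
  parameters are bounded.\<close>

lemma continuous_on_levy_integral:
  fixes f :: "real ^ 'n \<Rightarrow> real ^ 'n \<Rightarrow> real"
  assumes N: "levy_measure N"
    and m: "\<And>u. u \<in> orthant \<Longrightarrow> f u \<in> borel_measurable N"
    and w: "\<And>L. integrable N (w L)"
    and bd: "\<And>L u z. u \<in> orthant \<Longrightarrow> norm u \<le> L \<Longrightarrow> z \<in> orthant \<Longrightarrow> \<bar>f u z\<bar> \<le> w L z"
    and cont: "\<And>z. continuous_on orthant (\<lambda>u. f u z)"
  shows "continuous_on orthant (\<lambda>u. LINT z|N. f u z :: real)"
  unfolding continuous_on_sequentially
proof (intro allI ballI impI)
  fix x :: "nat \<Rightarrow> real ^ 'n" and a assume a: "a \<in> orthant" and "(\<forall>n. x n \<in> orthant) \<and> x \<longlonglongrightarrow> a"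
  then have x: "\<And>n. x n \<in> orthant" "x \<longlonglongrightarrow> a" by auto
  then have "Bseq x" by (intro convergent_imp_Bseq) (auto simp: convergent_def)
  then obtain L where L: "\<And>n. norm (x n) \<le> L" unfolding Bseq_def by auto
  show "((\<lambda>u. LINT z|N. f u z) \<circ> x) \<longlonglongrightarrow> (LINT z|N. f a z)"
    unfolding o_def
  proof (rule integral_dominated_convergence[where w = "w L"])
    show "AE z in N. (\<lambda>n. f (x n) z) \<longlonglongrightarrow> f a z"
      using cont a x unfolding continuous_on_sequentially o_def by (intro AE_I2) blast
    show "AE z in N. norm (f (x n) z) \<le> w L z" for n
      using bd[OF x(1) L] by (intro AE_levyI[OF N]) simp
  qed (use m a x w in auto)
qed

lemma continuous_phi: "continuous_on orthant (\<phi> c B \<mu> i)"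
proof -
  have "continuous_on orthant (\<lambda>u. LINT z|\<mu> i. mu_integrand i u z)"
  proof (rule continuous_on_levy_integral[where w = "\<lambda>L z. (1 + L)\<^sup>2 * mu_weight i z"])
    show "continuous_on orthant (\<lambda>u. mu_integrand i u z)" for z
      unfolding mu_integrand_def by (intro continuous_intros)
    show "mu_integrand i u \<in> borel_measurable (\<mu> i)" for u
      by (rule levy_measurable[OF levy_measure_nu_mu(2) mu_integrand_borel])
  qed (auto intro: levy_measure_nu_mu integrable_mu_weight mu_integrand_bound)
  then show ?thesis
    unfolding \<phi>_def mu_integrand_def[symmetric] by (intro continuous_intros)
qed

lemma continuous_psi: "continuous_on orthant (\<psi> \<beta> \<nu>)"
proof -
  have "continuous_on orthant (\<lambda>u. LINT z|\<nu>. 1 - exp (- (u \<bullet> z)))"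
  proof (rule continuous_on_levy_integral[where w = "\<lambda>L z. (1 + L) * min 1 (norm z)"])
    show "(\<lambda>z. 1 - exp (- (u \<bullet> z))) \<in> borel_measurable \<nu>" for u
      by (rule levy_measurable[OF levy_measure_nu_mu(1)]) measurable
  qed (auto intro!: continuous_intros levy_measure_nu_mu integrable_nu_weight nu_integrand_bound)
  then show ?thesis unfolding \<psi>_def by (intro continuous_intros)
qed

lemma integrable_exp_on:
  assumes N: "levy_measure N" and A: "A \<in> sets N" "emeasure N A < \<infinity>" and u: "u \<in> orthant"
  shows "integrable N (\<lambda>z. indicator A z * exp (- (u \<bullet> z)))"
proof (rule Bochner_Integration.integrable_bound)
  show "integrable N (indicator A :: _ \<Rightarrow> real)" using A by simp
  show "(\<lambda>z. indicator A z * exp (- (u \<bullet> z))) \<in> borel_measurable N"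
    by (rule borel_measurable_times[OF borel_measurable_indicator[OF A(1)] levy_measurable[OF N]]) measurable
  show "AE z in N. norm (indicator A z * exp (- (u \<bullet> z))) \<le> norm (indicator A z :: real)"
    using inner_orthant_nonneg[OF u] by (intro AE_levyI[OF N]) (auto simp: indicator_def)
qed

lemma continuous_exp_on:
  assumes N: "levy_measure N" and A: "A \<in> sets N" "emeasure N A < \<infinity>"
  shows "continuous_on orthant (\<lambda>u. LINT z|N. indicator A z * exp (- (u \<bullet> z)))"
proof (rule continuous_on_levy_integral[OF N, where w = "\<lambda>L. indicator A"])
  show "(\<lambda>z. indicator A z * exp (- (u \<bullet> z))) \<in> borel_measurable N" for u
    by (rule borel_measurable_times[OF borel_measurable_indicator[OF A(1)] levy_measurable[OF N]]) measurable
  show "\<bar>indicator A z * exp (- (u \<bullet> z))\<bar> \<le> indicator A z" if "u \<in> orthant" "z \<in> orthant" for u z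
    using inner_orthant_nonneg[OF that] by (auto simp: indicator_def)
qed (use A in \<open>auto intro!: continuous_intros\<close>)

text \<open>The generator maps \<open>\<lambda>x. exp (- (u \<bullet> x))\<close> to \<open>\<lambda>x. symbol x u * exp (- (u \<bullet> x))\<close>.\<close>

definition symbol :: "real ^ 'n \<Rightarrow> real ^ 'n \<Rightarrow> real" where
  "symbol x u = (\<Sum>l\<in>UNIV. x $ l * \<phi> c B \<mu> l u) - \<psi> \<beta> \<nu> u"

text \<open>Integration against the jump kernel \<open>\<nu> + (\<Sum>l. x $ l * \<mu> l)\<close> of the process at \<open>x\<close>.\<close>

definition jump_integral :: "real ^ 'n \<Rightarrow> (real ^ 'n \<Rightarrow> real) \<Rightarrow> real" where
  "jump_integral x f = (LINT z|\<nu>. f z) + (\<Sum>l\<in>UNIV. x $ l * (LINT z|\<mu> l. f z))"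

definition jump_integrable :: "(real ^ 'n \<Rightarrow> real) \<Rightarrow> bool" where
  "jump_integrable f \<longleftrightarrow> (\<forall>N. levy_measure N \<longrightarrow> integrable N f)"

lemma jump_integrableD: "jump_integrable f \<Longrightarrow> integrable \<nu> f" "jump_integrable f \<Longrightarrow> integrable (\<mu> l) f"
  by (auto simp: jump_integrable_def levy_measure_nu_mu)

lemma jump_integral_add:
  "jump_integrable f \<Longrightarrow> jump_integrable g \<Longrightarrow> jump_integral x (\<lambda>z. f z + g z) = jump_integral x f + jump_integral x g"
  by (simp add: jump_integral_def jump_integrableD distrib_left sum.distrib)

lemma jump_integral_diff:
  "jump_integrable f \<Longrightarrow> jump_integrable g \<Longrightarrow> jump_integral x (\<lambda>z. f z - g z) = jump_integral x f - jump_integral x g"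
  by (simp add: jump_integral_def jump_integrableD right_diff_distrib sum_subtractf)

lemma jump_integral_cmult: "jump_integral x (\<lambda>z. a * f z) = a * jump_integral x f"
  by (simp add: jump_integral_def distrib_left sum_distrib_left mult.left_commute)

lemma jump_integral_mono:
  assumes "x \<in> orthant" "jump_integrable f" "jump_integrable g" "\<And>z. z \<in> orthant \<Longrightarrow> f z \<le> g z"
  shows "jump_integral x f \<le> jump_integral x g"
proof -
  have "(LINT z|N. f z) \<le> (LINT z|N. g z)" if "levy_measure N" for N
    using assms(2-) that by (intro integral_mono) (auto simp: jump_integrable_def levy_space punctured_orthant_def)
  then show ?thesis unfolding jump_integral_def
    using assms(1) by (intro add_mono sum_mono mult_left_mono) (auto simp: levy_measure_nu_mu orthant_iff)
qed

lemma jump_integral_cong: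
  assumes "\<And>z. z \<in> orthant \<Longrightarrow> f z = g z"
  shows "jump_integral x f = jump_integral x g"
proof -
  have "(LINT z|N. f z) = (LINT z|N. g z)" if "levy_measure N" for N
    using assms that by (intro Bochner_Integration.integral_cong) (auto simp: levy_space punctured_orthant_def)
  then show ?thesis by (simp add: jump_integral_def levy_measure_nu_mu)
qed

lemma jump_integral_bounded_start:
  assumes "x \<in> orthant" "norm x \<le> R" "jump_integrable f" "\<And>z. z \<in> orthant \<Longrightarrow> 0 \<le> f z"
  shows "jump_integral x f \<le> jump_integral (\<chi> l. R) f" "0 \<le> jump_integral x f"
proof -
  have nn: "0 \<le> (LINT z|N. f z)" if "levy_measure N" for N
    using assms(4) by (intro integral_nonneg_AE AE_levyI[OF that])
  have "x $ l \<le> R" for l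
    using assms component_le_norm_cart[of x l] by linarith
  then show "jump_integral x f \<le> jump_integral (\<chi> l. R) f"
    unfolding jump_integral_def using nn by (auto intro!: add_mono sum_mono mult_right_mono levy_measure_nu_mu)
  show "0 \<le> jump_integral x f"
    unfolding jump_integral_def using nn assms(1) by (auto intro!: add_nonneg_nonneg sum_nonneg mult_nonneg_nonneg levy_measure_nu_mu simp: orthant_iff)
qed

text \<open>A fourth difference in the direction \<open>k\<close>: it annihilates polynomials in \<open>u\<close> of degree at most three, in
  particular the compensating terms of the integrand here and the drift and diffusion terms of \<open>\<phi>\<close> below,
  and it turns \<open>exp (- (u \<bullet> z))\<close> into its product with \<open>(1 - exp (- (z $ k))) ^ 4\<close>.\<close>

lemma mu_integrand_alternating:
  fixes u z :: "real ^ 'n" and k :: 'n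
  defines "U \<equiv> \<lambda>j::real. u + j *\<^sub>R axis k 1"
  shows "mu_integrand i (U 0) z - 4 * mu_integrand i (U 1) z + 6 * mu_integrand i (U 2) z
    - 4 * mu_integrand i (U 3) z + mu_integrand i (U 4) z = (1 - exp (- (z $ k))) ^ 4 * exp (- (u \<bullet> z))"
proof -
  define q where "q = exp (- (z $ k))"
  define E where "E = exp (- (u \<bullet> z))"
  have e: "exp (- (U (real j) \<bullet> z)) = E * q ^ j" for j
    by (simp add: U_def inner_add_left inner_axis' E_def q_def exp_of_nat_mult[symmetric] exp_add[symmetric] exp_diff exp_minus field_simps)
  have U: "U j $ i = u $ i + j * axis k 1 $ i" for j by (simp add: U_def)
  show ?thesis
    unfolding mu_integrand_def U
    using e[of 0] e[of 1] e[of 2] e[of 3] e[of 4]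
    by (simp add: q_def[symmetric] E_def[symmetric]) (simp add: algebra_simps power2_eq_square power3_eq_cube power4_eq_xxxx)
qed

lemma phi_alternating:
  fixes u :: "real ^ 'n" and k :: 'n
  defines "U \<equiv> \<lambda>j::real. u + j *\<^sub>R axis k 1"
  assumes u: "u \<in> orthant"
  shows "\<phi> c B \<mu> i (U 0) - 4 * \<phi> c B \<mu> i (U 1) + 6 * \<phi> c B \<mu> i (U 2) - 4 * \<phi> c B \<mu> i (U 3) + \<phi> c B \<mu> i (U 4)
    = (LINT z|\<mu> i. (1 - exp (- (z $ k))) ^ 4 * exp (- (u \<bullet> z)))"
proof -
  have Uo: "U j \<in> orthant" if "0 \<le> j" for j
    using u that by (auto simp: U_def orthant_iff axis_def)
  have int: "integrable (\<mu> i) (mu_integrand i (U j))" if "0 \<le> j" for j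
    using Uo[OF that] by (rule integrable_mu_integrand)
  define I where "I j = (LINT z|\<mu> i. mu_integrand i (U j) z)" for j
  have "(LINT z|\<mu> i. (1 - exp (- (z $ k))) ^ 4 * exp (- (u \<bullet> z))) =
     (LINT z|\<mu> i. mu_integrand i (U 0) z - 4 * mu_integrand i (U 1) z + 6 * mu_integrand i (U 2) z
    - 4 * mu_integrand i (U 3) z + mu_integrand i (U 4) z)"
    unfolding U_def mu_integrand_alternating ..
  also have "\<dots> = I 0 - 4 * I 1 + 6 * I 2 - 4 * I 3 + I 4"
    unfolding I_def using int by simp
  finally have lhs: "(LINT z|\<mu> i. (1 - exp (- (z $ k))) ^ 4 * exp (- (u \<bullet> z))) = I 0 - 4 * I 1 + 6 * I 2 - 4 * I 3 + I 4" .
  define a where "a = (axis k 1 :: real ^ 'n) $ i"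
  define b where "b = (B *v axis i 1) \<bullet> axis k 1"
  have phi: "\<phi> c B \<mu> i (U j) = c $ i * (u $ i + j * a)\<^sup>2 - ((B *v axis i 1) \<bullet> u + j * b) + I j" for j
    by (simp add: \<phi>_def I_def mu_integrand_def U_def a_def b_def inner_add_right)
  show ?thesis unfolding lhs phi by (simp add: algebra_simps power2_eq_square)
qed

lemma psi_alternating:
  fixes u :: "real ^ 'n" and k :: 'n
  defines "U \<equiv> \<lambda>j::real. u + j *\<^sub>R axis k 1"
  assumes u: "u \<in> orthant"
  shows "\<psi> \<beta> \<nu> (U 0) - 4 * \<psi> \<beta> \<nu> (U 1) + 6 * \<psi> \<beta> \<nu> (U 2) - 4 * \<psi> \<beta> \<nu> (U 3) + \<psi> \<beta> \<nu> (U 4)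
    = - (LINT z|\<nu>. (1 - exp (- (z $ k))) ^ 4 * exp (- (u \<bullet> z)))"
proof -
  have Uo: "U j \<in> orthant" if "0 \<le> j" for j
    using u that by (auto simp: U_def orthant_iff axis_def)
  define f where "f j z = 1 - exp (- (U j \<bullet> z))" for j z
  have int: "integrable \<nu> (f j)" if "0 \<le> j" for j
    unfolding f_def using Uo[OF that] by (rule integrable_nu_integrand)
  define I where "I j = (LINT z|\<nu>. f j z)" for j
  have alt: "f 0 z - 4 * f 1 z + 6 * f 2 z - 4 * f 3 z + f 4 z = - ((1 - exp (- (z $ k))) ^ 4 * exp (- (u \<bullet> z)))" for z
    using mu_integrand_alternating[where u = u and k = k and z = z and i = k]
    unfolding f_def mu_integrand_def U_def[symmetric]
    by (simp add: U_def algebra_simps)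
  have "- (LINT z|\<nu>. (1 - exp (- (z $ k))) ^ 4 * exp (- (u \<bullet> z))) =
     (LINT z|\<nu>. f 0 z - 4 * f 1 z + 6 * f 2 z - 4 * f 3 z + f 4 z)"
    unfolding alt by simp
  also have "\<dots> = I 0 - 4 * I 1 + 6 * I 2 - 4 * I 3 + I 4"
    unfolding I_def using int by simp
  finally have lhs: "- (LINT z|\<nu>. (1 - exp (- (z $ k))) ^ 4 * exp (- (u \<bullet> z))) = I 0 - 4 * I 1 + 6 * I 2 - 4 * I 3 + I 4" .
  have psi: "\<psi> \<beta> \<nu> (U j) = \<beta> \<bullet> u + j * (\<beta> \<bullet> axis k 1) + I j" for j
    by (simp add: \<psi>_def I_def f_def U_def inner_add_right)
  show ?thesis unfolding lhs psi by (simp add: algebra_simps)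
qed

lemma symbol_alternating:
  fixes u :: "real ^ 'n" and k :: 'n
  defines "U \<equiv> \<lambda>j::real. u + j *\<^sub>R axis k 1"
  assumes u: "u \<in> orthant"
  shows "symbol x (U 0) - 4 * symbol x (U 1) + 6 * symbol x (U 2) - 4 * symbol x (U 3) + symbol x (U 4)
    = jump_integral x (\<lambda>z. (1 - exp (- (z $ k))) ^ 4 * exp (- (u \<bullet> z)))"
proof -
  have lin: "(\<Sum>l\<in>UNIV. x $ l * (a l - 4 * b l + 6 * d l - 4 * e l + f l)) =
      (\<Sum>l\<in>UNIV. x $ l * a l) - 4 * (\<Sum>l\<in>UNIV. x $ l * b l) + 6 * (\<Sum>l\<in>UNIV. x $ l * d l)
        - 4 * (\<Sum>l\<in>UNIV. x $ l * e l) + (\<Sum>l\<in>UNIV. x $ l * f l)" for a b d e f :: "'n \<Rightarrow> real"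
    unfolding sum_distrib_left sum.distrib[symmetric] sum_subtractf[symmetric]
    by (intro sum.cong refl) (simp add: algebra_simps)
  have eq1: "symbol x (U 0) - 4 * symbol x (U 1) + 6 * symbol x (U 2) - 4 * symbol x (U 3) + symbol x (U 4)
    = (\<Sum>l\<in>UNIV. x $ l * (\<phi> c B \<mu> l (U 0) - 4 * \<phi> c B \<mu> l (U 1) + 6 * \<phi> c B \<mu> l (U 2) - 4 * \<phi> c B \<mu> l (U 3) + \<phi> c B \<mu> l (U 4)))
    - (\<psi> \<beta> \<nu> (U 0) - 4 * \<psi> \<beta> \<nu> (U 1) + 6 * \<psi> \<beta> \<nu> (U 2) - 4 * \<psi> \<beta> \<nu> (U 3) + \<psi> \<beta> \<nu> (U 4))"
    unfolding symbol_def lin right_diff_distrib by linarith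
  have eq2: "\<phi> c B \<mu> l (U 0) - 4 * \<phi> c B \<mu> l (U 1) + 6 * \<phi> c B \<mu> l (U 2) - 4 * \<phi> c B \<mu> l (U 3) + \<phi> c B \<mu> l (U 4)
    = (LINT z|\<mu> l. (1 - exp (- (z $ k))) ^ 4 * exp (- (u \<bullet> z)))" for l
    unfolding U_def by (rule phi_alternating[OF u])
  have eq3: "\<psi> \<beta> \<nu> (U 0) - 4 * \<psi> \<beta> \<nu> (U 1) + 6 * \<psi> \<beta> \<nu> (U 2) - 4 * \<psi> \<beta> \<nu> (U 3) + \<psi> \<beta> \<nu> (U 4)
    = - (LINT z|\<nu>. (1 - exp (- (z $ k))) ^ 4 * exp (- (u \<bullet> z)))"
    unfolding U_def by (rule psi_alternating[OF u])
  show ?thesis unfolding eq1 eq2 eq3 jump_integral_def by linarith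
qed

end

section \<open>Small increments and the jump kernel\<close>

locale cbi_kernel = admissible_parameters c \<beta> B \<nu> \<mu>
  for c \<beta> :: "real ^ 'n::finite" and B :: "real ^ 'n ^ 'n"
    and \<nu> :: "(real ^ 'n) measure" and \<mu> :: "'n \<Rightarrow> (real ^ 'n) measure" +
  fixes P :: "real \<Rightarrow> real ^ 'n \<Rightarrow> (real ^ 'n) measure"
  assumes semigroup: "cbi_semigroup c \<beta> B \<nu> \<mu> P"
begin

lemma transition: "transition_semigroup P"
  using semigroup unfolding cbi_semigroup_def by blast

lemma laplace:
  assumes "u \<in> orthant"
  obtains v where "is_v c B \<mu> u v"
    "\<And>x t. x \<in> orthant \<Longrightarrow> 0 \<le> t \<Longrightarrow> (LINT y|P t x. exp (- (u \<bullet> y))) = exp (- (x \<bullet> v t) - integral {0..t} (\<lambda>s. \<psi> \<beta> \<nu> (v s)))"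
  using semigroup assms unfolding cbi_semigroup_def by blast

lemma kernel_measurable:
  assumes x: "x \<in> orthant" and t: "0 \<le> t" and f: "f \<in> borel_measurable borel"
  shows "f \<in> borel_measurable (P t x)"
proof -
  have "f \<in> borel_measurable state_algebra" using f by (rule measurable_restrict_space1)
  then show ?thesis
    using measurable_cong_sets[OF transition_kernel(3)[OF transition t x] refl] by blast
qed

lemma kernel_AEI:
  assumes x: "x \<in> orthant" and t: "0 \<le> t" and Q: "\<And>y. y \<in> orthant \<Longrightarrow> Q y"
  shows "AE y in P t x. Q y"
  using transition_kernel(4)[OF transition t x] by (intro AE_I2 Q) simp

lemma kernel_integrable:
  assumes x: "x \<in> orthant" and t: "0 \<le> t" and f: "f \<in> borel_measurable borel"
    and bd: "\<And>y. y \<in> orthant \<Longrightarrow> \<bar>f y\<bar> \<le> C"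
  shows "integrable (P t x) (f :: real ^ 'n \<Rightarrow> real)"
proof -
  interpret p: prob_space "P t x" using transition_kernel(2)[OF transition t x] .
  show ?thesis
  proof (rule p.integrable_const_bound[where B = C])
    show "AE y in P t x. norm (f y) \<le> C" by (rule kernel_AEI[OF x t]) (simp add: bd)
  qed (rule kernel_measurable[OF x t f])
qed

lemma exp_shift_bound:
  fixes x y u :: "real ^ 'n"
  assumes "x \<in> orthant" "u \<in> orthant" "y \<in> orthant"
  shows "exp (- (u \<bullet> (y - x))) \<le> exp (u \<bullet> x)"
  using inner_orthant_nonneg[OF assms(2,3)] by (simp add: inner_diff_right)

text \<open>The increment \<open>y - x\<close> replaces \<open>y\<close>, so that the leading term is \<open>1\<close>.\<close>

lemma laplace_small_time:
  assumes e: "0 < e"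
  shows "eventually (\<lambda>h. \<forall>x\<in>orthant. \<forall>u\<in>orthant. norm x \<le> R \<longrightarrow> norm u \<le> L \<longrightarrow>
    \<bar>(\<integral>y. exp (- (u \<bullet> (y - x))) \<partial>P h x) - 1 - h * symbol x u\<bar> \<le> e * h) (at_right 0)"
proof -
  have "eventually (\<lambda>h. \<forall>a v x. norm a \<le> L \<longrightarrow> norm x \<le> R \<longrightarrow> orthant_solution (\<lambda>i y. - \<phi> c B \<mu> i y) a v \<longrightarrow>
     \<bar>exp (x \<bullet> a - x \<bullet> v h - integral {0..h} (\<lambda>s. \<psi> \<beta> \<nu> (v s))) - 1 + h * ((\<Sum>l\<in>UNIV. x $ l * - \<phi> c B \<mu> l a) + \<psi> \<beta> \<nu> a)\<bar> \<le> e * h)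
   (at_right 0)"
    by (rule affine_exponential_small_time[OF _ continuous_psi e]) (intro continuous_intros continuous_phi)
  moreover have "eventually (\<lambda>h::real. 0 < h) (at_right 0)" by (rule eventually_at_right_less)
  ultimately show ?thesis
  proof eventually_elim
    case (elim h)
    show ?case
    proof (intro ballI impI)
      fix x u :: "real ^ 'n" assume x: "x \<in> orthant" and u: "u \<in> orthant" and n: "norm x \<le> R" "norm u \<le> L"
      obtain v where v: "is_v c B \<mu> u v"
        "(LINT y|P h x. exp (- (u \<bullet> y))) = exp (- (x \<bullet> v h) - integral {0..h} (\<lambda>s. \<psi> \<beta> \<nu> (v s)))"
        using laplace[OF u] x elim(2) by (metis less_imp_le)
      have "(\<integral>y. exp (- (u \<bullet> (y - x))) \<partial>P h x) = (\<integral>y. exp (u \<bullet> x) * exp (- (u \<bullet> y)) \<partial>P h x)"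
        by (intro Bochner_Integration.integral_cong) (auto simp: inner_diff_right exp_add[symmetric])
      also have "\<dots> = exp (u \<bullet> x) * exp (- (x \<bullet> v h) - integral {0..h} (\<lambda>s. \<psi> \<beta> \<nu> (v s)))"
        by (simp add: v(2))
      also have "\<dots> = exp (x \<bullet> u - x \<bullet> v h - integral {0..h} (\<lambda>s. \<psi> \<beta> \<nu> (v s)))"
        by (simp add: exp_add[symmetric] inner_commute)
      finally have I: "(\<integral>y. exp (- (u \<bullet> (y - x))) \<partial>P h x) = exp (x \<bullet> u - x \<bullet> v h - integral {0..h} (\<lambda>s. \<psi> \<beta> \<nu> (v s)))" .
      have "(\<Sum>l\<in>UNIV. x $ l * - \<phi> c B \<mu> l u) + \<psi> \<beta> \<nu> u = - symbol x u"
        by (simp add: symbol_def sum_negf)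
      moreover have "\<bar>exp (x \<bullet> u - x \<bullet> v h - integral {0..h} (\<lambda>s. \<psi> \<beta> \<nu> (v s))) - 1 + h * ((\<Sum>l\<in>UNIV. x $ l * - \<phi> c B \<mu> l u) + \<psi> \<beta> \<nu> u)\<bar> \<le> e * h"
        using elim(1) n v(1) unfolding is_v_def by blast
      ultimately show "\<bar>(\<integral>y. exp (- (u \<bullet> (y - x))) \<partial>P h x) - 1 - h * symbol x u\<bar> \<le> e * h"
        unfolding I by simp
    qed
  qed
qed

text \<open>Growth conditions under which the mean over an increment and the integral over the jump kernel both
  exist: from a starting point of norm at most \<open>R\<close> the increments have coordinates at least \<open>- R\<close>, whereas
  the Levy measures live on the orthant and may be infinite near \<open>0\<close>.\<close>

definition test_function :: "(real ^ 'n \<Rightarrow> real) \<Rightarrow> bool" where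
  "test_function f \<longleftrightarrow> continuous_on UNIV f \<and> (\<forall>R. \<exists>C. \<forall>z. (\<forall>i. - R \<le> z $ i) \<longrightarrow> \<bar>f z\<bar> \<le> C) \<and>
     (\<exists>C. \<forall>z\<in>orthant. \<bar>f z\<bar> \<le> C * min 1 ((norm z)\<^sup>2))"

lemma test_function_add:
  assumes "test_function f" "test_function g"
  shows "test_function (\<lambda>z. f z + g z)"
  unfolding test_function_def
proof (intro conjI allI)
  show "continuous_on UNIV (\<lambda>z. f z + g z)" using assms by (auto simp: test_function_def intro: continuous_intros)
  fix R
  obtain C1 C2 where "\<forall>z. (\<forall>i. - R \<le> z $ i) \<longrightarrow> \<bar>f z\<bar> \<le> C1" "\<forall>z. (\<forall>i. - R \<le> z $ i) \<longrightarrow> \<bar>g z\<bar> \<le> C2"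
    using assms unfolding test_function_def by meson
  then show "\<exists>C. \<forall>z. (\<forall>i. - R \<le> z $ i) \<longrightarrow> \<bar>f z + g z\<bar> \<le> C"
    by (intro exI[of _ "C1 + C2"]) (meson abs_triangle_ineq add_mono order_trans)
next
  obtain C1 C2 where C: "\<forall>z\<in>orthant. \<bar>f z\<bar> \<le> C1 * min 1 ((norm z)\<^sup>2)" "\<forall>z\<in>orthant. \<bar>g z\<bar> \<le> C2 * min 1 ((norm z)\<^sup>2)"
    using assms unfolding test_function_def by meson
  show "\<exists>C. \<forall>z\<in>orthant. \<bar>f z + g z\<bar> \<le> C * min 1 ((norm z)\<^sup>2)"
    using C by (intro exI[of _ "C1 + C2"]) (auto simp: distrib_right intro: order_trans[OF abs_triangle_ineq add_mono])
qed

lemma test_function_zero: "test_function (\<lambda>z. 0)"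
  by (auto simp: test_function_def intro!: exI[of _ 0])

lemma test_function_sum:
  assumes "finite I" "\<And>i. i \<in> I \<Longrightarrow> test_function (f i)"
  shows "test_function (\<lambda>z. \<Sum>i\<in>I. f i z)"
  using assms
proof (induction I rule: finite_induct)
  case empty
  show ?case using test_function_zero by simp
next
  case (insert i I)
  have "test_function (f i)" "test_function (\<lambda>z. \<Sum>i\<in>I. f i z)" using insert by auto
  from test_function_add[OF this] show ?case unfolding sum.insert[OF insert(1,2)] .
qed

lemma test_function_mult:
  assumes f: "test_function f" and g: "exponential_sum g"
  shows "test_function (\<lambda>z. f z * g z)"
  unfolding test_function_def
proof (intro conjI allI)
  show "continuous_on UNIV (\<lambda>z. f z * g z)" using f exponential_sum_continuous[OF g] by (auto simp: test_function_def intro: continuous_intros)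
  fix R
  obtain C1 C2 where C: "\<forall>z. (\<forall>i. - R \<le> z $ i) \<longrightarrow> \<bar>f z\<bar> \<le> C1" "\<forall>z. (\<forall>i. - R \<le> z $ i) \<longrightarrow> \<bar>g z\<bar> \<le> C2"
    using f exponential_sum_bounded[OF g] unfolding test_function_def by meson
  have "\<bar>f z * g z\<bar> \<le> C1 * C2" if "\<forall>i. - R \<le> z $ i" for z
  proof -
    have "\<bar>f z\<bar> \<le> C1" "\<bar>g z\<bar> \<le> C2" using C that by auto
    then show ?thesis unfolding abs_mult by (rule mult_mono') auto
  qed
  then show "\<exists>C. \<forall>z. (\<forall>i. - R \<le> z $ i) \<longrightarrow> \<bar>f z * g z\<bar> \<le> C" by blast
next
  obtain C1 where C1: "\<forall>z\<in>orthant. \<bar>f z\<bar> \<le> C1 * min 1 ((norm z)\<^sup>2)"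
    using f unfolding test_function_def by meson
  obtain C2 where C2: "\<forall>z. (\<forall>i. - 0 \<le> z $ i) \<longrightarrow> \<bar>g z\<bar> \<le> C2"
    using exponential_sum_bounded[OF g, of 0] by blast
  have "\<bar>f z * g z\<bar> \<le> C1 * C2 * min 1 ((norm z)\<^sup>2)" if z: "z \<in> orthant" for z
  proof -
    have "\<bar>f z\<bar> \<le> C1 * min 1 ((norm z)\<^sup>2)" "\<bar>g z\<bar> \<le> C2" using C1 C2 z by (auto simp: orthant_iff)
    then have "\<bar>f z\<bar> * \<bar>g z\<bar> \<le> (C1 * min 1 ((norm z)\<^sup>2)) * C2" by (rule mult_mono') auto
    then show ?thesis by (simp add: abs_mult mult.commute mult.left_commute)
  qed
  then show "\<exists>C. \<forall>z\<in>orthant. \<bar>f z * g z\<bar> \<le> C * min 1 ((norm z)\<^sup>2)" by blast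
qed

lemma test_function_flat_weight_component: "test_function (\<lambda>z. (1 - exp (- (z $ i))) ^ 4)"
  unfolding test_function_def
proof (intro conjI allI)
  show "continuous_on UNIV (\<lambda>z :: real ^ 'n. (1 - exp (- (z $ i))) ^ 4)" by (intro continuous_intros)
  fix R
  have "\<bar>(1 - exp (- (z $ i))) ^ 4\<bar> \<le> (1 + exp R) ^ 4" if "\<forall>i. - R \<le> z $ i" for z :: "real ^ 'n"
  proof -
    have "- R \<le> z $ i" using that by blast
    then have "exp (- (z $ i)) \<le> exp R" by (subst exp_le_cancel_iff) linarith
    then have "\<bar>1 - exp (- (z $ i))\<bar> \<le> 1 + exp R" using exp_ge_zero[of "- (z $ i)"] by linarith
    then show ?thesis unfolding power_abs by (rule power_mono) simp
  qed
  then show "\<exists>C. \<forall>z :: real ^ 'n. (\<forall>i. - R \<le> z $ i) \<longrightarrow> \<bar>(1 - exp (- (z $ i))) ^ 4\<bar> \<le> C" by blast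
next
  have "\<bar>(1 - exp (- (z $ i))) ^ 4\<bar> \<le> 1 * min 1 ((norm z)\<^sup>2)" if z: "z \<in> orthant" for z :: "real ^ 'n"
  proof -
    define q where "q = 1 - exp (- (z $ i))"
    have zi: "0 \<le> z $ i" using z by (simp add: orthant_iff)
    have q: "0 \<le> q" "q \<le> 1" using zi by (auto simp: q_def)
    have "q \<le> z $ i" using exp_ge_add_one_self[of "- (z $ i)"] by (simp add: q_def)
    also have "z $ i \<le> norm z" using component_le_norm_cart[of z i] by linarith
    finally have "q\<^sup>2 \<le> (norm z)\<^sup>2" using q by (intro power_mono)
    moreover have "q ^ 4 \<le> q\<^sup>2" using q by (intro power_decreasing) auto
    moreover have "q ^ 4 \<le> 1" using q by (intro power_le_one)
    ultimately show ?thesis unfolding q_def[symmetric] using power4_nonneg[of q] by simp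
  qed
  then show "\<exists>C. \<forall>z :: real ^ 'n\<in>orthant. \<bar>(1 - exp (- (z $ i))) ^ 4\<bar> \<le> C * min 1 ((norm z)\<^sup>2)" by blast
qed

lemma test_function_flat_weight: "test_function flat_weight"
  unfolding flat_weight_def[abs_def] by (rule test_function_sum) (auto intro: test_function_flat_weight_component)

lemma test_function_exp: "test_function f \<Longrightarrow> u \<in> orthant \<Longrightarrow> test_function (\<lambda>z. f z * exp (- (u \<bullet> z)))"
  using test_function_mult[of f "\<lambda>z. 1 * exp (- (u \<bullet> z))"] exponential_sum_term[of u 1] by simp

lemma test_function_jump_integrable:
  assumes "test_function f"
  shows "jump_integrable f"
proof -
  obtain C where C: "\<And>z. z \<in> orthant \<Longrightarrow> \<bar>f z\<bar> \<le> C * min 1 ((norm z)\<^sup>2)"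
    using assms unfolding test_function_def by meson
  have "f \<in> borel_measurable borel"
    using assms unfolding test_function_def by (intro borel_measurable_continuous_onI) blast
  then show ?thesis unfolding jump_integrable_def using integrable_levy_bound C by blast
qed

lemma test_function_kernel_integrable:
  assumes f: "test_function f" and x: "x \<in> orthant" and h: "0 \<le> h"
  shows "integrable (P h x) (\<lambda>y. f (y - x))"
proof -
  have "\<exists>C. \<forall>z. (\<forall>i. - norm x \<le> z $ i) \<longrightarrow> \<bar>f z\<bar> \<le> C"
    using f unfolding test_function_def by (elim conjE) (rule spec)
  then obtain C where C: "\<forall>z. (\<forall>i. - norm x \<le> z $ i) \<longrightarrow> \<bar>f z\<bar> \<le> C" ..
  show ?thesis
  proof (rule kernel_integrable[OF x h])
    have fc: "continuous_on UNIV f" using f unfolding test_function_def by (rule conjunct1)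
    have "continuous_on UNIV (\<lambda>y. y - x)" by (intro continuous_intros)
    from continuous_on_compose2[OF fc this] have "continuous_on UNIV (\<lambda>y. f (y - x))" by simp
    then show "(\<lambda>y. f (y - x)) \<in> borel_measurable borel" by (rule borel_measurable_continuous_onI)
    show "\<bar>f (y - x)\<bar> \<le> C" if y: "y \<in> orthant" for y
    proof (rule C[rule_format])
      fix i
      have "x $ i \<le> norm x" using component_le_norm_cart[of x i] by linarith
      moreover have "0 \<le> y $ i" using y by (simp add: orthant_iff)
      ultimately show "- norm x \<le> (y - x) $ i" by simp
    qed
  qed
qed

text \<open>The exponential weights in these means are there because the survival probability is an exponential of the
  state; \<open>u\<close> is going to be a value of the solution of the killed equation.\<close>

definition kernel_mean :: "real \<Rightarrow> real ^ 'n \<Rightarrow> real ^ 'n \<Rightarrow> (real ^ 'n \<Rightarrow> real) \<Rightarrow> real" where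
  "kernel_mean h x u f = (\<integral>y. f (y - x) * exp (- (u \<bullet> (y - x))) \<partial>P h x)"

definition jump_mean :: "real ^ 'n \<Rightarrow> real ^ 'n \<Rightarrow> (real ^ 'n \<Rightarrow> real) \<Rightarrow> real" where
  "jump_mean x u f = jump_integral x (\<lambda>z. f z * exp (- (u \<bullet> z)))"

lemma kernel_mean_add:
  assumes "test_function f" "test_function g" "x \<in> orthant" "u \<in> orthant" "0 \<le> h"
  shows "kernel_mean h x u (\<lambda>z. f z + g z) = kernel_mean h x u f + kernel_mean h x u g"
  unfolding kernel_mean_def distrib_right
  by (rule Bochner_Integration.integral_add[OF test_function_kernel_integrable[OF test_function_exp[OF assms(1,4)] assms(3,5)]
        test_function_kernel_integrable[OF test_function_exp[OF assms(2,4)] assms(3,5)]])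

lemma jump_mean_add:
  assumes "test_function f" "test_function g" "u \<in> orthant"
  shows "jump_mean x u (\<lambda>z. f z + g z) = jump_mean x u f + jump_mean x u g"
  unfolding jump_mean_def distrib_right
  by (rule jump_integral_add[OF test_function_jump_integrable[OF test_function_exp[OF assms(1,3)]]
        test_function_jump_integrable[OF test_function_exp[OF assms(2,3)]]])

text \<open>The error is uniform for bounded \<open>x\<close> and \<open>u\<close>; this is what makes the errors of \<open>n\<close> steps of length \<open>t / n\<close>
  add up to something small.\<close>

definition small_time_rate :: "(real ^ 'n \<Rightarrow> real) \<Rightarrow> bool" where
  "small_time_rate f \<longleftrightarrow> (\<forall>R L e. 0 < e \<longrightarrow>
     eventually (\<lambda>h. \<forall>x\<in>orthant. \<forall>u\<in>orthant. norm x \<le> R \<longrightarrow> norm u \<le> L \<longrightarrow>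
       \<bar>kernel_mean h x u f - h * jump_mean x u f\<bar> \<le> e * h) (at_right 0))"

lemma small_time_rateD:
  assumes "small_time_rate f" "0 < e"
  shows "eventually (\<lambda>h. \<forall>x\<in>orthant. \<forall>u\<in>orthant. norm x \<le> R \<longrightarrow> norm u \<le> L \<longrightarrow>
    \<bar>kernel_mean h x u f - h * jump_mean x u f\<bar> \<le> e * h) (at_right 0)"
  using assms unfolding small_time_rate_def by blast

lemma small_time_rateI:
  assumes "\<And>R L e. 0 < e \<Longrightarrow> eventually (\<lambda>h. \<forall>x\<in>orthant. \<forall>u\<in>orthant. norm x \<le> R \<longrightarrow> norm u \<le> L \<longrightarrow>
    \<bar>kernel_mean h x u f - h * jump_mean x u f\<bar> \<le> e * h) (at_right 0)"
  shows "small_time_rate f"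
  using assms unfolding small_time_rate_def by blast

text \<open>Both means are fourth differences in \<open>u\<close>: of the Laplace transform of the increment and, by
  \<open>symbol_alternating\<close>, of the symbol. So the claim is the fourth difference of \<open>laplace_small_time\<close>.\<close>

lemma small_time_rate_flat_component:
  assumes m: "m \<in> orthant"
  shows "small_time_rate (\<lambda>z. (1 - exp (- (z $ k))) ^ 4 * (a * exp (- (m \<bullet> z))))"
    (is "small_time_rate ?f")
proof (rule small_time_rateI)
  fix R L e :: real assume e: "0 < e"
  \<comment> \<open>16 is the sum of the absolute values of the coefficients 1, 4, 6, 4, 1\<close>
  define e' where "e' = e / (16 * (\<bar>a\<bar> + 1))"
  have e': "0 < e'" "16 * \<bar>a\<bar> * e' \<le> e"
  proof -
    define b where "b = \<bar>a\<bar> + 1"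
    have b: "0 < b" "\<bar>a\<bar> \<le> b" by (auto simp: b_def)
    show "0 < e'" using e by (simp add: e'_def)
    have "16 * \<bar>a\<bar> * e' \<le> 16 * b * e'" using b \<open>0 < e'\<close> by (intro mult_right_mono) auto
    also have "\<dots> = e" using b by (simp add: e'_def b_def[symmetric])
    finally show "16 * \<bar>a\<bar> * e' \<le> e" .
  qed
  have "eventually (\<lambda>h::real. 0 < h) (at_right 0)" by (rule eventually_at_right_less)
  with laplace_small_time[OF e'(1), of R "L + norm m + 4"]
  show "eventually (\<lambda>h. \<forall>x\<in>orthant. \<forall>u\<in>orthant. norm x \<le> R \<longrightarrow> norm u \<le> L \<longrightarrow>
    \<bar>kernel_mean h x u ?f - h * jump_mean x u ?f\<bar> \<le> e * h) (at_right 0)"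
  proof eventually_elim
    case (elim h)
    show ?case
    proof (intro ballI impI)
      fix x u :: "real ^ 'n" assume x: "x \<in> orthant" and u: "u \<in> orthant" and n: "norm x \<le> R" "norm u \<le> L"
      have h: "0 \<le> h" using elim by simp
      define U where "U j = (u + m) + j *\<^sub>R axis k 1" for j :: real
      have um: "u + m \<in> orthant" using u m by (rule orthant_add)
      have Uo: "U j \<in> orthant" if "0 \<le> j" for j
        using um that by (auto simp: U_def orthant_iff axis_def)
      have Un: "norm (U j) \<le> L + norm m + 4" if "0 \<le> j" "j \<le> 4" for j
      proof -
        have "norm (U j) \<le> norm (u + m) + norm (j *\<^sub>R axis k 1 :: real ^ 'n)" unfolding U_def by (rule norm_triangle_ineq)
        moreover have "norm (u + m) \<le> norm u + norm m" by (rule norm_triangle_ineq)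
        moreover have "norm (j *\<^sub>R axis k 1 :: real ^ 'n) = j" using that by (simp add: norm_axis_1)
        ultimately show ?thesis using n that by linarith
      qed
      define E where "E j y = exp (- (U j \<bullet> (y - x)))" for j y
      define I where "I j = (\<integral>y. E j y \<partial>P h x)" for j
      have int: "integrable (P h x) (E j)" if "0 \<le> j" for j
      proof (rule kernel_integrable[OF x h])
        show "E j \<in> borel_measurable borel" unfolding E_def by measurable
        show "\<bar>E j y\<bar> \<le> exp (U j \<bullet> x)" if y: "y \<in> orthant" for y
          using exp_shift_bound[OF x Uo[OF \<open>0 \<le> j\<close>] y] by (simp add: E_def)
      qed
      have alt: "?f z * exp (- (u \<bullet> z)) =
         a * (exp (- (U 0 \<bullet> z)) - 4 * exp (- (U 1 \<bullet> z)) + 6 * exp (- (U 2 \<bullet> z)) - 4 * exp (- (U 3 \<bullet> z)) + exp (- (U 4 \<bullet> z)))" for z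
      proof -
        have "mu_integrand k (U 0) z - 4 * mu_integrand k (U 1) z + 6 * mu_integrand k (U 2) z - 4 * mu_integrand k (U 3) z + mu_integrand k (U 4) z
          = (1 - exp (- (z $ k))) ^ 4 * exp (- ((u + m) \<bullet> z))"
          unfolding U_def by (rule mu_integrand_alternating)
        moreover have "mu_integrand k (U 0) z - 4 * mu_integrand k (U 1) z + 6 * mu_integrand k (U 2) z - 4 * mu_integrand k (U 3) z + mu_integrand k (U 4) z
          = exp (- (U 0 \<bullet> z)) - 4 * exp (- (U 1 \<bullet> z)) + 6 * exp (- (U 2 \<bullet> z)) - 4 * exp (- (U 3 \<bullet> z)) + exp (- (U 4 \<bullet> z))"
          unfolding mu_integrand_def by (simp add: U_def algebra_simps)
        moreover have "exp (- ((u + m) \<bullet> z)) = exp (- (m \<bullet> z)) * exp (- (u \<bullet> z))"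
          by (simp add: inner_add_left exp_add[symmetric])
        ultimately show ?thesis by simp
      qed
      have "kernel_mean h x u ?f = (\<integral>y. a * (E 0 y - 4 * E 1 y + 6 * E 2 y - 4 * E 3 y + E 4 y) \<partial>P h x)"
        unfolding kernel_mean_def alt E_def ..
      also have "\<dots> = a * (I 0 - 4 * I 1 + 6 * I 2 - 4 * I 3 + I 4)"
        unfolding I_def using int by simp
      finally have lhs: "kernel_mean h x u ?f = a * (I 0 - 4 * I 1 + 6 * I 2 - 4 * I 3 + I 4)" .
      define S where "S j = symbol x (U j)" for j
      have "jump_mean x u ?f = jump_integral x (\<lambda>z. a * ((1 - exp (- (z $ k))) ^ 4 * exp (- ((u + m) \<bullet> z))))"
        unfolding jump_mean_def
        by (intro jump_integral_cong) (simp add: inner_add_left exp_add[symmetric] exp_diff exp_minus field_simps)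
      also have "\<dots> = a * (S 0 - 4 * S 1 + 6 * S 2 - 4 * S 3 + S 4)"
        unfolding jump_integral_cmult S_def U_def using symbol_alternating[OF um] by simp
      finally have rhs: "jump_mean x u ?f = a * (S 0 - 4 * S 1 + 6 * S 2 - 4 * S 3 + S 4)" .
      define D where "D j = I j - 1 - h * S j" for j
      have d: "\<bar>D j\<bar> \<le> e' * h" if "0 \<le> j" "j \<le> 4" for j
        using elim(1) x Uo[of j] Un[of j] n that unfolding D_def I_def E_def S_def by blast
      have "(I 0 - 4 * I 1 + 6 * I 2 - 4 * I 3 + I 4) - h * (S 0 - 4 * S 1 + 6 * S 2 - 4 * S 3 + S 4)
        = D 0 - 4 * D 1 + 6 * D 2 - 4 * D 3 + D 4"
        by (simp add: D_def algebra_simps)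
      moreover have "\<bar>D 0 - 4 * D 1 + 6 * D 2 - 4 * D 3 + D 4\<bar> \<le> 16 * (e' * h)"
        using d[of 0] d[of 1] d[of 2] d[of 3] d[of 4] by (simp add: abs_le_iff)
      ultimately have "\<bar>(I 0 - 4 * I 1 + 6 * I 2 - 4 * I 3 + I 4) - h * (S 0 - 4 * S 1 + 6 * S 2 - 4 * S 3 + S 4)\<bar> \<le> 16 * (e' * h)"
        by simp
      then have "\<bar>a\<bar> * \<bar>(I 0 - 4 * I 1 + 6 * I 2 - 4 * I 3 + I 4) - h * (S 0 - 4 * S 1 + 6 * S 2 - 4 * S 3 + S 4)\<bar> \<le> \<bar>a\<bar> * (16 * (e' * h))"
        by (rule mult_left_mono) simp
      also have "\<dots> = (16 * \<bar>a\<bar> * e') * h" by simp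
      also have "\<dots> \<le> e * h" using e'(2) h by (rule mult_right_mono)
      finally show "\<bar>kernel_mean h x u ?f - h * jump_mean x u ?f\<bar> \<le> e * h"
        unfolding lhs rhs by (simp add: abs_mult[symmetric] algebra_simps)
    qed
  qed
qed

lemma small_time_rate_add:
  assumes f: "test_function f" "small_time_rate f" and g: "test_function g" "small_time_rate g"
  shows "small_time_rate (\<lambda>z. f z + g z)" (is "small_time_rate ?s")
proof (rule small_time_rateI)
  fix R L e :: real assume "0 < e"
  then have e: "0 < e / 2" by simp
  have "eventually (\<lambda>h::real. 0 < h) (at_right 0)" by (rule eventually_at_right_less)
  with small_time_rateD[OF f(2) e, of R L] small_time_rateD[OF g(2) e, of R L]
  show "eventually (\<lambda>h. \<forall>x\<in>orthant. \<forall>u\<in>orthant. norm x \<le> R \<longrightarrow> norm u \<le> L \<longrightarrow>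
    \<bar>kernel_mean h x u ?s - h * jump_mean x u ?s\<bar> \<le> e * h) (at_right 0)"
  proof eventually_elim
    case (elim h)
    show ?case
    proof (intro ballI impI)
      fix x u :: "real ^ 'n" assume x: "x \<in> orthant" and u: "u \<in> orthant" and n: "norm x \<le> R" "norm u \<le> L"
      have h: "0 \<le> h" using elim by simp
      have 1: "\<bar>kernel_mean h x u f - h * jump_mean x u f\<bar> \<le> e / 2 * h" using elim(1) x u n by blast
      have 2: "\<bar>kernel_mean h x u g - h * jump_mean x u g\<bar> \<le> e / 2 * h" using elim(2) x u n by blast
      have "kernel_mean h x u ?s - h * jump_mean x u ?s
          = (kernel_mean h x u f - h * jump_mean x u f) + (kernel_mean h x u g - h * jump_mean x u g)"
        unfolding kernel_mean_add[OF f(1) g(1) x u h] jump_mean_add[OF f(1) g(1) u] by (simp add: distrib_left)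
      then have "\<bar>kernel_mean h x u ?s - h * jump_mean x u ?s\<bar> \<le> e / 2 * h + e / 2 * h"
        using order_trans[OF abs_triangle_ineq add_mono[OF 1 2]] by simp
      then show "\<bar>kernel_mean h x u ?s - h * jump_mean x u ?s\<bar> \<le> e * h" by simp
    qed
  qed
qed

lemma small_time_rate_zero: "small_time_rate (\<lambda>z. 0)"
proof (rule small_time_rateI)
  fix R L e :: real assume "0 < e"
  have "eventually (\<lambda>h::real. 0 < h) (at_right 0)" by (rule eventually_at_right_less)
  then show "eventually (\<lambda>h. \<forall>x\<in>orthant. \<forall>u\<in>orthant. norm x \<le> R \<longrightarrow> norm u \<le> L \<longrightarrow>
    \<bar>kernel_mean h x u (\<lambda>z. 0) - h * jump_mean x u (\<lambda>z. 0)\<bar> \<le> e * h) (at_right 0)"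
    by eventually_elim (use \<open>0 < e\<close> in \<open>simp add: kernel_mean_def jump_mean_def jump_integral_def\<close>)
qed

lemma small_time_rate_sum:
  assumes "finite I" "\<And>i. i \<in> I \<Longrightarrow> test_function (f i) \<and> small_time_rate (f i)"
  shows "test_function (\<lambda>z. \<Sum>i\<in>I. f i z) \<and> small_time_rate (\<lambda>z. \<Sum>i\<in>I. f i z)"
  using assms
proof (induction I rule: finite_induct)
  case empty
  show ?case using test_function_zero small_time_rate_zero by simp
next
  case (insert i I)
  have i: "test_function (f i)" "small_time_rate (f i)"
    and I: "test_function (\<lambda>z. \<Sum>i\<in>I. f i z)" "small_time_rate (\<lambda>z. \<Sum>i\<in>I. f i z)"
    using insert by auto
  show ?case
    unfolding sum.insert[OF insert(1,2)] using test_function_add[OF i(1) I(1)] small_time_rate_add[OF i I] by (rule conjI)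
qed

lemma small_time_rate_flat_exponential_sum:
  assumes "exponential_sum p"
  shows "test_function (\<lambda>z. flat_weight z * p z) \<and> small_time_rate (\<lambda>z. flat_weight z * p z)"
  using assms
proof induction
  case (exponential_sum_term m a)
  have "test_function (\<lambda>z. \<Sum>k\<in>UNIV. (1 - exp (- (z $ k))) ^ 4 * (a * exp (- (m \<bullet> z)))) \<and>
      small_time_rate (\<lambda>z. \<Sum>k\<in>UNIV. (1 - exp (- (z $ k))) ^ 4 * (a * exp (- (m \<bullet> z))))"
    using exponential_sum_term
    by (intro small_time_rate_sum conjI small_time_rate_flat_component
        test_function_mult[OF test_function_flat_weight_component] exponential_sum.intros) auto
  then show ?case unfolding flat_weight_def sum_distrib_right .
next
  case (exponential_sum_add p q)
  then show ?case unfolding distrib_left using test_function_add small_time_rate_add by blast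
qed

text \<open>A relative approximation is enough because the weight itself has a rate: the mean of
  \<open>flat_weight\<close> over an increment is of order \<open>h\<close>, hence so is the error of approximation.\<close>

lemma small_time_rate_approx:
  assumes g: "test_function g"
    and approx: "\<And>R e. 0 < e \<Longrightarrow> \<exists>p. exponential_sum p \<and>
      (\<forall>z. (\<forall>i. - R \<le> z $ i) \<longrightarrow> \<bar>g z - flat_weight z * p z\<bar> \<le> e * flat_weight z)"
  shows "small_time_rate g"
proof (rule small_time_rateI)
  fix R L e :: real assume e: "0 < e"
  have flat_rate: "small_time_rate flat_weight"
    using small_time_rate_flat_exponential_sum[OF exponential_sum_const[of 1]] by simp
  \<comment> \<open>a bound for the mean of the weight over the jump kernel, for starting points of norm at most \<open>R\<close>\<close>
  define K0 where "K0 = \<bar>jump_integral (\<chi> l. \<bar>R\<bar>) flat_weight\<bar>"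
  define e' where "e' = e / (4 * (K0 + 1))"
  have K0: "0 \<le> K0" by (simp add: K0_def)
  have e': "0 < e'" "e' * (2 * K0 + 1) \<le> e / 2"
  proof -
    define b where "b = K0 + 1"
    have b: "0 < b" "2 * K0 + 1 \<le> 2 * b" using K0 by (auto simp: b_def)
    show "0 < e'" using e K0 by (simp add: e'_def)
    have "e' * (2 * K0 + 1) \<le> e' * (2 * b)" using b \<open>0 < e'\<close> by (intro mult_left_mono) auto
    also have "\<dots> = e / 2" using b by (simp add: e'_def b_def[symmetric])
    finally show "e' * (2 * K0 + 1) \<le> e / 2" .
  qed
  obtain p where p: "exponential_sum p"
    "\<And>z. (\<And>i. - \<bar>R\<bar> \<le> z $ i) \<Longrightarrow> \<bar>g z - flat_weight z * p z\<bar> \<le> e' * flat_weight z"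
    using approx[OF e'(1), of "\<bar>R\<bar>"] by blast
  define f where "f z = flat_weight z * p z" for z
  have f: "test_function f" "small_time_rate f"
    using small_time_rate_flat_exponential_sum[OF p(1)] by (simp_all add: f_def[abs_def])
  have e2: "0 < e / 2" using e by simp
  have "eventually (\<lambda>h::real. 0 < h) (at_right 0)" by (rule eventually_at_right_less)
  with small_time_rateD[OF f(2) e2, of R L] small_time_rateD[OF flat_rate zero_less_one, of R L]
  show "eventually (\<lambda>h. \<forall>x\<in>orthant. \<forall>u\<in>orthant. norm x \<le> R \<longrightarrow> norm u \<le> L \<longrightarrow>
    \<bar>kernel_mean h x u g - h * jump_mean x u g\<bar> \<le> e * h) (at_right 0)"
  proof eventually_elim
    case (elim h)
    show ?case
    proof (intro ballI impI)
      fix x u :: "real ^ 'n" assume x: "x \<in> orthant" and u: "u \<in> orthant" and n: "norm x \<le> R" "norm u \<le> L"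
      have h: "0 \<le> h" using elim by simp
      let ?E = "\<lambda>z. exp (- (u \<bullet> z))"
      define IP where "IP = kernel_mean h x u"
      define IJ where "IJ = jump_mean x u"
      note IP = IP_def kernel_mean_def and IJ = IJ_def jump_mean_def
      have 1: "\<bar>IP f - h * IJ f\<bar> \<le> e / 2 * h" using elim(1) x u n unfolding IP_def IJ_def by blast
      have 2: "\<bar>IP flat_weight - h * IJ flat_weight\<bar> \<le> 1 * h" using elim(2) x u n unfolding IP_def IJ_def by blast
      have R: "norm x \<le> \<bar>R\<bar>" using n by linarith
      have ti: "integrable (P h x) (\<lambda>y. \<xi> (y - x) * ?E (y - x))" "jump_integrable (\<lambda>z. \<xi> z * ?E z)" if "test_function \<xi>" for \<xi>
        using test_function_kernel_integrable[OF test_function_exp[OF that u] x h]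
          test_function_jump_integrable[OF test_function_exp[OF that u]] by auto
      have J0: "IJ flat_weight \<le> K0" "0 \<le> IJ flat_weight"
      proof -
        have "IJ flat_weight \<le> jump_integral x flat_weight"
          unfolding IJ
        proof (rule jump_integral_mono[OF x ti(2)[OF test_function_flat_weight] test_function_jump_integrable[OF test_function_flat_weight]])
          fix z :: "real ^ 'n" assume "z \<in> orthant"
          then have "?E z \<le> 1" using inner_orthant_nonneg[OF u] by simp
          then have "flat_weight z * ?E z \<le> flat_weight z * 1" by (rule mult_left_mono[OF _ flat_weight_nonneg])
          then show "flat_weight z * ?E z \<le> flat_weight z" by simp
        qed
        also have "\<dots> \<le> jump_integral (\<chi> l. \<bar>R\<bar>) flat_weight"
          by (rule jump_integral_bounded_start[OF x R test_function_jump_integrable[OF test_function_flat_weight] flat_weight_nonneg])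
        finally show "IJ flat_weight \<le> K0" unfolding K0_def by linarith
        show "0 \<le> IJ flat_weight" unfolding IJ
          by (rule jump_integral_bounded_start[OF x R ti(2)[OF test_function_flat_weight]]) (simp add: flat_weight_nonneg)
      qed
      have pw: "\<bar>g z * ?E z - f z * ?E z\<bar> \<le> e' * (flat_weight z * ?E z)" if "\<And>i. - \<bar>R\<bar> \<le> z $ i" for z
      proof -
        have "\<bar>g z - f z\<bar> \<le> e' * flat_weight z" unfolding f_def using p(2) that by blast
        then have "\<bar>g z - f z\<bar> * ?E z \<le> e' * flat_weight z * ?E z" by (rule mult_right_mono) simp
        then show ?thesis by (simp add: left_diff_distrib[symmetric] abs_mult)
      qed
      have "\<bar>IP g - IP f\<bar> \<le> e' * IP flat_weight"
      proof -
        have "\<bar>IP g - IP f\<bar> = \<bar>\<integral>y. g (y - x) * ?E (y - x) - f (y - x) * ?E (y - x) \<partial>P h x\<bar>"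
          unfolding IP using ti(1)[OF g] ti(1)[OF f(1)] by simp
        also have "\<dots> \<le> (\<integral>y. \<bar>g (y - x) * ?E (y - x) - f (y - x) * ?E (y - x)\<bar> \<partial>P h x)"
          by (rule integral_abs_bound)
        also have "\<dots> \<le> (\<integral>y. e' * (flat_weight (y - x) * ?E (y - x)) \<partial>P h x)"
        proof (rule integral_mono_AE)
          show "AE y in P h x. \<bar>g (y - x) * ?E (y - x) - f (y - x) * ?E (y - x)\<bar> \<le> e' * (flat_weight (y - x) * ?E (y - x))"
          proof (rule kernel_AEI[OF x h], rule pw)
            fix y :: "real ^ 'n" and i assume y: "y \<in> orthant"
            have "x $ i \<le> \<bar>R\<bar>" using component_le_norm_cart[of x i] R by linarith
            moreover have "0 \<le> y $ i" using y by (simp add: orthant_iff)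
            ultimately show "- \<bar>R\<bar> \<le> (y - x) $ i" by simp
          qed
        qed (use ti(1)[OF g] ti(1)[OF f(1)] ti(1)[OF test_function_flat_weight] in auto)
        finally show ?thesis by (simp add: IP)
      qed
      also have "\<dots> \<le> e' * ((K0 + 1) * h)"
      proof -
        have "h * IJ flat_weight \<le> h * K0" using J0(1) h by (rule mult_left_mono)
        then have "IP flat_weight \<le> (K0 + 1) * h" using 2 by (simp add: algebra_simps abs_le_iff)
        then show ?thesis using e'(1) by (intro mult_left_mono) auto
      qed
      finally have 3: "\<bar>IP g - IP f\<bar> \<le> e' * ((K0 + 1) * h)" .
      have "\<bar>IJ g - IJ f\<bar> \<le> e' * IJ flat_weight"
      proof -
        have pwo: "\<bar>g z * ?E z - f z * ?E z\<bar> \<le> e' * (flat_weight z * ?E z)" if "z \<in> orthant" for z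
          using that by (intro pw) (auto simp: orthant_iff intro: order_trans[of _ 0])
        have d: "jump_integral x (\<lambda>z. g z * ?E z - f z * ?E z) = IJ g - IJ f"
          unfolding IJ by (rule jump_integral_diff[OF ti(2)[OF g] ti(2)[OF f(1)]])
        have ji: "jump_integrable (\<lambda>z. g z * ?E z - f z * ?E z)" "jump_integrable (\<lambda>z. e' * (flat_weight z * ?E z))" "jump_integrable (\<lambda>z. (- e') * (flat_weight z * ?E z))"
          using ti(2)[OF g] ti(2)[OF f(1)] ti(2)[OF test_function_flat_weight] by (simp_all add: jump_integrable_def)
        have "jump_integral x (\<lambda>z. g z * ?E z - f z * ?E z) \<le> jump_integral x (\<lambda>z. e' * (flat_weight z * ?E z))"
          using pwo by (intro jump_integral_mono[OF x ji(1,2)]) (simp add: abs_le_iff)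
        moreover have "jump_integral x (\<lambda>z. (- e') * (flat_weight z * ?E z)) \<le> jump_integral x (\<lambda>z. g z * ?E z - f z * ?E z)"
          using pwo by (intro jump_integral_mono[OF x ji(3,1)]) (fastforce simp: abs_le_iff)
        ultimately show ?thesis unfolding d jump_integral_cmult IJ by (simp add: abs_le_iff)
      qed
      also have "\<dots> \<le> e' * K0" using J0 e' by (intro mult_left_mono) auto
      finally have "h * \<bar>IJ g - IJ f\<bar> \<le> h * (e' * K0)" using h by (rule mult_left_mono)
      then have 4: "\<bar>h * IJ g - h * IJ f\<bar> \<le> h * (e' * K0)" using h by (simp add: right_diff_distrib[symmetric] abs_mult)
      have "\<bar>IP g - h * IJ g\<bar> \<le> e' * ((K0 + 1) * h) + e / 2 * h + h * (e' * K0)"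
        using 1 3 4 by linarith
      also have "\<dots> = (e' * (2 * K0 + 1)) * h + e / 2 * h" by (simp add: algebra_simps)
      also have "\<dots> \<le> e / 2 * h + e / 2 * h" using e'(2) h by (intro add_right_mono mult_right_mono)
      finally show "\<bar>kernel_mean h x u g - h * jump_mean x u g\<bar> \<le> e * h"
        unfolding IP_def IJ_def by simp
    qed
  qed
qed

lemma test_function_cutoff:
  assumes r: "0 \<le> r" and \<delta>: "0 < \<delta>"
  shows "test_function (cutoff r \<delta>)"
  unfolding test_function_def
proof (intro conjI allI)
  show "continuous_on UNIV (cutoff r \<delta> :: real ^ 'n \<Rightarrow> real)" by (rule cutoff_continuous)
  show "\<exists>C. \<forall>z :: real ^ 'n. (\<forall>i. - R \<le> z $ i) \<longrightarrow> \<bar>cutoff r \<delta> z\<bar> \<le> C" for R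
    by (rule exI[of _ 1]) (simp add: abs_of_nonneg cutoff_range)
  define k where "k = max 1 (1 / \<delta>\<^sup>2)"
  have k: "1 \<le> k" "1 / \<delta>\<^sup>2 \<le> k" by (auto simp: k_def)
  have "\<bar>cutoff r \<delta> z\<bar> \<le> k * min 1 ((norm z)\<^sup>2)" for z :: "real ^ 'n"
  proof (cases "norm z \<le> r + \<delta>")
    case True
    then show ?thesis using k by (simp add: cutoff_eq_0[OF \<delta>])
  next
    case False
    then have "\<delta>\<^sup>2 \<le> (norm z)\<^sup>2" using r \<delta> by (intro power_mono) auto
    then have "1 \<le> 1 / \<delta>\<^sup>2 * (norm z)\<^sup>2" using \<delta> by (simp add: field_simps)
    also have "\<dots> \<le> k * (norm z)\<^sup>2" using k(2) by (intro mult_right_mono) auto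
    finally have "1 \<le> k * min 1 ((norm z)\<^sup>2)" using k(1) by (simp add: min_def)
    then show ?thesis using cutoff_range[of r \<delta> z] by linarith
  qed
  then show "\<exists>C. \<forall>z :: real ^ 'n\<in>orthant. \<bar>cutoff r \<delta> z\<bar> \<le> C * min 1 ((norm z)\<^sup>2)" by blast
qed

text \<open>The jump kernel is the small-time limit of the increments, away from \<open>0\<close>.\<close>

lemma small_time_rate_cutoff:
  assumes "0 \<le> r" "0 < \<delta>"
  shows "small_time_rate (cutoff r \<delta>)"
proof (rule small_time_rate_approx[OF test_function_cutoff[OF assms]])
  fix R e :: real assume e: "0 < e"
  obtain p :: "real ^ 'n \<Rightarrow> real" where "exponential_sum p"
    "\<And>z. (\<And>i. - R \<le> z $ i) \<Longrightarrow> \<bar>cutoff r \<delta> z - flat_weight z * p z\<bar> \<le> e * flat_weight z"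
    using cutoff_approx_exponential_sum[OF assms e, where R = R] by blast
  then show "\<exists>p. exponential_sum p \<and> (\<forall>z :: real ^ 'n. (\<forall>i. - R \<le> z $ i) \<longrightarrow>
      \<bar>cutoff r \<delta> z - flat_weight z * p z\<bar> \<le> e * flat_weight z)" by blast
qed

end

section \<open>One step of the process killed at a large jump\<close>

context cbi_kernel
begin

text \<open>The right-hand side of the equation for the truncated parameters.\<close>

definition killed_field :: "(real ^ 'n) set \<Rightarrow> 'n \<Rightarrow> real ^ 'n \<Rightarrow> real" where
  "killed_field A l y = measure (\<mu> l) A - \<phi>_trunc c B \<mu> A l y"

definition killed_rate :: "(real ^ 'n) set \<Rightarrow> real ^ 'n \<Rightarrow> real" where
  "killed_rate A y = measure \<nu> A + \<psi>_trunc \<beta> \<nu> A y"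

definition finite_jump_set :: "(real ^ 'n) set \<Rightarrow> bool" where
  "finite_jump_set A \<longleftrightarrow> (\<forall>N. levy_measure N \<longrightarrow> A \<in> sets N \<and> emeasure N A < \<infinity>)"

lemma finite_jump_setD:
  assumes "finite_jump_set A" "levy_measure N"
  shows "A \<in> sets N" "emeasure N A < \<infinity>"
  using assms unfolding finite_jump_set_def by auto

lemma set_integral_exp:
  assumes A: "finite_jump_set A" and N: "levy_measure N" and y: "y \<in> orthant"
  shows "(LINT z:A|N. 1 - exp (- (y \<bullet> z))) = measure N A - (LINT z|N. indicator A z * exp (- (y \<bullet> z)))"
proof -
  note AN = finite_jump_setD[OF A N]
  have "(LINT z:A|N. 1 - exp (- (y \<bullet> z))) = (LINT z|N. indicator A z - indicator A z * exp (- (y \<bullet> z)))"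
    unfolding set_lebesgue_integral_def by (simp add: right_diff_distrib)
  also have "\<dots> = (LINT z|N. indicator A z) - (LINT z|N. indicator A z * exp (- (y \<bullet> z)))"
    using AN by (intro Bochner_Integration.integral_diff integrable_exp_on[OF N AN y]) simp
  finally show ?thesis using AN by (simp add: sets.Int_space_eq2)
qed

lemma killed_field_eq:
  assumes A: "finite_jump_set A" and y: "y \<in> orthant"
  shows "killed_field A l y = - \<phi> c B \<mu> l y + (LINT z|\<mu> l. indicator A z * exp (- (y \<bullet> z)))"
  unfolding killed_field_def \<phi>_trunc_def set_integral_exp[OF A levy_measure_nu_mu(2) y] by simp

lemma killed_rate_eq:
  assumes A: "finite_jump_set A" and y: "y \<in> orthant"
  shows "killed_rate A y = \<psi> \<beta> \<nu> y + (LINT z|\<nu>. indicator A z * exp (- (y \<bullet> z)))"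
proof -
  let ?f = "\<lambda>z. 1 - exp (- (y \<bullet> z))"
  note AN = finite_jump_setD[OF A levy_measure_nu_mu(1)]
  have int: "integrable \<nu> (\<lambda>z. indicator A z * ?f z)"
    using integrable_mult_indicator[OF AN(1) integrable_nu_integrand[OF y]] by simp
  have "(LINT z:punctured_orthant - A|\<nu>. ?f z) = (LINT z|\<nu>. ?f z - indicator A z * ?f z)"
    unfolding set_lebesgue_integral_def
    by (intro Bochner_Integration.integral_cong refl) (auto simp: levy_space[OF levy_measure_nu_mu(1)] indicator_def)
  also have "\<dots> = (LINT z|\<nu>. ?f z) - (LINT z:A|\<nu>. ?f z)"
    unfolding set_lebesgue_integral_def real_scaleR_def
    by (rule Bochner_Integration.integral_diff[OF integrable_nu_integrand[OF y] int])
  finally show ?thesis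
    unfolding killed_rate_def \<psi>_trunc_def \<psi>_def set_integral_exp[OF A levy_measure_nu_mu(1) y] by simp
qed

lemma continuous_killed_field:
  assumes A: "finite_jump_set A"
  shows "continuous_on orthant (killed_field A l)"
proof -
  have "continuous_on orthant (\<lambda>y. - \<phi> c B \<mu> l y + (LINT z|\<mu> l. indicator A z * exp (- (y \<bullet> z))))"
    by (intro continuous_on_add continuous_on_minus continuous_phi
        continuous_exp_on[OF levy_measure_nu_mu(2) finite_jump_setD[OF A levy_measure_nu_mu(2)]])
  then show ?thesis
    by (rule continuous_on_cong[THEN iffD1, rotated 2]) (simp_all add: killed_field_eq[OF A])
qed

lemma continuous_killed_rate:
  assumes A: "finite_jump_set A"
  shows "continuous_on orthant (killed_rate A)"
proof -
  have "continuous_on orthant (\<lambda>y. \<psi> \<beta> \<nu> y + (LINT z|\<nu>. indicator A z * exp (- (y \<bullet> z))))"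
    by (intro continuous_on_add continuous_psi
        continuous_exp_on[OF levy_measure_nu_mu(1) finite_jump_setD[OF A levy_measure_nu_mu(1)]])
  then show ?thesis
    by (rule continuous_on_cong[THEN iffD1, rotated 2]) (simp_all add: killed_rate_eq[OF A])
qed

text \<open>The symbol of the process killed at its jumps in \<open>A\<close> differs from the symbol of the process by the
  contribution of these jumps.\<close>

lemma killed_symbol:
  assumes A: "finite_jump_set A" and y: "y \<in> orthant"
  shows "(\<Sum>l\<in>UNIV. x $ l * killed_field A l y) + killed_rate A y
    = - symbol x y + jump_integral x (\<lambda>z. indicator A z * exp (- (y \<bullet> z)))"
proof -
  have "(\<Sum>l\<in>UNIV. x $ l * killed_field A l y) =
      - (\<Sum>l\<in>UNIV. x $ l * \<phi> c B \<mu> l y) + (\<Sum>l\<in>UNIV. x $ l * (LINT z|\<mu> l. indicator A z * exp (- (y \<bullet> z))))"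
    unfolding killed_field_eq[OF A y] sum_negf[symmetric] sum.distrib[symmetric]
    by (intro sum.cong refl) (simp add: algebra_simps)
  then show ?thesis unfolding killed_rate_eq[OF A y] symbol_def jump_integral_def by simp
qed

text \<open>The candidate for the probability of having no jump in \<open>A\<close> up to time \<open>s\<close> when started from \<open>x\<close>.\<close>

definition survival :: "(real ^ 'n) set \<Rightarrow> (real \<Rightarrow> real ^ 'n) \<Rightarrow> real \<Rightarrow> real ^ 'n \<Rightarrow> real" where
  "survival A w s x = exp (- (x \<bullet> w s) - integral {0..s} (\<lambda>u. killed_rate A (w u)))"

lemma killed_solution:
  assumes "is_v_tilde c B \<mu> A w"
  shows "orthant_solution (killed_field A) 0 w"
  using assms unfolding is_v_tilde_def killed_field_def[abs_def] .

lemma killed_rate_nonneg: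
  assumes A: "finite_jump_set A" and y: "y \<in> orthant"
  shows "0 \<le> killed_rate A y"
proof -
  have "0 \<le> \<beta> \<bullet> y" using admissible y by (intro inner_orthant_nonneg) (auto simp: admissible_def)
  moreover have "0 \<le> (LINT z|\<nu>. 1 - exp (- (y \<bullet> z)))"
    using inner_orthant_nonneg[OF y] by (intro integral_nonneg_AE AE_levyI[OF levy_measure_nu_mu(1)]) simp
  moreover have "0 \<le> (LINT z|\<nu>. indicator A z * exp (- (y \<bullet> z)))"
    by (intro integral_nonneg_AE AE_levyI[OF levy_measure_nu_mu(1)]) simp
  ultimately show ?thesis unfolding killed_rate_eq[OF A y] \<psi>_def by simp
qed

lemma killed_rate_path_continuous:
  assumes A: "finite_jump_set A" and w: "orthant_solution (killed_field A) a w"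
  shows "continuous_on {0..} (\<lambda>u. killed_rate A (w u))"
  using w by (intro continuous_on_compose2[OF continuous_killed_rate[OF A] orthant_solution_continuous[OF w]])
    (auto simp: orthant_solution_def)

lemma survival_range:
  assumes A: "finite_jump_set A" and w: "orthant_solution (killed_field A) 0 w" and s: "0 \<le> s" and x: "x \<in> orthant"
  shows "0 \<le> survival A w s x" "survival A w s x \<le> 1"
proof -
  have wo: "w u \<in> orthant" if "0 \<le> u" for u using w that unfolding orthant_solution_def by blast
  have "0 \<le> x \<bullet> w s" using x wo[OF s] by (rule inner_orthant_nonneg)
  moreover have "0 \<le> integral {0..s} (\<lambda>u. killed_rate A (w u))"
    using wo by (intro Henstock_Kurzweil_Integration.integral_nonneg integrable_continuous_real
        continuous_on_subset[OF killed_rate_path_continuous[OF A w]] killed_rate_nonneg[OF A]) auto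
  ultimately show "survival A w s x \<le> 1" by (simp add: survival_def)
qed (simp add: survival_def)

lemma survival_step:
  assumes A: "finite_jump_set A" and w: "orthant_solution (killed_field A) 0 w" and s: "0 \<le> s" and h: "0 \<le> h"
  shows "survival A w (s + h) x = survival A w s x *
     exp (x \<bullet> w s - x \<bullet> w (s + h) - integral {0..h} (\<lambda>u. killed_rate A (w (s + u))))"
proof -
  have cont: "continuous_on {0..s + h} (\<lambda>u. killed_rate A (w u))"
    by (rule continuous_on_subset[OF killed_rate_path_continuous[OF A w]]) auto
  have "integral {0..s} (\<lambda>u. killed_rate A (w u)) + integral {s..s + h} (\<lambda>u. killed_rate A (w u))
      = integral {0..s + h} (\<lambda>u. killed_rate A (w u))"
    using s h by (intro Henstock_Kurzweil_Integration.integral_combine integrable_continuous_real[OF cont]) auto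
  moreover have "integral {s..s + h} (\<lambda>u. killed_rate A (w u)) = integral {0..h} (\<lambda>u. killed_rate A (w (s + u)))"
    using integral_shift_Icc_real[of 0 h "\<lambda>u. killed_rate A (w u)" s] by (simp add: o_def add.commute)
  ultimately show ?thesis by (simp add: survival_def exp_add[symmetric])
qed

lemma cutoff_outside_Kc:
  assumes "0 \<le> r" "0 < \<delta>" "z \<in> orthant" "z \<notin> Kc r"
  shows "cutoff r \<delta> z = 0"
  using assms by (intro cutoff_eq_0) (auto simp: Kc_eq not_less)

lemma cutoff_le_Kc:
  assumes "0 \<le> r" "0 < \<delta>" "z \<in> orthant"
  shows "cutoff r \<delta> z \<le> indicator (Kc r) z"
  using cutoff_outside_Kc[OF assms] cutoff_range[of r \<delta> z] by (cases "z \<in> Kc r") simp_all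

lemma jump_integrable_indicator:
  assumes A: "finite_jump_set A"
  shows "jump_integrable (indicator A)"
  unfolding jump_integrable_def using finite_jump_setD[OF A] by auto

text \<open>Three first-order expansions are compared: those of the Laplace transform, of the rate of the cutoff, and of
  \<open>survival\<close> in time. By \<open>killed_symbol\<close> their first-order terms cancel, except that the cutoff is not yet
  the indicator of the large jumps.\<close>

lemma killed_one_step:
  assumes r: "0 \<le> r" and \<delta>: "0 < \<delta>" and A: "finite_jump_set (Kc r)"
    and w: "orthant_solution (killed_field (Kc r)) 0 w" and e: "0 < e"
  shows "eventually (\<lambda>h. \<forall>x\<in>orthant. norm x \<le> R \<longrightarrow> (\<forall>s\<in>{0..t}.
     \<bar>(\<integral>y. (1 - cutoff r \<delta> (y - x)) * survival (Kc r) w s y \<partial>P h x) - survival (Kc r) w (s + h) x\<bar>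
       \<le> (e + jump_integral x (\<lambda>z. indicator (Kc r) z - cutoff r \<delta> z)) * h)) (at_right 0)"
proof -
  let ?A = "Kc r :: (real ^ 'n) set"
  have wo: "w u \<in> orthant" if "0 \<le> u" for u using w that unfolding orthant_solution_def by blast
  have "bounded (w ` {0..t})"
  proof (cases "0 \<le> t")
    case True then show ?thesis using w unfolding orthant_solution_def by blast
  qed simp
  then obtain L where "\<forall>y\<in>w ` {0..t}. norm y \<le> L" unfolding bounded_iff ..
  then have L: "\<And>s. s \<in> {0..t} \<Longrightarrow> norm (w s) \<le> L" by blast
  have e3: "0 < e / 3" using e by simp
  have "eventually (\<lambda>h. \<forall>a v x. norm a \<le> L \<longrightarrow> norm x \<le> R \<longrightarrow> orthant_solution (killed_field ?A) a v \<longrightarrow>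
     \<bar>exp (x \<bullet> a - x \<bullet> v h - integral {0..h} (\<lambda>s. killed_rate ?A (v s))) - 1
       + h * ((\<Sum>l\<in>UNIV. x $ l * killed_field ?A l a) + killed_rate ?A a)\<bar> \<le> e / 3 * h) (at_right 0)"
    by (rule affine_exponential_small_time[OF continuous_killed_field[OF A] continuous_killed_rate[OF A] e3])
  moreover note laplace_small_time[OF e3, of R L] small_time_rateD[OF small_time_rate_cutoff[OF r \<delta>] e3, of R L]
  moreover have "eventually (\<lambda>h::real. 0 < h) (at_right 0)" by (rule eventually_at_right_less)
  ultimately show ?thesis
  proof eventually_elim
    case (elim h)
    then have h: "0 \<le> h" by simp
    show ?case
    proof (intro ballI impI)
      fix x :: "real ^ 'n" and s assume x: "x \<in> orthant" and n: "norm x \<le> R" and s: "s \<in> {0..t}"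
      define u where "u = w s"
      have uo: "u \<in> orthant" and un: "norm u \<le> L" using wo L s unfolding u_def by auto
      define E where "E = exp (x \<bullet> w s - x \<bullet> w (s + h) - integral {0..h} (\<lambda>v. killed_rate ?A (w (s + v))))"
      define I1 where "I1 = (\<integral>y. exp (- (u \<bullet> (y - x))) \<partial>P h x)"
      define I2 where "I2 = (\<integral>y. cutoff r \<delta> (y - x) * exp (- (u \<bullet> (y - x))) \<partial>P h x)"
      define S where "S = symbol x u"
      define KA where "KA = jump_integral x (\<lambda>z. indicator ?A z * exp (- (u \<bullet> z)))"
      define Kg where "Kg = jump_integral x (\<lambda>z. cutoff r \<delta> z * exp (- (u \<bullet> z)))"
      define D where "D = jump_integral x (\<lambda>z. indicator ?A z - cutoff r \<delta> z)"
      define U where "U = survival ?A w s x"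
      have sol: "orthant_solution (killed_field ?A) u (\<lambda>v. w (s + v))"
        unfolding u_def using s by (intro orthant_solution_shift[OF w]) simp
      have b1: "\<bar>E - 1 + h * (- S + KA)\<bar> \<le> e / 3 * h"
      proof -
        have "\<bar>exp (x \<bullet> u - x \<bullet> w (s + h) - integral {0..h} (\<lambda>v. killed_rate ?A (w (s + v)))) - 1
          + h * ((\<Sum>l\<in>UNIV. x $ l * killed_field ?A l u) + killed_rate ?A u)\<bar> \<le> e / 3 * h"
          using elim(1)[rule_format, OF un n sol] .
        then show ?thesis unfolding killed_symbol[OF A uo] unfolding E_def S_def KA_def u_def .
      qed
      have b2: "\<bar>I1 - 1 - h * S\<bar> \<le> e / 3 * h"
        using elim(2)[rule_format, OF x uo n un] unfolding I1_def S_def .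
      have b3: "\<bar>I2 - h * Kg\<bar> \<le> e / 3 * h"
        using elim(3)[rule_format, OF x uo n un] unfolding I2_def Kg_def kernel_mean_def jump_mean_def .
      have int1: "integrable (P h x) (\<lambda>y. exp (- (u \<bullet> (y - x))))"
      proof (rule kernel_integrable[OF x h])
        show "\<bar>exp (- (u \<bullet> (y - x)))\<bar> \<le> exp (u \<bullet> x)" if "y \<in> orthant" for y
          using exp_shift_bound[OF x uo that] by simp
      qed measurable
      have int2: "integrable (P h x) (\<lambda>y. cutoff r \<delta> (y - x) * exp (- (u \<bullet> (y - x))))"
        by (rule test_function_kernel_integrable[OF test_function_exp[OF test_function_cutoff[OF r \<delta>] uo] x h])
      have Uy: "survival ?A w s y = U * exp (- (u \<bullet> (y - x)))" for y
        by (simp add: U_def survival_def u_def exp_add[symmetric] inner_diff_right inner_commute)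
      have "(\<integral>y. (1 - cutoff r \<delta> (y - x)) * survival ?A w s y \<partial>P h x) =
          (\<integral>y. U * (exp (- (u \<bullet> (y - x))) - cutoff r \<delta> (y - x) * exp (- (u \<bullet> (y - x)))) \<partial>P h x)"
        unfolding Uy by (intro Bochner_Integration.integral_cong refl) (simp add: algebra_simps)
      also have "\<dots> = U * (I1 - I2)"
        unfolding I1_def I2_def Bochner_Integration.integral_mult_right_zero
        by (simp only: Bochner_Integration.integral_diff[OF int1 int2])
      finally have lhs: "(\<integral>y. (1 - cutoff r \<delta> (y - x)) * survival ?A w s y \<partial>P h x) = U * (I1 - I2)" .
      have rhs: "survival ?A w (s + h) x = U * E"
        unfolding U_def E_def using s h by (intro survival_step[OF A w]) auto
      have jA: "jump_integrable (\<lambda>z. indicator ?A z * exp (- (u \<bullet> z)))"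
        unfolding jump_integrable_def using integrable_exp_on finite_jump_setD[OF A] uo by blast
      have jg: "jump_integrable (\<lambda>z. cutoff r \<delta> z * exp (- (u \<bullet> z)))" "jump_integrable (cutoff r \<delta>)"
        using test_function_jump_integrable test_function_exp[OF test_function_cutoff[OF r \<delta>] uo] test_function_cutoff[OF r \<delta>] by blast+
      have KD: "0 \<le> KA - Kg" "KA - Kg \<le> D"
      proof -
        have eq: "KA - Kg = jump_integral x (\<lambda>z. indicator ?A z * exp (- (u \<bullet> z)) - cutoff r \<delta> z * exp (- (u \<bullet> z)))"
          unfolding KA_def Kg_def by (rule jump_integral_diff[OF jA jg(1), symmetric])
        have ji: "jump_integrable (\<lambda>z. indicator ?A z * exp (- (u \<bullet> z)) - cutoff r \<delta> z * exp (- (u \<bullet> z)))"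
            "jump_integrable (\<lambda>z. indicator ?A z - cutoff r \<delta> z)"
          using jA jg jump_integrable_indicator[OF A] by (simp_all add: jump_integrable_def)
        have pw: "0 \<le> indicator ?A z * exp (- (u \<bullet> z)) - cutoff r \<delta> z * exp (- (u \<bullet> z))"
           "indicator ?A z * exp (- (u \<bullet> z)) - cutoff r \<delta> z * exp (- (u \<bullet> z)) \<le> indicator ?A z - cutoff r \<delta> z"
          if z: "z \<in> orthant" for z
        proof -
          have a: "0 \<le> indicator ?A z - cutoff r \<delta> z" using cutoff_le_Kc[OF r \<delta> z] by simp
          have b: "exp (- (u \<bullet> z)) \<le> 1" using inner_orthant_nonneg[OF uo z] by simp
          show "0 \<le> indicator ?A z * exp (- (u \<bullet> z)) - cutoff r \<delta> z * exp (- (u \<bullet> z))"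
            unfolding left_diff_distrib[symmetric] by (rule mult_nonneg_nonneg[OF a]) simp
          show "indicator ?A z * exp (- (u \<bullet> z)) - cutoff r \<delta> z * exp (- (u \<bullet> z)) \<le> indicator ?A z - cutoff r \<delta> z"
            unfolding left_diff_distrib[symmetric] using mult_left_mono[OF b a] by simp
        qed
        show "0 \<le> KA - Kg" unfolding eq by (rule jump_integral_bounded_start(2)[OF x n ji(1) pw(1)])
        show "KA - Kg \<le> D" unfolding eq D_def by (rule jump_integral_mono[OF x ji pw(2)])
      qed
      \<comment> \<open>the first-order terms \<open>h * S\<close> and \<open>h * KA\<close> cancel\<close>
      have "I1 - I2 - E = (I1 - 1 - h * S) - (I2 - h * Kg) - (E - 1 + h * (- S + KA)) + h * (KA - Kg)"
        by (simp add: algebra_simps)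
      moreover have "\<bar>(I1 - 1 - h * S) - (I2 - h * Kg) - (E - 1 + h * (- S + KA)) + h * (KA - Kg)\<bar>
          \<le> \<bar>I1 - 1 - h * S\<bar> + \<bar>I2 - h * Kg\<bar> + \<bar>E - 1 + h * (- S + KA)\<bar> + \<bar>h * (KA - Kg)\<bar>"
        by (simp only: abs_le_iff) linarith
      moreover have "\<bar>h * (KA - Kg)\<bar> \<le> h * D" using KD h by (simp add: abs_mult mult_left_mono)
      ultimately have "\<bar>I1 - I2 - E\<bar> \<le> e / 3 * h + e / 3 * h + e / 3 * h + h * D"
        using b1 b2 b3 by linarith
      also have "\<dots> = (e + D) * h" by (simp add: algebra_simps)
      finally have fin: "\<bar>I1 - I2 - E\<bar> \<le> (e + D) * h" .
      have U: "0 \<le> U" "U \<le> 1" unfolding U_def using survival_range[OF A w _ x] s by auto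
      have "\<bar>U * (I1 - I2) - U * E\<bar> = U * \<bar>I1 - I2 - E\<bar>" using U by (simp add: abs_mult right_diff_distrib[symmetric])
      also have "\<dots> \<le> 1 * \<bar>I1 - I2 - E\<bar>" using U by (intro mult_right_mono) auto
      finally show "\<bar>(\<integral>y. (1 - cutoff r \<delta> (y - x)) * survival ?A w s y \<partial>P h x) - survival ?A w (s + h) x\<bar>
          \<le> (e + jump_integral x (\<lambda>z. indicator ?A z - cutoff r \<delta> z)) * h"
        unfolding lhs rhs D_def[symmetric] using fin by simp
    qed
  qed
qed

lemma jump_integral_cutoff_tendsto:
  assumes r: "0 \<le> r" and A: "finite_jump_set (Kc r)" and d: "\<And>k. 0 < d k" "d \<longlonglongrightarrow> 0"
  shows "(\<lambda>k. jump_integral x (\<lambda>z. indicator (Kc r) z - cutoff r (d k) z)) \<longlonglongrightarrow> 0"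
proof -
  have "(\<lambda>k. LINT z|N. indicator (Kc r) z - cutoff r (d k) z) \<longlonglongrightarrow> (LINT z|N. 0 :: real)" if N: "levy_measure N" for N
  proof (rule integral_dominated_convergence[where w = "indicator (Kc r)"])
    note AN = finite_jump_setD[OF A N]
    show "integrable N (indicator (Kc r) :: _ \<Rightarrow> real)" using AN by simp
    show "(\<lambda>z. indicator (Kc r) z - cutoff r (d k) z) \<in> borel_measurable N" for k
      using AN levy_measurable[OF N borel_measurable_continuous_onI[OF cutoff_continuous]]
      by (intro borel_measurable_diff borel_measurable_indicator) auto
    show "AE z in N. norm (indicator (Kc r) z - cutoff r (d k) z) \<le> indicator (Kc r) z" for k
    proof (rule AE_levyI[OF N])
      fix z :: "real ^ 'n" assume z: "z \<in> orthant"
      show "norm (indicator (Kc r) z - cutoff r (d k) z) \<le> indicator (Kc r) z"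
        using cutoff_outside_Kc[OF r d(1) z] cutoff_range[of r "d k" z] by (cases "z \<in> Kc r") simp_all
    qed
    show "AE z in N. (\<lambda>k. indicator (Kc r) z - cutoff r (d k) z) \<longlonglongrightarrow> 0"
    proof (rule AE_levyI[OF N])
      fix z :: "real ^ 'n" assume z: "z \<in> orthant"
      show "(\<lambda>k. indicator (Kc r) z - cutoff r (d k) z) \<longlonglongrightarrow> 0"
      proof (cases "z \<in> Kc r")
        case True
        then have "0 < (norm z - r) / 2" using r by (simp add: Kc_eq)
        from order_tendstoD(2)[OF d(2) this]
        have "eventually (\<lambda>k. indicator (Kc r) z - cutoff r (d k) z = 0) sequentially"
          by eventually_elim (use True d(1) in \<open>simp add: cutoff_eq_1\<close>)
        then show ?thesis by (rule tendsto_eventually)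
      next
        case False
        then have "cutoff r (d k) z = 0" for k by (rule cutoff_outside_Kc[OF r d(1) z])
        then show ?thesis using False by simp
      qed
    qed
  qed auto
  then have "(\<lambda>k. jump_integral x (\<lambda>z. indicator (Kc r) z - cutoff r (d k) z)) \<longlonglongrightarrow> 0 + (\<Sum>l\<in>UNIV. x $ l * 0)"
    unfolding jump_integral_def by (intro tendsto_intros) (auto simp: levy_measure_nu_mu)
  then show ?thesis by simp
qed

text \<open>The vector with all coordinates \<open>R\<close> serves as a single starting point whose jump kernel dominates the jump
  kernels of all starting points of norm at most \<open>R\<close>.\<close>

lemma cutoff_one_step:
  assumes r: "0 \<le> r" and \<delta>: "0 < \<delta>"
  shows "eventually (\<lambda>h. \<forall>x\<in>orthant. norm x \<le> R \<longrightarrow>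
     (\<integral>y. cutoff r \<delta> (y - x) \<partial>P h x) \<le> (1 + jump_integral (\<chi> l. R) (cutoff r \<delta>)) * h) (at_right 0)"
proof -
  have "eventually (\<lambda>h::real. 0 < h) (at_right 0)" by (rule eventually_at_right_less)
  with small_time_rateD[OF small_time_rate_cutoff[OF r \<delta>] zero_less_one, of R 0] show ?thesis
  proof eventually_elim
    case (elim h)
    show ?case
    proof (intro ballI impI)
      fix x :: "real ^ 'n" assume x: "x \<in> orthant" and n: "norm x \<le> R"
      have 0: "(0 :: real ^ 'n) \<in> orthant" "norm (0 :: real ^ 'n) \<le> 0" by (simp_all add: orthant_iff)
      have "\<bar>(\<integral>y. cutoff r \<delta> (y - x) * exp (- (0 \<bullet> (y - x))) \<partial>P h x) - h * jump_integral x (\<lambda>z. cutoff r \<delta> z * exp (- (0 \<bullet> z)))\<bar> \<le> 1 * h"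
        using elim(1)[rule_format, OF x 0(1) n 0(2)] unfolding kernel_mean_def jump_mean_def .
      then have "(\<integral>y. cutoff r \<delta> (y - x) \<partial>P h x) \<le> h + h * jump_integral x (cutoff r \<delta>)" by simp
      also have "\<dots> \<le> h + h * jump_integral (\<chi> l. R) (cutoff r \<delta>)"
        using elim(2) jump_integral_bounded_start(1)[OF x n test_function_jump_integrable[OF test_function_cutoff[OF r \<delta>]] cutoff_range(1)]
        by (intro add_left_mono mult_left_mono) auto
      finally show "(\<integral>y. cutoff r \<delta> (y - x) \<partial>P h x) \<le> (1 + jump_integral (\<chi> l. R) (cutoff r \<delta>)) * h"
        by (simp add: algebra_simps)
    qed
  qed
qed

end

section \<open>Telescoping along a grid\<close>

locale cbi_path = cbi_kernel c \<beta> B \<nu> \<mu> P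
  for c \<beta> :: "real ^ 'n::finite" and B :: "real ^ 'n ^ 'n"
    and \<nu> :: "(real ^ 'n) measure" and \<mu> :: "'n \<Rightarrow> (real ^ 'n) measure"
    and P :: "real \<Rightarrow> real ^ 'n \<Rightarrow> (real ^ 'n) measure" +
  fixes M :: "'w measure" and X :: "real \<Rightarrow> 'w \<Rightarrow> real ^ 'n"
  assumes markov: "markov_process P M X"
    and cadlag_paths: "\<And>\<omega>. \<omega> \<in> space M \<Longrightarrow> cadlag (\<lambda>t. X t \<omega>)"
begin

sublocale prob_space M
  using markov unfolding markov_process_def by blast

lemma X_state: "0 \<le> t \<Longrightarrow> X t \<in> M \<rightarrow>\<^sub>M state_algebra"
  using markov unfolding markov_process_def by blast

lemma X_orthant: "0 \<le> t \<Longrightarrow> \<omega> \<in> space M \<Longrightarrow> X t \<omega> \<in> orthant"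
  using measurable_space[OF X_state, of t \<omega>] by (simp add: space_restrict_space)

lemma X_borel: "0 \<le> t \<Longrightarrow> X t \<in> borel_measurable M"
  using X_state[of t] by (simp add: measurable_restrict_space2_iff)

lemma X_borel_filtration: "0 \<le> u \<Longrightarrow> u \<le> s \<Longrightarrow> X u \<in> borel_measurable (natural_filtration M X s)"
proof -
  assume "0 \<le> u" "u \<le> s"
  then have "X u \<in> natural_filtration M X s \<rightarrow>\<^sub>M state_algebra"
    by (intro natural_filtration_measurable X_state)
  then show ?thesis by (simp add: measurable_restrict_space2_iff)
qed

lemma continuous_survival: "continuous_on UNIV (survival A w s)"
  unfolding survival_def by (intro continuous_intros)

text \<open>\<open>Z\<close> is the part of a grid functional that is known at time \<open>s\<close>. It usually contains the indicator that the
  path is still in a ball, so the mean over the kernel has to be bounded only where \<open>Z\<close> does not vanish.\<close>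

lemma one_step_expectation_bound:
  fixes Z :: "'w \<Rightarrow> real" and f :: "real ^ 'n \<Rightarrow> real ^ 'n \<Rightarrow> real"
  assumes s: "0 \<le> s" and h: "0 \<le> h" and C: "0 \<le> C"
    and Z: "Z \<in> borel_measurable (natural_filtration M X s)" "\<And>\<omega>. \<omega> \<in> space M \<Longrightarrow> \<bar>Z \<omega>\<bar> \<le> 1"
    and f: "(\<lambda>p. f (fst p) (snd p)) \<in> borel_measurable borel" "\<And>x y. x \<in> orthant \<Longrightarrow> y \<in> orthant \<Longrightarrow> \<bar>f x y\<bar> \<le> D"
    and bd: "\<And>\<omega>. \<omega> \<in> space M \<Longrightarrow> Z \<omega> \<noteq> 0 \<Longrightarrow> \<bar>\<integral>y. f (X s \<omega>) y \<partial>P h (X s \<omega>)\<bar> \<le> C"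
  shows "\<bar>\<integral>\<omega>. Z \<omega> * f (X s \<omega>) (X (s + h) \<omega>) \<partial>M\<bar> \<le> C"
proof -
  let ?F = "natural_filtration M X s" and ?S = "state_algebra :: (real ^ 'n) measure"
  have [measurable]: "Z \<in> borel_measurable ?F" by (rule Z)
  have [measurable]: "X s \<in> borel_measurable ?F" using s by (intro X_borel_filtration) auto
  have y[measurable]: "(\<lambda>y. y) \<in> borel_measurable ?S"
    by (rule measurable_restrict_space1) measurable
  have pair: "(\<lambda>p. (X s (fst p), snd p)) \<in> borel_measurable (?F \<Otimes>\<^sub>M ?S)"
  proof (rule borel_measurable_Pair)
    show "(\<lambda>p. X s (fst p)) \<in> borel_measurable (?F \<Otimes>\<^sub>M ?S)"
      by (rule measurable_compose[OF measurable_fst]) measurable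
    show "(\<lambda>p. snd p) \<in> borel_measurable (?F \<Otimes>\<^sub>M ?S)"
      using measurable_compose[OF measurable_snd y] by simp
  qed
  have fm: "(\<lambda>p. f (X s (fst p)) (snd p)) \<in> borel_measurable (?F \<Otimes>\<^sub>M ?S)"
    using measurable_compose[OF pair f(1)] by simp
  have H: "(\<lambda>p. Z (fst p) * f (X s (fst p)) (snd p)) \<in> borel_measurable (?F \<Otimes>\<^sub>M ?S)"
    by (rule borel_measurable_times[OF measurable_compose[OF measurable_fst Z(1)] fm])
  have "(\<integral>\<omega>. Z \<omega> * f (X s \<omega>) (X (s + h) \<omega>) \<partial>M) = (\<integral>\<omega>. (\<integral>y. Z \<omega> * f (X s \<omega>) y \<partial>P h (X s \<omega>)) \<partial>M)"
  proof -
    have bdd: "\<bar>Z \<omega> * f (X s \<omega>) y\<bar> \<le> 1 * D" if "\<omega> \<in> space M" "y \<in> orthant" for \<omega> y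
      unfolding abs_mult using Z(2)[OF that(1)] f(2)[OF X_orthant[OF s that(1)] that(2)] by (intro mult_mono') auto
    show ?thesis
      using markov_process_integral[OF transition markov s h H, of "1 * D"] bdd by simp
  qed
  also have "\<bar>\<dots>\<bar> \<le> C"
  proof -
    define G where "G \<omega> = (\<integral>y. Z \<omega> * f (X s \<omega>) y \<partial>P h (X s \<omega>))" for \<omega>
    have G: "\<bar>G \<omega>\<bar> \<le> C" if w: "\<omega> \<in> space M" for \<omega>
    proof (cases "Z \<omega> = 0")
      case True then show ?thesis using C by (simp add: G_def)
    next
      case False
      have "\<bar>G \<omega>\<bar> = \<bar>Z \<omega>\<bar> * \<bar>\<integral>y. f (X s \<omega>) y \<partial>P h (X s \<omega>)\<bar>" by (simp add: G_def abs_mult)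
      also have "\<dots> \<le> 1 * C" using Z(2)[OF w] bd[OF w False] by (intro mult_mono') auto
      finally show ?thesis by simp
    qed
    have "\<bar>integral\<^sup>L M G\<bar> \<le> C"
    proof (cases "integrable M G")
      case True
      have "\<bar>integral\<^sup>L M G\<bar> \<le> (\<integral>\<omega>. \<bar>G \<omega>\<bar> \<partial>M)" by (rule integral_abs_bound)
      also have "\<dots> \<le> (\<integral>\<omega>. C \<partial>M)" using True G by (intro integral_mono) auto
      finally show ?thesis by (simp add: prob_space)
    next
      case False
      then show ?thesis using C by (simp add: not_integrable_integral_eq)
    qed
    then show ?thesis unfolding G_def .
  qed
  finally show ?thesis .
qed

definition increment :: "real \<Rightarrow> nat \<Rightarrow> nat \<Rightarrow> 'w \<Rightarrow> real ^ 'n" where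
  "increment t n j \<omega> = X (grid t n (Suc j)) \<omega> - X (grid t n j) \<omega>"

definition inside :: "real \<Rightarrow> real \<Rightarrow> nat \<Rightarrow> nat \<Rightarrow> 'w \<Rightarrow> real" where
  "inside R t n j \<omega> = indicator {x. norm x \<le> R} (X (grid t n j) \<omega>)"

text \<open>Rational proportions make this event measurable and contain all grids of \<open>[0, t]\<close>.\<close>

definition confined :: "real \<Rightarrow> real \<Rightarrow> 'w set" where
  "confined R t = {\<omega>\<in>space M. \<forall>q\<in>\<rat> \<inter> {0..1}. norm (X (t * q) \<omega>) \<le> R}"

lemma confined_sets:
  assumes t: "0 \<le> t"
  shows "confined R t \<in> sets M"
  unfolding confined_def
proof (rule sets.sets_Collect_countable_All')
  show "countable (\<rat> \<inter> {0..1::real})" using countable_rat by (rule countable_Int1)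
  fix q :: real assume "q \<in> \<rat> \<inter> {0..1}"
  then have [measurable]: "X (t * q) \<in> borel_measurable M" using t by (intro X_borel) auto
  show "{\<omega>\<in>space M. norm (X (t * q) \<omega>) \<le> R} \<in> sets M" by measurable
qed

lemma inside_confined:
  assumes "\<omega> \<in> confined R t" "j \<le> n"
  shows "inside R t n j \<omega> = 1"
proof -
  have "real j / real n \<in> \<rat> \<inter> {0..1}" using assms(2) by (auto simp: divide_le_eq)
  then have "norm (X (t * (real j / real n)) \<omega>) \<le> R" using assms(1) unfolding confined_def by blast
  then show ?thesis by (simp add: inside_def grid_def)
qed

lemma confined_cover:
  assumes t: "0 \<le> t"
  shows "(\<Union>N. confined (real N) t) = space M"
proof (intro equalityI subsetI)
  fix \<omega> assume w: "\<omega> \<in> space M"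
  obtain N :: nat where N: "\<forall>s\<in>{0..t}. norm (X s \<omega>) \<le> N" using cadlag_bounded[OF cadlag_paths[OF w]] by blast
  have "norm (X (t * q) \<omega>) \<le> N" if "q \<in> \<rat> \<inter> {0..1}" for q
    using that t by (intro N[rule_format]) (auto intro: mult_left_le)
  then have "\<omega> \<in> confined (real N) t" using w unfolding confined_def by blast
  then show "\<omega> \<in> (\<Union>N. confined (real N) t)" by blast
qed (auto simp: confined_def)

lemma confined_tendsto:
  assumes t: "0 \<le> t"
  shows "(\<lambda>N. prob (confined (real N) t)) \<longlonglongrightarrow> 1"
proof -
  have "(\<lambda>N. prob (confined (real N) t)) \<longlonglongrightarrow> prob (\<Union>N. confined (real N) t)"
  proof (rule finite_Lim_measure_incseq)
    show "range (\<lambda>N. confined (real N) t) \<subseteq> sets M" using confined_sets[OF t] by auto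
    show "incseq (\<lambda>N. confined (real N) t)" unfolding incseq_def
    proof (intro allI impI subsetI)
      fix m n :: nat and \<omega> assume "m \<le> n" "\<omega> \<in> confined (real m) t"
      then have mn: "real m \<le> real n" and w: "\<omega> \<in> space M" "\<forall>q\<in>\<rat> \<inter> {0..1}. norm (X (t * q) \<omega>) \<le> real m"
        unfolding confined_def by auto
      have "norm (X (t * q) \<omega>) \<le> real n" if "q \<in> \<rat> \<inter> {0..1}" for q
        using w(2)[rule_format, OF that] mn by (rule order_trans)
      with w(1) show "\<omega> \<in> confined (real n) t" unfolding confined_def by blast
    qed
  qed
  then show ?thesis unfolding confined_cover[OF t] prob_space .
qed

lemma inside_range: "0 \<le> inside R t n j \<omega>" "inside R t n j \<omega> \<le> 1"
  by (auto simp: inside_def indicator_def)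

lemma increment_measurable: "0 \<le> t \<Longrightarrow> increment t n j \<in> borel_measurable M"
  unfolding increment_def[abs_def] by (intro borel_measurable_diff X_borel grid_nonneg)

lemma increment_measurable_filtration:
  "0 \<le> t \<Longrightarrow> i < j \<Longrightarrow> increment t n i \<in> borel_measurable (natural_filtration M X (grid t n j))"
  unfolding increment_def[abs_def] by (intro borel_measurable_diff X_borel_filtration grid_nonneg grid_mono) auto

lemma norm_ball_sets: "{x :: real ^ 'n. norm x \<le> R} \<in> sets borel"
  by (intro borel_closed closed_Collect_le continuous_intros)

lemma inside_measurable_filtration:
  assumes "0 \<le> t" "i \<le> j"
  shows "inside R t n i \<in> borel_measurable (natural_filtration M X (grid t n j))"
proof -
  have "X (grid t n i) \<in> borel_measurable (natural_filtration M X (grid t n j))"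
    using assms by (intro X_borel_filtration grid_nonneg grid_mono)
  from measurable_compose[OF this borel_measurable_indicator[OF norm_ball_sets]]
  show ?thesis unfolding inside_def[abs_def] .
qed

lemma inside_measurable: "0 \<le> t \<Longrightarrow> inside R t n i \<in> borel_measurable M"
  using measurable_compose[OF X_borel[OF grid_nonneg] borel_measurable_indicator[OF norm_ball_sets]]
  unfolding inside_def[abs_def] .

lemma cutoff_borel: "cutoff r \<delta> \<in> borel_measurable borel"
  by (rule borel_measurable_continuous_onI[OF cutoff_continuous])

lemma integrable_unit:
  assumes "f \<in> borel_measurable M" "\<And>\<omega>. \<omega> \<in> space M \<Longrightarrow> \<bar>f \<omega>\<bar> \<le> (1 :: real)"
  shows "integrable M f"
  using assms by (intro integrable_const_bound[where B = 1] AE_I2) auto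

text \<open>Between the survival probability at the start and the mean of the product over the grid, interpolate by
  \<open>b j\<close>: the first \<open>j\<close> factors, the indicators of staying in the ball, and the survival probability for the
  remaining time. By \<open>killed_one_step\<close> consecutive terms differ by \<open>(e + D) * h\<close>, up to the probability of
  leaving the ball at step \<open>j\<close>; the latter probabilities telescope to the probability of leaving it at all.\<close>

lemma grid_survival:
  assumes r: "0 \<le> r" and \<delta>: "0 < \<delta>" and A: "finite_jump_set (Kc r)"
    and w: "orthant_solution (killed_field (Kc r)) 0 w" and e: "0 < e" and t: "0 < t" and R: "0 \<le> R"
    and x: "AE \<omega> in M. X 0 \<omega> = x" "x \<in> orthant"
  shows "eventually (\<lambda>n. \<bar>(\<integral>\<omega>. (\<Prod>i<n. 1 - cutoff r \<delta> (increment t n i \<omega>)) \<partial>M) - survival (Kc r) w t x\<bar>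
     \<le> t * (e + jump_integral (\<chi> l. R) (\<lambda>z. indicator (Kc r) z - cutoff r \<delta> z)) + 2 * (1 - prob (confined R t))) sequentially"
proof -
  let ?A = "Kc r :: (real ^ 'n) set"
  let ?g = "cutoff r \<delta> :: real ^ 'n \<Rightarrow> real"
  define D where "D = jump_integral (\<chi> l. R) (\<lambda>z. indicator ?A z - ?g z)"
  have jiD: "jump_integrable (\<lambda>z. indicator ?A z - ?g z)"
    using jump_integrable_indicator[OF A] test_function_jump_integrable[OF test_function_cutoff[OF r \<delta>]]
    by (simp add: jump_integrable_def)
  have pD: "0 \<le> indicator ?A z - ?g z" if "z \<in> orthant" for z
    using cutoff_le_Kc[OF r \<delta> that] by simp
  have t0: "0 \<le> t" using t by simp
  have "eventually (\<lambda>h. \<forall>x\<in>orthant. norm x \<le> R \<longrightarrow> (\<forall>s\<in>{0..t}.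
     \<bar>(\<integral>y. (1 - ?g (y - x)) * survival ?A w s y \<partial>P h x) - survival ?A w (s + h) x\<bar>
       \<le> (e + jump_integral x (\<lambda>z. indicator ?A z - ?g z)) * h)) (at_right 0)"
    by (rule killed_one_step[OF r \<delta> A w e])
  moreover have "filterlim (\<lambda>n. t / real n) (at_right 0) sequentially"
    using t by (rule filterlim_mesh)
  ultimately have ev: "eventually (\<lambda>n. \<forall>x\<in>orthant. norm x \<le> R \<longrightarrow> (\<forall>s\<in>{0..t}.
     \<bar>(\<integral>y. (1 - ?g (y - x)) * survival ?A w s y \<partial>P (t / real n) x) - survival ?A w (s + t / real n) x\<bar>
       \<le> (e + jump_integral x (\<lambda>z. indicator ?A z - ?g z)) * (t / real n))) sequentially"
    unfolding filterlim_iff by blast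
  from ev eventually_gt_at_top[of "0::nat"] show ?thesis
  proof eventually_elim
    case (elim n)
    then have n: "0 < n" by simp
    define h where "h = t / real n"
    have h: "0 < h" "real n * h = t" using t n by (auto simp: h_def)
    have gS: "grid t n (Suc j) = grid t n j + h" for j using grid_diff[of t n j] by (simp add: h_def)
    have step: "\<bar>(\<integral>y. (1 - ?g (y - x)) * survival ?A w s y \<partial>P h x) - survival ?A w (s + h) x\<bar> \<le> (e + D) * h"
      if x: "x \<in> orthant" "norm x \<le> R" and s: "s \<in> {0..t}" for x s
    proof -
      have "\<bar>(\<integral>y. (1 - ?g (y - x)) * survival ?A w s y \<partial>P h x) - survival ?A w (s + h) x\<bar>
         \<le> (e + jump_integral x (\<lambda>z. indicator ?A z - ?g z)) * h"
        using elim(1) that unfolding h_def by blast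
      also have "\<dots> \<le> (e + D) * h"
        using h jump_integral_bounded_start(1)[OF x jiD pD] unfolding D_def by (intro mult_right_mono add_left_mono) auto
      finally show ?thesis .
    qed
    define Y where "Y j \<omega> = (\<Prod>i<j. (1 - ?g (increment t n i \<omega>)) * inside R t n i \<omega>)" for j \<omega>
    define C where "C j \<omega> = (\<Prod>i<j. inside R t n i \<omega>)" for j \<omega>
    define V where "V \<omega> = (\<Prod>i<n. 1 - ?g (increment t n i \<omega>))" for \<omega>
    define S where "S j = survival ?A w (t - grid t n j)" for j
    have Yr: "0 \<le> Y j \<omega>" "Y j \<omega> \<le> 1" for j \<omega>
      unfolding Y_def by (auto intro!: prod_nonneg prod_le_1 mult_nonneg_nonneg mult_le_one simp: cutoff_range inside_range)
    have Cr: "0 \<le> C j \<omega>" "C j \<omega> \<le> 1" for j \<omega>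
      unfolding C_def by (auto intro!: prod_nonneg prod_le_1 simp: inside_range)
    have Vr: "0 \<le> V \<omega>" "V \<omega> \<le> 1" for \<omega>
      unfolding V_def by (auto intro!: prod_nonneg prod_le_1 simp: cutoff_range)
    have YVC: "Y n \<omega> = V \<omega> * C n \<omega>" for \<omega> unfolding Y_def V_def C_def by (rule prod.distrib)
    have YC: "Y j \<omega> \<le> C j \<omega>" for j \<omega>
      unfolding Y_def C_def by (intro prod_mono) (auto simp: cutoff_range inside_range intro: mult_left_le_one_le)
    have sj: "t - grid t n j \<in> {0..t}" if "j \<le> n" for j
      using grid_le[OF t0 that] grid_nonneg[OF t0] by auto
    have Sr: "0 \<le> S j y" "S j y \<le> 1" if "j \<le> n" "y \<in> orthant" for j y
      using survival_range[OF A w _ that(2)] sj[OF that(1)] unfolding S_def by auto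
    have Sb[measurable]: "S j \<in> borel_measurable borel" for j
      unfolding S_def by (rule borel_measurable_continuous_onI[OF continuous_survival])
    have gb[measurable]: "?g \<in> borel_measurable borel" by (rule cutoff_borel)
    have Xb[measurable]: "X (grid t n j) \<in> borel_measurable M" for j by (rule X_borel[OF grid_nonneg[OF t0]])
    have Xo: "X (grid t n j) \<omega> \<in> orthant" if "\<omega> \<in> space M" for j \<omega> by (rule X_orthant[OF grid_nonneg[OF t0] that])
    have YF: "Y j \<in> borel_measurable (natural_filtration M X (grid t n j))" for j
      unfolding Y_def[abs_def]
      by (intro borel_measurable_prod borel_measurable_times borel_measurable_diff borel_measurable_const
          measurable_compose[OF increment_measurable_filtration[OF t0] gb] inside_measurable_filtration[OF t0]) auto
    have Ym[measurable]: "Y j \<in> borel_measurable M" for j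
      by (rule measurable_from_subalg[OF natural_filtration_subalgebra[OF X_state] YF])
    have im[measurable]: "inside R t n j \<in> borel_measurable M" for j by (rule inside_measurable[OF t0])
    have Cm[measurable]: "C j \<in> borel_measurable M" for j
      unfolding C_def[abs_def] by measurable
    have incm[measurable]: "increment t n j \<in> borel_measurable M" for j by (rule increment_measurable[OF t0])
    have Vm[measurable]: "V \<in> borel_measurable M" unfolding V_def[abs_def] by measurable
    define b where "b j = (\<integral>\<omega>. Y j \<omega> * S j (X (grid t n j) \<omega>) \<partial>M)" for j
    define c where "c j = (\<integral>\<omega>. C j \<omega> \<partial>M)" for j
    have Ci: "integrable M (C j)" for j using Cr by (intro integrable_unit) auto
    have one: "\<bar>b (Suc j) - b j\<bar> \<le> (e + D) * h + (c j - c (Suc j))" if j: "j < n" for j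
    proof -
      define Z where "Z \<omega> = Y j \<omega> * inside R t n j \<omega>" for \<omega>
      have Zr: "0 \<le> Z \<omega>" "Z \<omega> \<le> 1" for \<omega>
        unfolding Z_def using Yr[of j \<omega>] inside_range[of R t n j \<omega>] by (auto intro: mult_nonneg_nonneg mult_le_one)
      have Zm[measurable]: "Z \<in> borel_measurable M" unfolding Z_def[abs_def] by measurable
      define f where "f x y = (1 - ?g (y - x)) * S (Suc j) y - S j x" for x y
      have Seq: "S j = survival ?A w (t - grid t n (Suc j) + h)" unfolding S_def gS by simp
      have fr: "\<bar>(1 - ?g (y - x)) * S (Suc j) y\<bar> \<le> 1" if "y \<in> orthant" for x y
        using Sr[of "Suc j" y] that j cutoff_range[of r \<delta> "y - x"] by (auto simp: abs_mult intro!: mult_le_one)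
      have "\<bar>\<integral>\<omega>. Z \<omega> * f (X (grid t n j) \<omega>) (X (grid t n j + h) \<omega>) \<partial>M\<bar> \<le> (e + D) * h"
      proof (rule one_step_expectation_bound[OF grid_nonneg[OF t0], where D = 1])
        have "0 \<le> D" unfolding D_def
          using R jump_integrable_indicator[OF A] by (intro jump_integral_bounded_start(2)[OF _ order_refl jiD pD]) (simp_all add: orthant_iff)
        then show "0 \<le> (e + D) * h" using e h by simp
        show "Z \<in> borel_measurable (natural_filtration M X (grid t n j))"
          unfolding Z_def[abs_def] by (intro borel_measurable_times YF inside_measurable_filtration[OF t0 order_refl])
        show "\<bar>Z \<omega>\<bar> \<le> 1" for \<omega> using Zr[of \<omega>] by simp
        show "(\<lambda>p. f (fst p) (snd p)) \<in> borel_measurable borel"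
        proof -
          have 1: "(\<lambda>p :: (real ^ 'n) \<times> (real ^ 'n). snd p - fst p) \<in> borel_measurable borel"
            "(\<lambda>p :: (real ^ 'n) \<times> (real ^ 'n). snd p) \<in> borel_measurable borel"
            "(\<lambda>p :: (real ^ 'n) \<times> (real ^ 'n). fst p) \<in> borel_measurable borel"
            by (intro borel_measurable_continuous_onI continuous_intros)+
          show ?thesis unfolding f_def
            by (intro borel_measurable_diff borel_measurable_times borel_measurable_const
                measurable_compose[OF 1(1) gb] measurable_compose[OF 1(2) Sb] measurable_compose[OF 1(3) Sb])
        qed
        show "\<bar>f x y\<bar> \<le> 1" if "x \<in> orthant" "y \<in> orthant" for x y
        proof -
          have "0 \<le> (1 - ?g (y - x)) * S (Suc j) y"
            using Sr[of "Suc j" y] that j cutoff_range[of r \<delta> "y - x"] by (intro mult_nonneg_nonneg) auto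
          then show ?thesis using fr[OF that(2), of x] Sr[of j x] that j unfolding f_def by linarith
        qed
        fix \<omega> assume w: "\<omega> \<in> space M" and Z: "Z \<omega> \<noteq> 0"
        define x' where "x' = X (grid t n j) \<omega>"
        have x': "x' \<in> orthant" unfolding x'_def by (rule Xo[OF w])
        have "norm x' \<le> R" using Z by (auto simp: Z_def inside_def x'_def indicator_def split: if_splits)
        interpret p: prob_space "P h x'" using h x' by (intro transition_kernel(2)[OF transition]) auto
        have "integrable (P h x') (\<lambda>y. (1 - ?g (y - x')) * S (Suc j) y)"
          using h by (intro kernel_integrable[OF x' _ _ fr]) auto
        then have "(\<integral>y. f x' y \<partial>P h x') = (\<integral>y. (1 - ?g (y - x')) * S (Suc j) y \<partial>P h x') - S j x'"
          unfolding f_def by (simp add: p.prob_space)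
        then show "\<bar>\<integral>y. f (X (grid t n j) \<omega>) y \<partial>P h (X (grid t n j) \<omega>)\<bar> \<le> (e + D) * h"
          using step[OF x' \<open>norm x' \<le> R\<close> sj[of "Suc j"]] j unfolding x'_def[symmetric] Seq S_def[of "Suc j"] by simp
      qed (use h in auto)
      also have "(\<integral>\<omega>. Z \<omega> * f (X (grid t n j) \<omega>) (X (grid t n j + h) \<omega>) \<partial>M) =
          (\<integral>\<omega>. Y (Suc j) \<omega> * S (Suc j) (X (grid t n (Suc j)) \<omega>) - Z \<omega> * S j (X (grid t n j) \<omega>) \<partial>M)"
        unfolding f_def Z_def Y_def increment_def gS
        by (intro Bochner_Integration.integral_cong refl) (simp add: algebra_simps)
      also have "\<dots> = b (Suc j) - (\<integral>\<omega>. Z \<omega> * S j (X (grid t n j) \<omega>) \<partial>M)"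
        unfolding b_def
      proof (rule Bochner_Integration.integral_diff)
        show "integrable M (\<lambda>\<omega>. Y (Suc j) \<omega> * S (Suc j) (X (grid t n (Suc j)) \<omega>))"
        proof (rule integrable_unit)
          show "\<bar>Y (Suc j) \<omega> * S (Suc j) (X (grid t n (Suc j)) \<omega>)\<bar> \<le> 1" if "\<omega> \<in> space M" for \<omega>
            using Yr[of "Suc j" \<omega>] Sr[OF _ Xo[OF that], of "Suc j"] j by (auto simp: abs_mult intro!: mult_le_one)
        qed measurable
        show "integrable M (\<lambda>\<omega>. Z \<omega> * S j (X (grid t n j) \<omega>))"
        proof (rule integrable_unit)
          show "\<bar>Z \<omega> * S j (X (grid t n j) \<omega>)\<bar> \<le> 1" if "\<omega> \<in> space M" for \<omega>
            using Zr[of \<omega>] Sr[OF _ Xo[OF that], of j] j by (auto simp: abs_mult intro!: mult_le_one)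
        qed measurable
      qed
      finally have 1: "\<bar>b (Suc j) - (\<integral>\<omega>. Z \<omega> * S j (X (grid t n j) \<omega>) \<partial>M)\<bar> \<le> (e + D) * h" .
      have i1: "integrable M (\<lambda>\<omega>. Y j \<omega> * S j (X (grid t n j) \<omega>))"
      proof (rule integrable_unit)
        show "\<bar>Y j \<omega> * S j (X (grid t n j) \<omega>)\<bar> \<le> 1" if "\<omega> \<in> space M" for \<omega>
          using Yr[of j \<omega>] Sr[OF _ Xo[OF that], of j] j by (auto simp: abs_mult intro!: mult_le_one)
      qed measurable
      have i2: "integrable M (\<lambda>\<omega>. Z \<omega> * S j (X (grid t n j) \<omega>))"
      proof (rule integrable_unit)
        show "\<bar>Z \<omega> * S j (X (grid t n j) \<omega>)\<bar> \<le> 1" if "\<omega> \<in> space M" for \<omega>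
          using Zr[of \<omega>] Sr[OF _ Xo[OF that], of j] j by (auto simp: abs_mult intro!: mult_le_one)
      qed measurable
      have diff: "b j - (\<integral>\<omega>. Z \<omega> * S j (X (grid t n j) \<omega>) \<partial>M) =
          (\<integral>\<omega>. Y j \<omega> * S j (X (grid t n j) \<omega>) - Z \<omega> * S j (X (grid t n j) \<omega>) \<partial>M)"
        unfolding b_def using i1 i2 by simp
      have pw: "0 \<le> Y j \<omega> * S j (X (grid t n j) \<omega>) - Z \<omega> * S j (X (grid t n j) \<omega>)"
          "Y j \<omega> * S j (X (grid t n j) \<omega>) - Z \<omega> * S j (X (grid t n j) \<omega>) \<le> C j \<omega> - C (Suc j) \<omega>"
        if w: "\<omega> \<in> space M" for \<omega>
      proof -
        define p q y where "p = Y j \<omega>" and "q = 1 - inside R t n j \<omega>" and "y = S j (X (grid t n j) \<omega>)"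
        have pq: "0 \<le> p" "p \<le> C j \<omega>" "0 \<le> q" "0 \<le> y" "y \<le> 1"
          using Yr[of j \<omega>] YC[of j \<omega>] inside_range[of R t n j \<omega>] Sr[OF _ Xo[OF w], of j] j by (auto simp: p_def q_def y_def)
        have eq: "Y j \<omega> * S j (X (grid t n j) \<omega>) - Z \<omega> * S j (X (grid t n j) \<omega>) = p * q * y"
          by (simp add: Z_def p_def q_def y_def algebra_simps)
        show "0 \<le> Y j \<omega> * S j (X (grid t n j) \<omega>) - Z \<omega> * S j (X (grid t n j) \<omega>)" unfolding eq using pq by simp
        have "p * q * y \<le> p * q * 1" using pq by (intro mult_left_mono) auto
        also have "\<dots> \<le> C j \<omega> * q" using pq by (simp add: mult_right_mono)
        also have "\<dots> = C j \<omega> - C (Suc j) \<omega>" by (simp add: C_def q_def algebra_simps)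
        finally show "Y j \<omega> * S j (X (grid t n j) \<omega>) - Z \<omega> * S j (X (grid t n j) \<omega>) \<le> C j \<omega> - C (Suc j) \<omega>" unfolding eq .
      qed
      have "0 \<le> b j - (\<integral>\<omega>. Z \<omega> * S j (X (grid t n j) \<omega>) \<partial>M)"
        unfolding diff using pw(1) by (intro integral_nonneg_AE AE_I2)
      moreover have "b j - (\<integral>\<omega>. Z \<omega> * S j (X (grid t n j) \<omega>) \<partial>M) \<le> (\<integral>\<omega>. C j \<omega> - C (Suc j) \<omega> \<partial>M)"
        unfolding diff using pw(2) i1 i2 Ci by (intro integral_mono Bochner_Integration.integrable_diff) auto
      moreover have "(\<integral>\<omega>. C j \<omega> - C (Suc j) \<omega> \<partial>M) = c j - c (Suc j)"
        unfolding c_def using Ci by simp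
      ultimately show ?thesis using 1 by linarith
    qed
    \<comment> \<open>the last summand is the probability of leaving the ball before step \<open>m\<close>\<close>
    have tele: "\<bar>b m - b 0\<bar> \<le> real m * ((e + D) * h) + (c 0 - c m)" if "m \<le> n" for m
      using that
    proof (induction m)
      case (Suc m)
      then have "\<bar>b m - b 0\<bar> \<le> real m * ((e + D) * h) + (c 0 - c m)" "\<bar>b (Suc m) - b m\<bar> \<le> (e + D) * h + (c m - c (Suc m))"
        using one[of m] by auto
      moreover have "real (Suc m) * ((e + D) * h) = real m * ((e + D) * h) + (e + D) * h" by (simp add: algebra_simps)
      ultimately show ?case by linarith
    qed simp
    have b0: "b 0 = survival ?A w t x"
    proof -
      have "b 0 = (\<integral>\<omega>. survival ?A w t (X 0 \<omega>) \<partial>M)" by (simp add: b_def Y_def S_def grid_def)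
      also have "\<dots> = (\<integral>\<omega>. survival ?A w t x \<partial>M)"
      proof (rule integral_cong_AE)
        show "(\<lambda>\<omega>. survival ?A w t (X 0 \<omega>)) \<in> borel_measurable M"
          by (rule measurable_compose[OF X_borel[OF order_refl] borel_measurable_continuous_onI[OF continuous_survival]])
        show "AE \<omega> in M. survival ?A w t (X 0 \<omega>) = survival ?A w t x" using x(1) by eventually_elim simp
      qed simp
      finally show ?thesis by (simp add: prob_space)
    qed
    have bn: "b n = (\<integral>\<omega>. Y n \<omega> \<partial>M)"
    proof -
      have "w 0 = 0" using w unfolding orthant_solution_def by blast
      then have "S n y = 1" for y using n by (simp add: S_def grid_def survival_def)
      then show ?thesis by (simp add: b_def)
    qed
    have Vi: "integrable M V" using Vr by (intro integrable_unit) auto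
    have Yi: "integrable M (Y n)" using Yr by (intro integrable_unit) auto
    have dVY: "(\<integral>\<omega>. V \<omega> \<partial>M) - (\<integral>\<omega>. Y n \<omega> \<partial>M) = (\<integral>\<omega>. V \<omega> - Y n \<omega> \<partial>M)" using Vi Yi by simp
    have pv: "0 \<le> V \<omega> - Y n \<omega>" "V \<omega> - Y n \<omega> \<le> 1 - C n \<omega>" for \<omega>
    proof -
      have eq: "V \<omega> - Y n \<omega> = V \<omega> * (1 - C n \<omega>)" unfolding YVC by (simp add: algebra_simps)
      show "0 \<le> V \<omega> - Y n \<omega>" unfolding eq using Vr[of \<omega>] Cr[of n \<omega>] by simp
      have "V \<omega> * (1 - C n \<omega>) \<le> 1 * (1 - C n \<omega>)" using Vr[of \<omega>] Cr[of n \<omega>] by (intro mult_right_mono) auto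
      then show "V \<omega> - Y n \<omega> \<le> 1 - C n \<omega>" unfolding eq by simp
    qed
    have "0 \<le> (\<integral>\<omega>. V \<omega> - Y n \<omega> \<partial>M)" using pv(1) by (intro integral_nonneg_AE AE_I2)
    moreover have "(\<integral>\<omega>. V \<omega> - Y n \<omega> \<partial>M) \<le> (\<integral>\<omega>. 1 - C n \<omega> \<partial>M)"
      using pv(2) Vi Yi Ci by (intro integral_mono Bochner_Integration.integrable_diff) auto
    moreover have "(\<integral>\<omega>. 1 - C n \<omega> \<partial>M) = 1 - c n" unfolding c_def using Ci by (simp add: prob_space)
    ultimately have 1: "\<bar>(\<integral>\<omega>. V \<omega> \<partial>M) - (\<integral>\<omega>. Y n \<omega> \<partial>M)\<bar> \<le> 1 - c n" using dVY by linarith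
    have c0: "c 0 = 1" by (simp add: c_def C_def prob_space)
    have 2: "prob (confined R t) \<le> c n"
    proof -
      have "(\<integral>\<omega>. indicator (confined R t) \<omega> \<partial>M) \<le> (\<integral>\<omega>. C n \<omega> \<partial>M)"
      proof (rule integral_mono)
        show "indicator (confined R t) \<omega> \<le> C n \<omega>" if "\<omega> \<in> space M" for \<omega>
        proof (cases "\<omega> \<in> confined R t")
          case True
          then have "C n \<omega> = 1" unfolding C_def by (intro prod.neutral) (auto intro: inside_confined)
          then show ?thesis by (simp add: indicator_def)
        qed (simp add: Cr)
        show "integrable M (indicator (confined R t) :: _ \<Rightarrow> real)"
          by (intro integrable_unit borel_measurable_indicator confined_sets t0) (simp add: indicator_def)
      qed (rule Ci)
      then show ?thesis unfolding c_def using confined_sets[OF t0, of R] by (simp add: sets.Int_space_eq2)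
    qed
    have rn: "real n * ((e + D) * h) = t * (e + D)" unfolding h(2)[symmetric] by (simp only: ac_simps)
    have "\<bar>b n - b 0\<bar> \<le> t * (e + D) + (1 - c n)" using tele[OF order_refl] unfolding rn c0 .
    then have "\<bar>((\<integral>\<omega>. V \<omega> \<partial>M) - b n) + (b n - b 0)\<bar> \<le> (1 - c n) + (t * (e + D) + (1 - c n))"
      using 1 unfolding bn[symmetric] by (intro order_trans[OF abs_triangle_ineq add_mono])
    also have "\<dots> \<le> t * (e + D) + 2 * (1 - prob (confined R t))" using 2 by simp
    finally show "\<bar>(\<integral>\<omega>. (\<Prod>i<n. 1 - ?g (increment t n i \<omega>)) \<partial>M) - survival ?A w t x\<bar>
      \<le> t * (e + jump_integral (\<chi> l. R) (\<lambda>z. indicator ?A z - ?g z)) + 2 * (1 - prob (confined R t))"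
      unfolding V_def[symmetric] D_def[symmetric] b0[symmetric] by simp
  qed
qed

end

section \<open>The law of the large jumps\<close>

context cbi_path
begin

definition no_jump :: "real \<Rightarrow> real \<Rightarrow> 'w set" where
  "no_jump t r = {\<omega>\<in>space M. \<forall>u\<in>{0<..t}. norm (jump X u \<omega>) \<le> r}"

lemma no_jump_sets: "0 < t \<Longrightarrow> 0 \<le> r \<Longrightarrow> no_jump t r \<in> sets M"
  unfolding no_jump_def by (rule no_large_jump_measurable[OF X_borel cadlag_paths])

text \<open>With indicators in place of the cutoffs this would be the indicator of having no increment of norm greater
  than \<open>r\<close> along the grid.\<close>

definition thinned :: "real \<Rightarrow> real \<Rightarrow> real \<Rightarrow> nat \<Rightarrow> 'w \<Rightarrow> real" where
  "thinned r \<delta> t n \<omega> = (\<Prod>i<n. 1 - cutoff r \<delta> (increment t n i \<omega>))"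

lemma thinned_range: "0 \<le> thinned r \<delta> t n \<omega>" "thinned r \<delta> t n \<omega> \<le> 1"
  unfolding thinned_def by (auto intro!: prod_nonneg prod_le_1 simp: cutoff_range)

lemma thinned_measurable: "0 \<le> t \<Longrightarrow> thinned r \<delta> t n \<in> borel_measurable M"
  unfolding thinned_def[abs_def]
  by (intro borel_measurable_prod borel_measurable_diff borel_measurable_const
      measurable_compose[OF increment_measurable cutoff_borel])

lemma thinned_integrable: "0 \<le> t \<Longrightarrow> integrable M (thinned r \<delta> t n)"
  using thinned_range by (intro integrable_unit thinned_measurable) auto

lemma thinned_eventually_one:
  assumes w: "\<omega> \<in> no_jump t r" and t: "0 < t" and r: "0 \<le> r" and \<delta>: "0 < \<delta>"
  shows "eventually (\<lambda>n. thinned r \<delta> t n \<omega> = 1) sequentially"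
proof -
  have ws: "\<omega> \<in> space M" using w by (simp add: no_jump_def)
  have no: "norm (path_jump (\<lambda>s. X s \<omega>) u) \<le> r" if "u \<in> {0<..t}" for u
    using w that unfolding no_jump_def jump_eq_path_jump by blast
  have "eventually (\<lambda>n. \<forall>j<n. norm (X (grid t n (Suc j)) \<omega> - X (grid t n j) \<omega>) < r + \<delta>) sequentially"
    by (rule cadlag_grid_increments_small[OF cadlag_paths[OF ws] t r \<delta> no])
  then show ?thesis
  proof eventually_elim
    case (elim n)
    show ?case unfolding thinned_def
    proof (rule prod.neutral, rule ballI)
      fix i assume "i \<in> {..<n}"
      then have "norm (increment t n i \<omega>) < r + \<delta>" using elim by (simp add: increment_def)
      then show "1 - cutoff r \<delta> (increment t n i \<omega>) = 1" using \<delta> by (simp add: cutoff_eq_0)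
    qed
  qed
qed

lemma thinned_eventually_zero:
  assumes w: "\<omega> \<in> space M" "\<omega> \<notin> no_jump t (r + 2 * \<delta>)" and t: "0 < t" and \<delta>: "0 < \<delta>"
  shows "eventually (\<lambda>n. thinned r \<delta> t n \<omega> = 0) sequentially"
proof -
  obtain u where "u \<in> {0<..t}" "r + 2 * \<delta> < norm (path_jump (\<lambda>s. X s \<omega>) u)"
    using w unfolding no_jump_def jump_eq_path_jump by (auto simp: not_le)
  then have "{u} \<subseteq> {u\<in>{0<..t}. r + 2 * \<delta> < norm (path_jump (\<lambda>s. X s \<omega>) u)}" by simp
  from cadlag_grid_increments_large[OF cadlag_paths[OF w(1)] t _ this]
  have "eventually (\<lambda>n. 1 \<le> card {j\<in>{..<n}. r + 2 * \<delta> < norm (increment t n j \<omega>)}) sequentially"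
    by (simp add: increment_def)
  then show ?thesis
  proof eventually_elim
    case (elim n)
    then have "{j\<in>{..<n}. r + 2 * \<delta> < norm (increment t n j \<omega>)} \<noteq> {}" by (metis card.empty not_one_le_zero)
    then obtain j where j: "j < n" "r + 2 * \<delta> < norm (increment t n j \<omega>)" by auto
    then have "1 - cutoff r \<delta> (increment t n j \<omega>) = 0" using \<delta> by (simp add: cutoff_eq_1)
    then show ?case unfolding thinned_def using j(1) by (intro prod_zero) auto
  qed
qed

text \<open>For fine grids the product is \<open>1\<close> on paths without jumps of norm greater than \<open>r\<close>, and it is \<open>0\<close> on paths
  with a jump of norm greater than \<open>r + 2 * \<delta>\<close>.\<close>

lemma survival_sandwich:
  assumes r: "0 \<le> r" and A: "finite_jump_set (Kc r)"
    and w: "orthant_solution (killed_field (Kc r)) 0 w" and t: "0 < t"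
    and x: "AE \<omega> in M. X 0 \<omega> = x" "x \<in> orthant"
    and \<delta>: "0 < \<delta>" and e: "0 < e" and R: "0 \<le> R"
  defines "err \<equiv> t * (e + jump_integral (\<chi> l. R) (\<lambda>z. indicator (Kc r) z - cutoff r \<delta> z)) + 2 * (1 - prob (confined R t))"
  shows "prob (no_jump t r) \<le> survival (Kc r) w t x + err"
    and "survival (Kc r) w t x - err \<le> prob (no_jump t (r + 2 * \<delta>))"
proof -
  let ?V = "thinned r \<delta> t"
  let ?E = "no_jump t r" and ?E' = "no_jump t (r + 2 * \<delta>)"
  have t0: "0 \<le> t" using t by simp
  have Es: "?E \<in> sets M" "?E' \<in> sets M" using no_jump_sets[OF t] r \<delta> by auto
  have ev: "eventually (\<lambda>n. \<bar>(\<integral>\<omega>. ?V n \<omega> \<partial>M) - survival (Kc r) w t x\<bar> \<le> err) sequentially"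
    using grid_survival[OF r \<delta> A w e t R x] unfolding thinned_def err_def .
  have Vi: "integrable M (?V n)" for n by (rule thinned_integrable[OF t0])
  have iE: "integrable M (\<lambda>\<omega>. indicator S \<omega> * ?V n \<omega>)" if "S \<in> sets M" for n S
    using integrable_mult_indicator[OF that Vi[of n]] by simp
  have dom: "\<bar>indicator S \<omega> * ?V n \<omega>\<bar> \<le> 1" for S :: "'w set" and n \<omega>
    using thinned_range[of r \<delta> t n \<omega>] by (auto simp: indicator_def)
  have "(\<lambda>n. \<integral>\<omega>. indicator ?E \<omega> * ?V n \<omega> \<partial>M) \<longlonglongrightarrow> (\<integral>\<omega>. indicator ?E \<omega> \<partial>M)"
  proof (rule integral_dominated_convergence[where w = "\<lambda>_. 1"])
    show "AE \<omega> in M. (\<lambda>n. indicator ?E \<omega> * ?V n \<omega>) \<longlonglongrightarrow> indicator ?E \<omega>"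
    proof (rule AE_I2)
      fix \<omega> assume "\<omega> \<in> space M"
      show "(\<lambda>n. indicator ?E \<omega> * ?V n \<omega>) \<longlonglongrightarrow> indicator ?E \<omega>"
      proof (cases "\<omega> \<in> ?E")
        case True
        from thinned_eventually_one[OF True t r \<delta>] have "eventually (\<lambda>n. indicator ?E \<omega> * ?V n \<omega> = 1) sequentially"
          by eventually_elim (use True in simp)
        then show ?thesis using True by (simp add: tendsto_eventually)
      qed simp
    qed
  qed (use dom Es iE[OF Es(1)] in \<open>auto intro: borel_measurable_integrable\<close>)
  then have lim: "(\<lambda>n. \<integral>\<omega>. indicator ?E \<omega> * ?V n \<omega> \<partial>M) \<longlonglongrightarrow> prob ?E"
    using Es by (simp add: sets.Int_space_eq2)
  show "prob ?E \<le> survival (Kc r) w t x + err"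
  proof (rule tendsto_upperbound[OF lim])
    show "eventually (\<lambda>n. (\<integral>\<omega>. indicator ?E \<omega> * ?V n \<omega> \<partial>M) \<le> survival (Kc r) w t x + err) sequentially"
      using ev
    proof eventually_elim
      case (elim n)
      have "(\<integral>\<omega>. indicator ?E \<omega> * ?V n \<omega> \<partial>M) \<le> (\<integral>\<omega>. ?V n \<omega> \<partial>M)"
        using thinned_range by (intro integral_mono iE Es Vi) (auto simp: indicator_def)
      then show ?case using elim by (simp add: abs_le_iff)
    qed
  qed simp
  have "(\<lambda>n. \<integral>\<omega>. indicator (space M - ?E') \<omega> * ?V n \<omega> \<partial>M) \<longlonglongrightarrow> (\<integral>\<omega>. 0 \<partial>M)"
  proof (rule integral_dominated_convergence[where w = "\<lambda>_. 1"])
    show "AE \<omega> in M. (\<lambda>n. indicator (space M - ?E') \<omega> * ?V n \<omega>) \<longlonglongrightarrow> 0"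
    proof (rule AE_I2)
      fix \<omega> assume ws: "\<omega> \<in> space M"
      show "(\<lambda>n. indicator (space M - ?E') \<omega> * ?V n \<omega>) \<longlonglongrightarrow> 0"
      proof (cases "\<omega> \<in> ?E'")
        case False
        from thinned_eventually_zero[OF ws False t \<delta>] have "eventually (\<lambda>n. indicator (space M - ?E') \<omega> * ?V n \<omega> = 0) sequentially"
          by eventually_elim simp
        then show ?thesis by (rule tendsto_eventually)
      qed simp
    qed
  qed (use dom Es iE[OF sets.compl_sets[OF Es(2)]] in \<open>auto intro: borel_measurable_integrable\<close>)
  then have "(\<lambda>n. prob ?E' + (\<integral>\<omega>. indicator (space M - ?E') \<omega> * ?V n \<omega> \<partial>M)) \<longlonglongrightarrow> prob ?E' + 0"
    by (intro tendsto_intros) simp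
  then have lim': "(\<lambda>n. prob ?E' + (\<integral>\<omega>. indicator (space M - ?E') \<omega> * ?V n \<omega> \<partial>M)) \<longlonglongrightarrow> prob ?E'" by simp
  show "survival (Kc r) w t x - err \<le> prob ?E'"
  proof (rule tendsto_lowerbound[OF lim'])
    show "eventually (\<lambda>n. survival (Kc r) w t x - err \<le> prob ?E' + (\<integral>\<omega>. indicator (space M - ?E') \<omega> * ?V n \<omega> \<partial>M)) sequentially"
      using ev
    proof eventually_elim
      case (elim n)
      have "(\<integral>\<omega>. ?V n \<omega> \<partial>M) = (\<integral>\<omega>. indicator ?E' \<omega> * ?V n \<omega> + indicator (space M - ?E') \<omega> * ?V n \<omega> \<partial>M)"
        by (intro Bochner_Integration.integral_cong refl) (simp add: indicator_def)
      also have "\<dots> = (\<integral>\<omega>. indicator ?E' \<omega> * ?V n \<omega> \<partial>M) + (\<integral>\<omega>. indicator (space M - ?E') \<omega> * ?V n \<omega> \<partial>M)"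
        by (rule Bochner_Integration.integral_add[OF iE[OF Es(2)] iE[OF sets.compl_sets[OF Es(2)]]])
      also have "(\<integral>\<omega>. indicator ?E' \<omega> * ?V n \<omega> \<partial>M) \<le> (\<integral>\<omega>. indicator ?E' \<omega> \<partial>M)"
        using thinned_range Es by (intro integral_mono iE Es integrable_unit borel_measurable_indicator) (auto simp: indicator_def)
      also have "(\<integral>\<omega>. indicator ?E' \<omega> \<partial>M) = prob ?E'" using Es by (simp add: sets.Int_space_eq2)
      finally show ?case using elim by (simp add: abs_le_iff)
    qed
  qed simp
qed

text \<open>The order of the limits matters: \<open>\<delta>\<close> and \<open>e\<close> tend to \<open>0\<close> for a fixed radius, on whose ball the error is
  controlled, and only then does the radius tend to infinity.\<close>

lemma prob_no_jump:
  assumes r: "0 \<le> r" and A: "finite_jump_set (Kc r)"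
    and w: "orthant_solution (killed_field (Kc r)) 0 w" and t: "0 < t"
    and x: "AE \<omega> in M. X 0 \<omega> = x" "x \<in> orthant"
  shows "prob (no_jump t r) = survival (Kc r) w t x"
proof -
  define d where "d k = 1 / real (Suc k)" for k
  have d: "0 < d k" "d \<longlonglongrightarrow> 0" for k
    unfolding d_def[abs_def] by (simp, rule LIMSEQ_Suc[OF lim_1_over_n])
  define err where "err N k = t * (d k + jump_integral (\<chi> l. real N) (\<lambda>z. indicator (Kc r) z - cutoff r (d k) z))
      + 2 * (1 - prob (confined (real N) t))" for N k
  define p where "p N = prob (confined (real N) t)" for N
  have err: "err N \<longlonglongrightarrow> 2 * (1 - p N)" for N
  proof -
    have "err N \<longlonglongrightarrow> t * (0 + 0) + 2 * (1 - p N)"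
      unfolding err_def p_def by (intro tendsto_intros d(2) jump_integral_cutoff_tendsto[OF r A d])
    then show ?thesis by simp
  qed
  have le1: "prob (no_jump t r) \<le> survival (Kc r) w t x + err N k"
    and le2: "survival (Kc r) w t x - err N k \<le> prob (no_jump t (r + 2 * d k))" for N k
    using survival_sandwich[OF r A w t x d(1) d(1), of "real N" k k] unfolding err_def by auto
  have mono: "no_jump t a \<subseteq> no_jump t b" if "a \<le> b" for a b
    unfolding no_jump_def using that by (auto intro: order_trans)
  have "(\<lambda>k. prob (no_jump t (r + 2 * d k))) \<longlonglongrightarrow> prob (\<Inter>k. no_jump t (r + 2 * d k))"
  proof (rule finite_Lim_measure_decseq)
    have "0 \<le> r + 2 * d k" for k using r d(1)[of k] by simp
    then show "range (\<lambda>k. no_jump t (r + 2 * d k)) \<subseteq> sets M" using no_jump_sets[OF t] by auto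
    show "decseq (\<lambda>k. no_jump t (r + 2 * d k))"
      unfolding decseq_def by (intro allI impI mono) (simp add: d_def frac_le)
  qed
  also have "(\<Inter>k. no_jump t (r + 2 * d k)) = no_jump t r"
  proof (intro equalityI subsetI)
    fix \<omega> assume w: "\<omega> \<in> (\<Inter>k. no_jump t (r + 2 * d k))"
    have "norm (jump X u \<omega>) \<le> r" if u: "u \<in> {0<..t}" for u
    proof (rule tendsto_lowerbound)
      show "(\<lambda>k. r + 2 * d k) \<longlonglongrightarrow> r" using tendsto_add[OF tendsto_const tendsto_mult[OF tendsto_const d(2)], of r 2] by simp
      show "eventually (\<lambda>k. norm (jump X u \<omega>) \<le> r + 2 * d k) sequentially"
        using w u by (auto simp: no_jump_def)
    qed simp
    then show "\<omega> \<in> no_jump t r" using w by (auto simp: no_jump_def)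
  next
    fix \<omega> assume w: "\<omega> \<in> no_jump t r"
    have "no_jump t r \<subseteq> no_jump t (r + 2 * d k)" for k using d(1)[of k] by (intro mono) simp
    with w show "\<omega> \<in> (\<Inter>k. no_jump t (r + 2 * d k))" by blast
  qed
  finally have lim: "(\<lambda>k. prob (no_jump t (r + 2 * d k))) \<longlonglongrightarrow> prob (no_jump t r)" .
  have p: "p \<longlonglongrightarrow> 1" unfolding p_def[abs_def] using t by (intro confined_tendsto) simp
  have u1: "prob (no_jump t r) \<le> survival (Kc r) w t x + 2 * (1 - p N)" for N
    by (rule LIMSEQ_le_const[OF tendsto_add[OF tendsto_const err]]) (use le1 in auto)
  have u2: "survival (Kc r) w t x - 2 * (1 - p N) \<le> prob (no_jump t r)" for N
    by (rule LIMSEQ_le[OF tendsto_diff[OF tendsto_const err] lim]) (use le2 in auto)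
  have l1: "(\<lambda>N. survival (Kc r) w t x + 2 * (1 - p N)) \<longlonglongrightarrow> survival (Kc r) w t x + 2 * (1 - 1)"
    by (intro tendsto_intros p)
  have l2: "(\<lambda>N. survival (Kc r) w t x - 2 * (1 - p N)) \<longlonglongrightarrow> survival (Kc r) w t x - 2 * (1 - 1)"
    by (intro tendsto_intros p)
  have "prob (no_jump t r) \<le> survival (Kc r) w t x + 2 * (1 - 1)" by (rule LIMSEQ_le_const[OF l1]) (use u1 in auto)
  moreover have "survival (Kc r) w t x - 2 * (1 - 1) \<le> prob (no_jump t r)" by (rule LIMSEQ_le_const2[OF l2]) (use u2 in auto)
  ultimately show ?thesis by simp
qed

text \<open>At least the number of increments of norm greater than \<open>2 * \<delta>\<close> that start in the ball, and yet a functional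
  whose mean is controlled by \<open>cutoff_one_step\<close>.\<close>

definition jump_count :: "real \<Rightarrow> real \<Rightarrow> real \<Rightarrow> nat \<Rightarrow> 'w \<Rightarrow> real" where
  "jump_count R \<delta> t n \<omega> = (\<Sum>j<n. inside R t n j \<omega> * cutoff 0 \<delta> (increment t n j \<omega>))"

lemma jump_count_nonneg: "0 \<le> jump_count R \<delta> t n \<omega>"
  unfolding jump_count_def by (intro sum_nonneg mult_nonneg_nonneg inside_range cutoff_range)

lemma jump_count_measurable: "0 \<le> t \<Longrightarrow> jump_count R \<delta> t n \<in> borel_measurable M"
  unfolding jump_count_def[abs_def]
  by (intro borel_measurable_sum borel_measurable_times inside_measurable measurable_compose[OF increment_measurable cutoff_borel])

text \<open>The bound does not depend on \<open>\<delta>\<close>: all cutoffs are dominated by the finite total mass of the jump kernel.\<close>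

lemma expected_jump_count:
  assumes A: "finite_jump_set (Kc 0)" and t: "0 < t" and R: "0 \<le> R" and \<delta>: "0 < \<delta>"
  shows "eventually (\<lambda>n. (\<integral>\<^sup>+\<omega>. ennreal (jump_count R \<delta> t n \<omega>) \<partial>M)
     \<le> ennreal (t * (1 + jump_integral (\<chi> l. R) (indicator (Kc 0))))) sequentially"
proof -
  let ?g = "cutoff 0 \<delta> :: real ^ 'n \<Rightarrow> real"
  define C where "C = 1 + jump_integral (\<chi> l. R) (indicator (Kc 0))"
  have t0: "0 \<le> t" using t by simp
  have Ro: "(\<chi> l. R) \<in> orthant" using R by (simp add: orthant_iff)
  have C: "1 + jump_integral (\<chi> l. R) ?g \<le> C"
    unfolding C_def using cutoff_le_Kc[OF order_refl \<delta>]
    by (intro add_left_mono jump_integral_mono[OF Ro test_function_jump_integrable[OF test_function_cutoff[OF order_refl \<delta>]] jump_integrable_indicator[OF A]])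
  have C0: "0 \<le> C"
    using jump_integral_bounded_start(2)[OF Ro order_refl jump_integrable_indicator[OF A]] unfolding C_def by simp
  have "eventually (\<lambda>h. \<forall>x\<in>orthant. norm x \<le> R \<longrightarrow> (\<integral>y. ?g (y - x) \<partial>P h x) \<le> (1 + jump_integral (\<chi> l. R) ?g) * h) (at_right 0)"
    by (rule cutoff_one_step[OF order_refl \<delta>])
  moreover have "filterlim (\<lambda>n. t / real n) (at_right 0) sequentially"
    using t by (rule filterlim_mesh)
  ultimately have "eventually (\<lambda>n. \<forall>x\<in>orthant. norm x \<le> R \<longrightarrow>
      (\<integral>y. ?g (y - x) \<partial>P (t / real n) x) \<le> (1 + jump_integral (\<chi> l. R) ?g) * (t / real n)) sequentially"
    unfolding filterlim_iff by blast
  from this eventually_gt_at_top[of "0::nat"] show ?thesis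
  proof eventually_elim
    case (elim n)
    define h where "h = t / real n"
    have h: "0 < h" "real n * h = t" using t elim by (auto simp: h_def)
    have gS: "grid t n (Suc j) = grid t n j + h" for j using grid_diff[of t n j] by (simp add: h_def)
    have one: "\<bar>\<integral>\<omega>. inside R t n j \<omega> * ?g (increment t n j \<omega>) \<partial>M\<bar> \<le> C * h" if j: "j < n" for j
    proof -
      have "\<bar>\<integral>\<omega>. inside R t n j \<omega> * (\<lambda>x y. ?g (y - x)) (X (grid t n j) \<omega>) (X (grid t n j + h) \<omega>) \<partial>M\<bar> \<le> C * h"
      proof (rule one_step_expectation_bound[OF grid_nonneg[OF t0], where D = 1])
        show "0 \<le> C * h" using C0 h by simp
        show "inside R t n j \<in> borel_measurable (natural_filtration M X (grid t n j))"
          by (rule inside_measurable_filtration[OF t0 order_refl])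
        show "\<bar>inside R t n j \<omega>\<bar> \<le> 1" for \<omega> using inside_range[of R t n j \<omega>] by simp
        have "(\<lambda>p :: (real ^ 'n) \<times> (real ^ 'n). snd p - fst p) \<in> borel_measurable borel"
          by (intro borel_measurable_continuous_onI continuous_intros)
        from measurable_compose[OF this cutoff_borel]
        show "(\<lambda>p. ?g (snd p - fst p)) \<in> borel_measurable borel" .
        show "\<bar>?g (y - x)\<bar> \<le> 1" for x y using cutoff_range[of 0 \<delta> "y - x"] by simp
        fix \<omega> assume w: "\<omega> \<in> space M" and Z: "inside R t n j \<omega> \<noteq> 0"
        define x' where "x' = X (grid t n j) \<omega>"
        have x': "x' \<in> orthant" unfolding x'_def by (rule X_orthant[OF grid_nonneg[OF t0] w])
        have "norm x' \<le> R" using Z by (auto simp: inside_def x'_def indicator_def split: if_splits)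
        then have "(\<integral>y. ?g (y - x') \<partial>P h x') \<le> (1 + jump_integral (\<chi> l. R) ?g) * h"
          using elim(1) x' unfolding h_def by blast
        also have "\<dots> \<le> C * h" using C h by (intro mult_right_mono) auto
        finally have "(\<integral>y. ?g (y - x') \<partial>P h x') \<le> C * h" .
        moreover have "0 \<le> (\<integral>y. ?g (y - x') \<partial>P h x')" by (intro integral_nonneg_AE AE_I2 cutoff_range)
        ultimately show "\<bar>\<integral>y. ?g (y - X (grid t n j) \<omega>) \<partial>P h (X (grid t n j) \<omega>)\<bar> \<le> C * h"
          unfolding x'_def[symmetric] by simp
      qed (use h in auto)
      then show ?thesis by (simp add: increment_def gS)
    qed
    have int: "integrable M (\<lambda>\<omega>. inside R t n j \<omega> * ?g (increment t n j \<omega>))" for j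
    proof (rule integrable_unit)
      show "(\<lambda>\<omega>. inside R t n j \<omega> * ?g (increment t n j \<omega>)) \<in> borel_measurable M"
        by (intro borel_measurable_times inside_measurable t0 measurable_compose[OF increment_measurable[OF t0] cutoff_borel])
      show "\<bar>inside R t n j \<omega> * ?g (increment t n j \<omega>)\<bar> \<le> 1" for \<omega>
        using inside_range[of R t n j \<omega>] cutoff_range[of 0 \<delta> "increment t n j \<omega>"] by (auto simp: abs_mult intro!: mult_le_one)
    qed
    have "(\<integral>\<omega>. jump_count R \<delta> t n \<omega> \<partial>M) = (\<Sum>j<n. \<integral>\<omega>. inside R t n j \<omega> * ?g (increment t n j \<omega>) \<partial>M)"
      unfolding jump_count_def using int by simp
    also have "\<dots> \<le> (\<Sum>j<n. C * h)" using one by (intro sum_mono) (auto simp: abs_le_iff)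
    also have "\<dots> = t * C" unfolding h(2)[symmetric] by simp
    finally have fin: "(\<integral>\<omega>. jump_count R \<delta> t n \<omega> \<partial>M) \<le> t * C" .
    have "integrable M (jump_count R \<delta> t n)" unfolding jump_count_def[abs_def] using int by simp
    then have "(\<integral>\<^sup>+\<omega>. ennreal (jump_count R \<delta> t n \<omega>) \<partial>M) = ennreal (\<integral>\<omega>. jump_count R \<delta> t n \<omega> \<partial>M)"
      by (rule nn_integral_eq_integral) (simp add: jump_count_nonneg)
    then show "(\<integral>\<^sup>+\<omega>. ennreal (jump_count R \<delta> t n \<omega>) \<partial>M)
       \<le> ennreal (t * (1 + jump_integral (\<chi> l. R) (indicator (Kc 0))))"
      using fin unfolding C_def[symmetric] by (simp add: ennreal_leI)
  qed
qed

lemma cutoff_0_antimono: "0 < a \<Longrightarrow> a \<le> b \<Longrightarrow> cutoff 0 b z \<le> cutoff 0 a z"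
proof -
  assume "0 < a" "a \<le> b"
  then have "norm z / b \<le> norm z / a" by (intro divide_left_mono) auto
  then show ?thesis unfolding cutoff_def by (auto simp: min_def max_def)
qed

text \<open>By the lemma of Fatou for the grids and monotone convergence for \<open>\<delta>\<close> tending to \<open>0\<close>, the expected number of
  jumps of the paths confined to a ball is finite.\<close>

lemma J_punctured_orthant_finite_confined:
  assumes A: "finite_jump_set (Kc 0)" and t: "0 < t" and R: "0 \<le> R"
  shows "AE \<omega> in M. \<omega> \<in> confined R t \<longrightarrow> J X t punctured_orthant \<omega> < \<infinity>"
proof -
  define d where "d k = 1 / real (Suc k)" for k
  have d: "0 < d k" for k by (simp add: d_def)
  have d0: "d \<longlonglongrightarrow> 0" unfolding d_def[abs_def] by (rule LIMSEQ_Suc[OF lim_1_over_n])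
  have t0: "0 \<le> t" using t by simp
  define C where "C = t * (1 + jump_integral (\<chi> l. R) (indicator (Kc 0)))"
  define L where "L k \<omega> = liminf (\<lambda>n. ennreal (jump_count R (d k) t n \<omega>))" for k \<omega>
  have Tm[measurable]: "(\<lambda>\<omega>. ennreal (jump_count R (d k) t n \<omega>)) \<in> borel_measurable M" for k n
    using jump_count_measurable[OF t0, of R "d k" n] by measurable
  have Lm[measurable]: "L k \<in> borel_measurable M" for k unfolding L_def[abs_def] by measurable
  have L_le: "(\<integral>\<^sup>+\<omega>. L k \<omega> \<partial>M) \<le> ennreal C" for k
  proof -
    have "(\<integral>\<^sup>+\<omega>. L k \<omega> \<partial>M) \<le> liminf (\<lambda>n. \<integral>\<^sup>+\<omega>. ennreal (jump_count R (d k) t n \<omega>) \<partial>M)"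
      unfolding L_def by (rule nn_integral_liminf[OF Tm])
    also have "\<dots> \<le> limsup (\<lambda>n. \<integral>\<^sup>+\<omega>. ennreal (jump_count R (d k) t n \<omega>) \<partial>M)"
      by (rule Liminf_le_Limsup) simp
    also have "\<dots> \<le> ennreal C"
      unfolding C_def by (rule Limsup_bounded) (rule expected_jump_count[OF A t R d])
    finally show ?thesis .
  qed
  have mono: "jump_count R (d k) t n \<omega> \<le> jump_count R (d (Suc k)) t n \<omega>" for k n \<omega>
    unfolding jump_count_def
    by (intro sum_mono mult_left_mono inside_range cutoff_0_antimono d) (simp add: d_def frac_le)
  have "incseq L"
    unfolding incseq_Suc_iff le_fun_def L_def using mono by (auto intro!: Liminf_mono always_eventually ennreal_leI)
  then have "(\<integral>\<^sup>+\<omega>. (SUP k. L k \<omega>) \<partial>M) = (SUP k. \<integral>\<^sup>+\<omega>. L k \<omega> \<partial>M)"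
    by (intro nn_integral_monotone_convergence_SUP Lm)
  also have "\<dots> \<le> ennreal C" using L_le by (intro SUP_least)
  finally have "(\<integral>\<^sup>+\<omega>. (SUP k. L k \<omega>) \<partial>M) \<noteq> \<infinity>" by (metis ennreal_less_top infinity_ennreal_def leD)
  then have "AE \<omega> in M. (SUP k. L k \<omega>) \<noteq> \<infinity>" by (intro nn_integral_noteq_infinite) measurable
  then show ?thesis
  proof (rule AE_mp, intro AE_I2 impI)
    fix \<omega> assume ws: "\<omega> \<in> space M" and fin: "(SUP k. L k \<omega>) \<noteq> \<infinity>" and conf: "\<omega> \<in> confined R t"
    have "J X t punctured_orthant \<omega> \<le> (SUP k. L k \<omega>)"
      unfolding J_def
    proof (rule emeasure_count_space_le)
      fix F assume F: "finite F" "F \<subseteq> {u\<in>{0<..t}. jump X u \<omega> \<in> punctured_orthant}"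
      have "eventually (\<lambda>k. \<forall>u\<in>F. 2 * d k < norm (jump X u \<omega>)) sequentially"
      proof (rule eventually_ball_finite[OF F(1)], rule ballI)
        fix u assume "u \<in> F"
        then have "jump X u \<omega> \<noteq> 0" using F by (auto simp: punctured_orthant_def)
        then have "0 < norm (jump X u \<omega>) / 2" by simp
        from order_tendstoD(2)[OF d0 this] show "eventually (\<lambda>k. 2 * d k < norm (jump X u \<omega>)) sequentially"
          by eventually_elim simp
      qed
      then obtain k where k: "\<forall>u\<in>F. 2 * d k < norm (jump X u \<omega>)" using eventually_happens by fastforce
      have "F \<subseteq> {u\<in>{0<..t}. 2 * d k < norm (path_jump (\<lambda>s. X s \<omega>) u)}"
        using F k unfolding jump_eq_path_jump by auto
      from cadlag_grid_increments_large[OF cadlag_paths[OF ws] t F(1) this]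
      have "eventually (\<lambda>n. of_nat (card F) \<le> ennreal (jump_count R (d k) t n \<omega>)) sequentially"
      proof eventually_elim
        case (elim n)
        define I where "I = {j\<in>{..<n}. 2 * d k < norm (increment t n j \<omega>)}"
        have cut: "cutoff 0 (d k) (increment t n j \<omega>) = 1" if "j \<in> I" for j
          using that d by (intro cutoff_eq_1) (auto simp: I_def)
        have "real (card I) = (\<Sum>j\<in>I. inside R t n j \<omega> * cutoff 0 (d k) (increment t n j \<omega>))"
          using inside_confined[OF conf, of _ n] by (simp add: cut) (auto simp: I_def)
        also have "\<dots> \<le> jump_count R (d k) t n \<omega>"
          unfolding jump_count_def by (intro sum_mono2 mult_nonneg_nonneg inside_range cutoff_range) (auto simp: I_def)
        finally have "real (card I) \<le> jump_count R (d k) t n \<omega>" .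
        moreover have "card F \<le> card I" using elim by (simp add: I_def increment_def)
        ultimately have "real (card F) \<le> jump_count R (d k) t n \<omega>" by linarith
        then show ?case by (metis ennreal_leI ennreal_of_nat_eq_real_of_nat)
      qed
      then have "of_nat (card F) \<le> L k \<omega>" unfolding L_def by (rule Liminf_bounded)
      also have "\<dots> \<le> (SUP k. L k \<omega>)" by (rule SUP_upper) simp
      finally show "of_nat (card F) \<le> (SUP k. L k \<omega>)" .
    qed
    also have "(SUP k. L k \<omega>) < \<infinity>" using fin unfolding infinity_ennreal_def by (rule top.not_eq_extremum[THEN iffD1])
    finally show "J X t punctured_orthant \<omega> < \<infinity>" .
  qed
qed

lemma J_punctured_orthant_measurable:
  assumes t: "0 < t"
  shows "J X t punctured_orthant \<in> borel_measurable M"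
proof (rule J_measurable[OF X_borel cadlag_paths t, where A = "\<lambda>k. orthant \<inter> {z. 1 / real (Suc k) \<le> norm z}"])
  show "orthant \<inter> {z :: real ^ 'n. 1 / real (Suc k) \<le> norm z} \<subseteq> orthant \<inter> {z. 1 / real (Suc (Suc k)) \<le> norm z}" for k
  proof -
    have "1 / real (Suc (Suc k)) \<le> 1 / real (Suc k)" by (rule frac_le) auto
    then show ?thesis by auto
  qed
  show "punctured_orthant = (\<Union>k. orthant \<inter> {z :: real ^ 'n. 1 / real (Suc k) \<le> norm z})"
  proof (intro equalityI subsetI)
    fix z :: "real ^ 'n" assume z: "z \<in> punctured_orthant"
    then have "0 < norm z" by (simp add: punctured_orthant_def)
    then obtain k where "inverse (real (Suc k)) < norm z" using reals_Archimedean by blast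
    then show "z \<in> (\<Union>k. orthant \<inter> {z. 1 / real (Suc k) \<le> norm z})"
      using z by (auto simp: punctured_orthant_def inverse_eq_divide intro: less_imp_le)
  next
    fix z :: "real ^ 'n" assume "z \<in> (\<Union>k. orthant \<inter> {z. 1 / real (Suc k) \<le> norm z})"
    then obtain k where k: "z \<in> orthant" "1 / real (Suc k) \<le> norm z" by blast
    moreover have "0 < 1 / real (Suc k)" by simp
    ultimately have "z \<noteq> 0" by (metis norm_zero not_less)
    then show "z \<in> punctured_orthant" using k by (simp add: punctured_orthant_def)
  qed
  show "closed (orthant \<inter> {z :: real ^ 'n. 1 / real (Suc k) \<le> norm z})" for k
    by (intro closed_Int closed_orthant closed_Collect_le continuous_intros)
  show "0 \<notin> orthant \<inter> {z :: real ^ 'n. 1 / real (Suc k) \<le> norm z}" for k by simp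
qed

lemma prob_finitely_many_jumps:
  assumes A: "finite_jump_set (Kc 0)" and t: "0 < t"
  shows "\<P>(\<omega> in M. J X t punctured_orthant \<omega> < \<infinity>) = 1"
proof -
  have "AE \<omega> in M. \<forall>N::nat. \<omega> \<in> confined (real N) t \<longrightarrow> J X t punctured_orthant \<omega> < \<infinity>"
    unfolding AE_all_countable using J_punctured_orthant_finite_confined[OF A t] by simp
  then have "AE \<omega> in M. J X t punctured_orthant \<omega> < \<infinity>"
  proof (rule AE_mp, intro AE_I2 impI)
    fix \<omega> assume w: "\<omega> \<in> space M" and *: "\<forall>N::nat. \<omega> \<in> confined (real N) t \<longrightarrow> J X t punctured_orthant \<omega> < \<infinity>"
    have "\<omega> \<in> (\<Union>N. confined (real N) t)" unfolding confined_cover[OF less_imp_le[OF t]] by (rule w)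
    then show "J X t punctured_orthant \<omega> < \<infinity>" using * by blast
  qed
  moreover have "{\<omega>\<in>space M. J X t punctured_orthant \<omega> < \<infinity>} \<in> sets M"
    using J_punctured_orthant_measurable[OF t] by measurable
  ultimately show ?thesis by (simp add: prob_Collect_eq_1)
qed

lemma prob_finitely_many_large_jumps:
  assumes r: "0 < r"
  shows "\<P>(\<omega> in M. J X t (Kc r) \<omega> < \<infinity>) = 1"
proof -
  have "J X t (Kc r) \<omega> < \<infinity>" if w: "\<omega> \<in> space M" for \<omega>
  proof -
    have "{u\<in>{0<..t}. jump X u \<omega> \<in> Kc r} \<subseteq> {u\<in>{0<..t}. r < norm (path_jump (\<lambda>s. X s \<omega>) u)}"
      using r unfolding jump_eq_path_jump by (auto simp: Kc_eq)
    then have "finite {u\<in>{0<..t}. jump X u \<omega> \<in> Kc r}"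
      by (rule finite_subset[OF _ cadlag_finite_large_jumps[OF cadlag_paths[OF w] r]])
    then show ?thesis by (simp add: J_def emeasure_count_space of_nat_less_top)
  qed
  then have "{\<omega>\<in>space M. J X t (Kc r) \<omega> < \<infinity>} = space M" by auto
  then show ?thesis by (simp add: prob_space)
qed

lemma survival_eq:
  assumes A: "finite_jump_set A" and w: "orthant_solution (killed_field A) 0 w" and t: "0 \<le> t"
  shows "survival A w t x = exp (- measure \<nu> A * t - (\<Sum>l\<in>UNIV. x $ l * w t $ l)
                - integral {0..t} (\<lambda>s. \<psi>_trunc \<beta> \<nu> A (w s)))"
proof -
  have c: "continuous_on {0..t} (\<lambda>u. killed_rate A (w u))"
    by (rule continuous_on_subset[OF killed_rate_path_continuous[OF A w]]) auto
  have "integral {0..t} (\<lambda>s. \<psi>_trunc \<beta> \<nu> A (w s)) = integral {0..t} (\<lambda>s. killed_rate A (w s) - measure \<nu> A)"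
    by (simp add: killed_rate_def)
  also have "\<dots> = integral {0..t} (\<lambda>s. killed_rate A (w s)) - integral {0..t} (\<lambda>s. measure \<nu> A)"
    by (rule Henstock_Kurzweil_Integration.integral_diff[OF integrable_continuous_real[OF c] integrable_const_ivl])
  finally show ?thesis using t by (simp add: survival_def inner_vec_def algebra_simps)
qed

end

lemma cbi_process_path:
  assumes "cbi_process c \<beta> B \<nu> \<mu> M X"
  obtains P where "cbi_path c \<beta> B \<nu> \<mu> P M X"
proof -
  obtain P where "cbi_semigroup c \<beta> B \<nu> \<mu> P" "markov_process P M X"
    using assms unfolding cbi_process_def by blast
  then have "cbi_path c \<beta> B \<nu> \<mu> P M X"
    using assms unfolding cbi_process_def by unfold_locales auto
  then show ?thesis by (rule that)
qed

theorem proposition5p1: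
  fixes c \<beta> :: "real ^ 'n::finite" and B :: "real ^ 'n ^ 'n"
    and \<nu> :: "(real ^ 'n) measure" and \<mu> :: "'n \<Rightarrow> (real ^ 'n) measure"
    and M :: "'w measure" and X :: "real \<Rightarrow> 'w \<Rightarrow> real ^ 'n"
  assumes "cbi_process c \<beta> B \<nu> \<mu> M X"
    and "(\<integral>\<^sup>+ r. ennreal (norm r) * indicator {r. norm r \<ge> 1} r \<partial>\<nu>) < \<infinity>"
  shows
    "(\<forall>r>0. \<forall>t>0. \<forall>x\<in>orthant.
        \<P>(\<omega> in M. J X t (Kc r) \<omega> < \<infinity>) = 1 \<and>
        (\<forall>Px w. cbi_process_from c \<beta> B \<nu> \<mu> x Px X \<longrightarrow> is_v_tilde c B \<mu> (Kc r) w \<longrightarrow>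
          \<P>(\<omega> in Px. sup_jump X t \<omega> \<le> ereal r)
            = exp (- measure \<nu> (Kc r) * t - (\<Sum>l\<in>UNIV. x $ l * w t $ l)
                - integral {0..t} (\<lambda>s. \<psi>_trunc \<beta> \<nu> (Kc r) (w s))))) \<and>
     (emeasure \<nu> punctured_orthant + (\<Sum>i\<in>UNIV. emeasure (\<mu> i) punctured_orthant) < \<infinity> \<longrightarrow>
      (\<forall>t>0. \<forall>x\<in>orthant.
        \<P>(\<omega> in M. J X t punctured_orthant \<omega> < \<infinity>) = 1 \<and>
        (\<forall>Px w. cbi_process_from c \<beta> B \<nu> \<mu> x Px X \<longrightarrow> is_v_tilde c B \<mu> punctured_orthant w \<longrightarrow>
          \<P>(\<omega> in Px. sup_jump X t \<omega> = 0)
            = exp (- measure \<nu> punctured_orthant * t - (\<Sum>l\<in>UNIV. x $ l * w t $ l)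
                - integral {0..t} (\<lambda>s. \<beta> \<bullet> w s)))))"
proof -
  obtain P0 where "cbi_path c \<beta> B \<nu> \<mu> P0 M X" using cbi_process_path[OF assms(1)] .
  then interpret X0: cbi_path c \<beta> B \<nu> \<mu> P0 M X .
  have formula: "\<P>(\<omega> in Px. sup_jump X t \<omega> \<le> ereal r)
            = exp (- measure \<nu> (Kc r) * t - (\<Sum>l\<in>UNIV. x $ l * w t $ l)
                - integral {0..t} (\<lambda>s. \<psi>_trunc \<beta> \<nu> (Kc r) (w s)))"
    if r: "0 \<le> r" and A: "X0.finite_jump_set (Kc r)" and t: "0 < t" and x: "x \<in> orthant"
      and Px: "cbi_process_from c \<beta> B \<nu> \<mu> x Px X" and w: "is_v_tilde c B \<mu> (Kc r) w" for r t x Px w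
  proof -
    have cp: "cbi_process c \<beta> B \<nu> \<mu> Px X" and ae: "AE \<omega> in Px. X 0 \<omega> = x"
      using Px unfolding cbi_process_from_def by auto
    obtain P where "cbi_path c \<beta> B \<nu> \<mu> P Px X" using cbi_process_path[OF cp] .
    then interpret Y: cbi_path c \<beta> B \<nu> \<mu> P Px X .
    have w': "orthant_solution (X0.killed_field (Kc r)) 0 w" by (rule X0.killed_solution[OF w])
    have "\<P>(\<omega> in Px. sup_jump X t \<omega> \<le> ereal r) = measure Px (Y.no_jump t r)"
      unfolding Y.no_jump_def sup_jump_le_iff[OF r] ..
    also have "\<dots> = Y.survival (Kc r) w t x"
      by (rule Y.prob_no_jump[OF r A w' t ae x])
    finally show ?thesis using t by (simp add: Y.survival_eq[OF A w'])
  qed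
  show ?thesis
  proof (intro conjI allI impI ballI)
    fix r t :: real and x :: "real ^ 'n" assume r: "0 < r" and t: "0 < t" and x: "x \<in> orthant"
    show "\<P>(\<omega> in M. J X t (Kc r) \<omega> < \<infinity>) = 1" by (rule X0.prob_finitely_many_large_jumps[OF r])
    fix Px w assume "cbi_process_from c \<beta> B \<nu> \<mu> x Px X" "is_v_tilde c B \<mu> (Kc r) w"
    moreover have "X0.finite_jump_set (Kc r)"
      unfolding X0.finite_jump_set_def using X0.Kc_finite[OF r] X0.levy_setsI Kc_borel[of r] r by (auto simp: Kc_def)
    ultimately show "\<P>(\<omega> in Px. sup_jump X t \<omega> \<le> ereal r)
            = exp (- measure \<nu> (Kc r) * t - (\<Sum>l\<in>UNIV. x $ l * w t $ l)
                - integral {0..t} (\<lambda>s. \<psi>_trunc \<beta> \<nu> (Kc r) (w s)))"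
      using r t x by (intro formula) auto
  next
    fix t :: real and x :: "real ^ 'n"
    assume fin: "emeasure \<nu> punctured_orthant + (\<Sum>i\<in>UNIV. emeasure (\<mu> i) punctured_orthant) < \<infinity>"
      and t: "0 < t" and x: "x \<in> orthant"
    have K0: "Kc 0 = (punctured_orthant :: (real ^ 'n) set)"
      unfolding Kc_eq[OF order_refl] punctured_orthant_def by auto
    have A: "X0.finite_jump_set (Kc 0)"
      unfolding X0.finite_jump_set_def K0
    proof (intro allI impI conjI)
      fix N :: "(real ^ 'n) measure" assume N: "X0.levy_measure N"
      show "punctured_orthant \<in> sets N" by (rule X0.levy_setsI[OF N punctured_borel order_refl])
      have "emeasure (\<mu> i) punctured_orthant \<le> (\<Sum>i\<in>UNIV. emeasure (\<mu> i) punctured_orthant)" for i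
        by (rule member_le_sum) auto
      then show "emeasure N punctured_orthant < \<infinity>"
        using N fin unfolding X0.levy_measure_def by (auto simp: ennreal_add_less_top intro: order_le_less_trans)
    qed
    show "\<P>(\<omega> in M. J X t punctured_orthant \<omega> < \<infinity>) = 1"
      by (rule X0.prob_finitely_many_jumps[OF A t])
    fix Px w assume Px: "cbi_process_from c \<beta> B \<nu> \<mu> x Px X" and w: "is_v_tilde c B \<mu> punctured_orthant w"
    have "\<psi>_trunc \<beta> \<nu> punctured_orthant u = \<beta> \<bullet> u" for u
      by (simp add: \<psi>_trunc_def set_lebesgue_integral_def)
    then show "\<P>(\<omega> in Px. sup_jump X t \<omega> = 0)
            = exp (- measure \<nu> punctured_orthant * t - (\<Sum>l\<in>UNIV. x $ l * w t $ l)
                - integral {0..t} (\<lambda>s. \<beta> \<bullet> w s))"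
      using formula[OF order_refl A t x Px] w unfolding K0 sup_jump_eq_0_iff[OF t] by simp
  qed
qed

end
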